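(* Fix positive integers $k,m$ and let $\tau$ be a tau-function of the extended bigraded Toda hierarchy with wave operators $W,\bar W$. Then for every $p\ge0$, with $a=L^p(M-\bar M)$ and $h=L_{p-1}\tau$, one has $$-\frac{(a_-W)z^s}{Wz^s}=G(z)\frac h\tau-\frac h\tau,\qquad \frac{(a_+\bar W)z^s}{\bar Wz^s}=\bar G(z)\frac h\tau-\frac h\tau .$$ (Equivalently, the vector field on tau-functions induced by $\partial^*_{L^p(M-\bar M)}$ via these relations equals $L_{p-1}$ up to adding a function from $\mathcal F$.)
   Context: Let $s$ be a variable, $\Lambda$ the shift $(\Lambda f)(s)=f(s+1)$, $\mathcal A$ the space of formal difference operators $\sum_{i\in\mathbb Z}a_i(s)\Lambda^i$, with projections $A_+=\sum_{i\ge0}a_i\Lambda^i$, $A_-=\sum_{i<0}a_i\Lambda^i$; $\mathcal A_{++}$ ($\mathcal A_{--}$) are operators with powers of $\Lambda$ bounded below (above), which are algebras under $(a(s)\Lambda^i)(b(s)\Lambda^j)=a(s)b(s+i)\Lambda^{i+j}$; $\mathcal A_{\mathrm{fin}}=\mathcal A_{++}\cap\mathcal A_{--}$. Operators act on $z^s$ by $(a(s)\Lambda^i\partial_s^j)z^s=a(s)z^i(\log z)^jz^s$. Fix $k,m\ge1$. Variables: $s=x_0$, $\mathbf x=(x_1,x_2,\dots)$, $\mathbf t=(t_1,t_2,\dots)$, $\bar{\mathbf t}=(\bar t_1,\bar t_2,\dots)$, where $t_{nk}$ and $\bar t_{nm}$ are distinct variables; $\partial_{x_0}=\partial_s$. Let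 $[z]=(z,z^2/2,z^3/3,\dots)$; for a function $g(s,\mathbf t,\bar{\mathbf t},\mathbf x)$ put $G(z)g=g(s,\mathbf t-[z^{-1}],\bar{\mathbf t},\mathbf x)$ and $\bar G(z)g=g(s+1,\mathbf t,\bar{\mathbf t}+[z],\mathbf x)$. A tau-function of the EBTH is a function $\tau(s,\mathbf t,\bar{\mathbf t},\mathbf x)$ such that, writing $G(z)\tau/\tau=1+\sum_{i\ge1}w_iz^{-i}$ and $\bar G(z)\tau/\tau=\sum_{i\ge0}\bar w_iz^i$, the operators $W=1+\sum_{i\ge1}w_i\Lambda^{-i}$, $\bar W=\sum_{i\ge0}\bar w_i\Lambda^i$ ($\bar w_0\ne0$) satisfy $W\Lambda^kW^{-1}=\bar W\Lambda^{-m}\bar W^{-1}=:L$ with $L=\Lambda^k+u_{k-1}\Lambda^{k-1}+\dots+u_{-m}\Lambda^{-m}$, $u_{-m}\ne0$, and the EBTH flows $\partial_{t_n}W=-(L^{\frac nk})_-W$, $\partial_{t_n}\bar W=(L^{\frac nk})_+\bar W$, $\partial_{\bar t_n}W=-(L^{\frac nm})_-W$, $\partial_{\bar t_n}\bar W=(L^{\frac nm})_+\bar W$ ($n\ge1$), $\partial_{x_n}W=-(2L^n\log L)_-W$, $\partial_{x_n}\bar W=(2L^n\log L)_+\bar W$ ($n\ge0$) hold. Here for $n\in\mathbb Z$, $L^{\frac nk}:=W\Lambda^nW^{-1}$, $L^{\frac nm}:=\bar W\Lambda^{-n}\bar W^{-1}$, and $\log L=\frac12W\partial_sW^{-1}-\frac12\bar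 W\partial_s\bar W^{-1}$. $\mathcal F$ denotes the space of functions $f(s,\mathbf x)$ with $f(s+1,\mathbf x)=f(s,\mathbf x)$. Define the difference operator $M-\bar M=\frac1kWs\Lambda^{-k}W^{-1}+\frac1m\bar Ws\Lambda^m\bar W^{-1}+\sum_{n\ge1}\bigl((\frac1k+\frac1m)x_n+2nx_n\log L\bigr)L^{n-1}+\sum_{n\ge1}\bigl(\frac nkt_nL^{\frac{n-k}{k}}+\frac nm\bar t_nL^{\frac{n-m}{m}}\bigr)$ (here $s$ denotes multiplication by $s$; sums formal). Define differential operators in $x_0=s,x_n,t_n,\bar t_n$: $D_0=\frac1k\sum_{n\ge1}\bigl(x_{n+1}\partial_{t_{nk}}+(n+k)t_{n+k}\partial_{t_n}\bigr)+\frac1{2k}\sum_{n=1}^{k-1}nt_n(k-n)t_{k-n}+\frac1m\sum_{n\ge1}\bigl(x_{n+1}\partial_{\bar t_{nm}}+(n+m)\bar t_{n+m}\partial_{\bar t_n}\bigr)+\frac1{2m}\sum_{n=1}^{m-1}n\bar t_n(m-n)\bar t_{m-n}+\sum_{n\ge1}nx_n\partial_{x_{n-1}}+(\frac1k+\frac1m)x_0x_1+x_0(t_k+\bar t_m)$; $D_1=\frac1k\sum_{n\ge1}(x_n\partial_{t_{nk}}+nt_n\partial_{t_n})+\frac1m\sum_{n\ge1}(x_n\partial_{\bar t_{nm}}+n\bar t_n\partial_{\bar t_n})+\sum_{n\ge1}nx_n\partial_{x_n}+(\frac1k+\frac1m)\frac{x_0^2}2$; for $p\ge1$: $D_{p+1}=\sum_{n\ge1}nx_n\partial_{x_{p+n}}+\frac1k\sum_{n\ge0}(x_n\partial_{t_{(p+n)k}}+nt_n\partial_{t_{pk+n}})+\frac1{2k}\sum_{n=1}^{pk-1}\partial_{t_n}\partial_{t_{pk-n}}+\frac1m\sum_{n\ge0}(x_n\partial_{\bar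 t_{(p+n)m}}+n\bar t_n\partial_{\bar t_{pm+n}})+\frac1{2m}\sum_{n=1}^{pm-1}\partial_{\bar t_n}\partial_{\bar t_{pm-n}}$. Then $L_{-1}=D_0+\frac{k-1}2t_k-\frac{m+1}2\bar t_m$, $L_0=D_1-(\frac1{2k}+\frac1{2m})x_0+\frac{(k+m)(km+2)}{24km}$, and $L_p=D_{p+1}-\frac1{2k}\partial_{t_{pk}}-\frac1{2m}\partial_{\bar t_{pm}}$ for $p\ge1$. *)

theory Defs
  imports "HOL-Analysis.Analysis" "HOL-Library.Poly_Mapping"
begin

text \<open>Variables: T n is t_n, TB n is the barred variable, X n is x_n (all for n >= 1;
  index 0 is a dummy that tau-functions may not depend on).  x_0 = s is treated separately
  as the real shift variable.  Functions of (s,t,tbar,x) are formal power series in the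
  variables T n, TB n, X n whose coefficients are complex functions of the real variable s.\<close>

datatype var = T nat | TB nat | X nat

type_synonym mono = "var \<Rightarrow>\<^sub>0 nat"
type_synonym R = "mono \<Rightarrow> real \<Rightarrow> complex"
type_synonym op = "int \<Rightarrow> R"    (* formal difference operator: coefficient of Lambda^i *)
type_synonym zser = "int \<Rightarrow> R"  (* formal Laurent series in z: coefficient of z^i *)

definition rzero :: R where "rzero = (\<lambda>\<alpha> s. 0)"
definition rone :: R where "rone = (\<lambda>\<alpha> s. if \<alpha> = 0 then 1 else 0)"
definition radd :: "R \<Rightarrow> R \<Rightarrow> R" where "radd f g = (\<lambda>\<alpha> s. f \<alpha> s + g \<alpha> s)"
definition rscale :: "complex \<Rightarrow> R \<Rightarrow> R" where "rscale c f = (\<lambda>\<alpha> s. c * f \<alpha> s)"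
definition rmul :: "R \<Rightarrow> R \<Rightarrow> R" where
  "rmul f g = (\<lambda>\<alpha> s. \<Sum>(\<beta>,\<gamma>) \<in> {(\<beta>,\<gamma>). \<beta> + \<gamma> = \<alpha>}. f \<beta> s * g \<gamma> s)"
definition rshift :: "int \<Rightarrow> R \<Rightarrow> R" where "rshift i f = (\<lambda>\<alpha> s. f \<alpha> (s + of_int i))"
definition rvar :: "var \<Rightarrow> R \<Rightarrow> R" where
  "rvar v f = (\<lambda>\<alpha> s. if 1 \<le> Poly_Mapping.lookup \<alpha> v then f (\<alpha> - Poly_Mapping.single v 1) s else 0)"
definition rS :: "R \<Rightarrow> R" where "rS f = (\<lambda>\<alpha> s. complex_of_real s * f \<alpha> s)"
definition xmul :: "nat \<Rightarrow> R \<Rightarrow> R" where "xmul n f = (if n = 0 then rS f else rvar (X n) f)"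
definition rdvar :: "var \<Rightarrow> R \<Rightarrow> R" where
  "rdvar v f = (\<lambda>\<alpha> s. of_nat (Poly_Mapping.lookup \<alpha> v + 1) * f (\<alpha> + Poly_Mapping.single v 1) s)"
definition rds :: "R \<Rightarrow> R" where "rds f = (\<lambda>\<alpha> s. vector_derivative (\<lambda>\<sigma>. f \<alpha> \<sigma>) (at s))"
definition dX :: "nat \<Rightarrow> R \<Rightarrow> R" where "dX n f = (if n = 0 then rds f else rdvar (X n) f)"
definition rinv :: "R \<Rightarrow> R" where "rinv g = (THE v. rmul g v = rone)"
definition rdiv :: "R \<Rightarrow> R \<Rightarrow> R" where "rdiv f g = rmul f (rinv g)"
definition rsum :: "(nat \<Rightarrow> R) \<Rightarrow> R" where
  "rsum F = (\<lambda>\<alpha> s. \<Sum>n \<in> {n. F n \<alpha> s \<noteq> 0}. F n \<alpha> s)"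

definition smooth_s :: "(real \<Rightarrow> complex) \<Rightarrow> bool" where
  "smooth_s g \<longleftrightarrow> (\<forall>j s. ((\<lambda>h t. vector_derivative h (at t)) ^^ j) g differentiable (at s))"

definition opadd :: "op \<Rightarrow> op \<Rightarrow> op" where "opadd A B = (\<lambda>i. radd (A i) (B i))"
definition opscale :: "complex \<Rightarrow> op \<Rightarrow> op" where "opscale c A = (\<lambda>i. rscale c (A i))"
definition opmap :: "(R \<Rightarrow> R) \<Rightarrow> op \<Rightarrow> op" where "opmap F A = (\<lambda>i. F (A i))"
text \<open>(a(s) Lambda^i)(b(s) Lambda^j) = a(s) b(s+i) Lambda^(i+j)\<close>
definition opmul :: "op \<Rightarrow> op \<Rightarrow> op" where
  "opmul A B = (\<lambda>n \<alpha> s. \<Sum>i \<in> {i. A i \<noteq> rzero \<and> B (n - i) \<noteq> rzero}.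
                       rmul (A i) (rshift i (B (n - i))) \<alpha> s)"
definition lam :: "int \<Rightarrow> op" where "lam i = (\<lambda>j. if j = i then rone else rzero)"
definition sLam :: "int \<Rightarrow> op" where "sLam i = (\<lambda>j. if j = i then rS rone else rzero)"
definition oppow :: "op \<Rightarrow> nat \<Rightarrow> op" where "oppow A n = ((opmul A) ^^ n) (lam 0)"
definition opminus :: "op \<Rightarrow> op" where "opminus A = (\<lambda>i. if i < 0 then A i else rzero)"
definition opplus :: "op \<Rightarrow> op" where "opplus A = (\<lambda>i. if 0 \<le> i then A i else rzero)"
definition inv_mm :: "op \<Rightarrow> op" where
  "inv_mm A = (THE V. (\<exists>N. \<forall>i>N. V i = rzero) \<and> opmul A V = lam 0)"
definition inv_pp :: "op \<Rightarrow> op" where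
  "inv_pp A = (THE V. (\<exists>N. \<forall>i<N. V i = rzero) \<and> opmul A V = lam 0)"
definition opsum :: "(nat \<Rightarrow> op) \<Rightarrow> op" where
  "opsum F = (\<lambda>i. rsum (\<lambda>n. F n i))"

text \<open>Applying an operator to z^s and dividing by z^s gives the series with the same coefficients;
  products of such series carry no shift.\<close>
definition smul :: "zser \<Rightarrow> zser \<Rightarrow> zser" where
  "smul A B = (\<lambda>n \<alpha> s. \<Sum>i \<in> {i. A i \<noteq> rzero \<and> B (n - i) \<noteq> rzero}. rmul (A i) (B (n - i)) \<alpha> s)"
definition sdiv_minus :: "zser \<Rightarrow> zser \<Rightarrow> zser" where
  "sdiv_minus N D = (THE Q. (\<exists>B. \<forall>i>B. Q i = rzero) \<and> smul Q D = N)"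
definition sdiv_plus :: "zser \<Rightarrow> zser \<Rightarrow> zser" where
  "sdiv_plus N D = (THE Q. (\<exists>B. \<forall>i<B. Q i = rzero) \<and> smul Q D = N)"

definition tw :: "var \<Rightarrow> nat" where "tw v = (case v of T n \<Rightarrow> n | _ \<Rightarrow> 0)"
definition tbw :: "var \<Rightarrow> nat" where "tbw v = (case v of TB n \<Rightarrow> n | _ \<Rightarrow> 0)"

text \<open>G(z) f = f(s, t - [z^{-1}], tbar, x), expanded formally (coefficient of z^j, j <= 0).\<close>
definition Gser :: "R \<Rightarrow> zser" where
  "Gser f = (\<lambda>j \<alpha> s. if j \<le> 0 then
      (\<Sum>\<gamma> \<in> {\<gamma>. Poly_Mapping.keys \<gamma> \<subseteq> {T n | n. 1 \<le> n} \<and> (\<Sum>v\<in>Poly_Mapping.keys \<gamma>. tw v * Poly_Mapping.lookup \<gamma> v) = nat (- j)}.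
         f (\<alpha> + \<gamma>) s * (\<Prod>v\<in>Poly_Mapping.keys \<gamma>. of_nat ((Poly_Mapping.lookup \<alpha> v + Poly_Mapping.lookup \<gamma> v) choose Poly_Mapping.lookup \<gamma> v)
                                     * (- 1 / of_nat (tw v)) ^ Poly_Mapping.lookup \<gamma> v))
      else 0)"

text \<open>Gbar(z) f = f(s+1, t, tbar + [z], x), expanded formally (coefficient of z^j, j >= 0).\<close>
definition Gbser :: "R \<Rightarrow> zser" where
  "Gbser f = (\<lambda>j \<alpha> s. if 0 \<le> j then
      (\<Sum>\<gamma> \<in> {\<gamma>. Poly_Mapping.keys \<gamma> \<subseteq> {TB n | n. 1 \<le> n} \<and> (\<Sum>v\<in>Poly_Mapping.keys \<gamma>. tbw v * Poly_Mapping.lookup \<gamma> v) = nat j}.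
         f (\<alpha> + \<gamma>) (s + 1) * (\<Prod>v\<in>Poly_Mapping.keys \<gamma>. of_nat ((Poly_Mapping.lookup \<alpha> v + Poly_Mapping.lookup \<gamma> v) choose Poly_Mapping.lookup \<gamma> v)
                                     * (1 / of_nat (tbw v)) ^ Poly_Mapping.lookup \<gamma> v))
      else 0)"

definition Wop :: "R \<Rightarrow> op" where
  "Wop \<tau> = (\<lambda>i. if i \<le> 0 then rdiv (Gser \<tau> i) \<tau> else rzero)"
definition Wbop :: "R \<Rightarrow> op" where
  "Wbop \<tau> = (\<lambda>i. if 0 \<le> i then rdiv (Gbser \<tau> i) \<tau> else rzero)"

text \<open>L = W Lambda^k W^{-1}; L^{n/k} = W Lambda^n W^{-1}; L^{n/m} = Wbar Lambda^{-n} Wbar^{-1}\<close>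
definition Lk :: "R \<Rightarrow> int \<Rightarrow> op" where
  "Lk \<tau> n = opmul (opmul (Wop \<tau>) (lam n)) (inv_mm (Wop \<tau>))"
definition Lm :: "R \<Rightarrow> int \<Rightarrow> op" where
  "Lm \<tau> n = opmul (opmul (Wbop \<tau>) (lam (- n))) (inv_pp (Wbop \<tau>))"
definition Lax :: "nat \<Rightarrow> R \<Rightarrow> op" where "Lax k \<tau> = Lk \<tau> (int k)"

text \<open>log L = 1/2 W d_s W^{-1} - 1/2 Wbar d_s Wbar^{-1}; since W d_s W^{-1} = d_s + W (d_s W^{-1})
  (d_s W^{-1} taken coefficientwise), the d_s terms cancel.\<close>
definition logL :: "R \<Rightarrow> op" where
  "logL \<tau> = opadd (opscale (1/2) (opmul (Wop \<tau>) (opmap rds (inv_mm (Wop \<tau>)))))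
                   (opscale (-1/2) (opmul (Wbop \<tau>) (opmap rds (inv_pp (Wbop \<tau>)))))"

definition is_tau :: "nat \<Rightarrow> nat \<Rightarrow> R \<Rightarrow> bool" where
  "is_tau k m \<tau> \<longleftrightarrow>
     (\<forall>\<alpha>. smooth_s (\<tau> \<alpha>)) \<and>
     (\<forall>\<alpha> s. (T 0 \<in> Poly_Mapping.keys \<alpha> \<or> TB 0 \<in> Poly_Mapping.keys \<alpha> \<or> X 0 \<in> Poly_Mapping.keys \<alpha>) \<longrightarrow> \<tau> \<alpha> s = 0) \<and>
     (\<exists>v. rmul \<tau> v = rone) \<and>
     Wbop \<tau> 0 \<noteq> rzero \<and>
     Lax k \<tau> = Lm \<tau> (int m) \<and>
     Lax k \<tau> (int k) = rone \<and> Lax k \<tau> (- int m) \<noteq> rzero \<and>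
     (\<forall>i. (i > int k \<or> i < - int m) \<longrightarrow> Lax k \<tau> i = rzero) \<and>
     (\<forall>n\<ge>1. opmap (rdvar (T n)) (Wop \<tau>) = opscale (-1) (opmul (opminus (Lk \<tau> (int n))) (Wop \<tau>)) \<and>
             opmap (rdvar (T n)) (Wbop \<tau>) = opmul (opplus (Lk \<tau> (int n))) (Wbop \<tau>) \<and>
             opmap (rdvar (TB n)) (Wop \<tau>) = opscale (-1) (opmul (opminus (Lm \<tau> (int n))) (Wop \<tau>)) \<and>
             opmap (rdvar (TB n)) (Wbop \<tau>) = opmul (opplus (Lm \<tau> (int n))) (Wbop \<tau>)) \<and>
     (\<forall>n. opmap (dX n) (Wop \<tau>) =
            opscale (-1) (opmul (opminus (opscale 2 (opmul (oppow (Lax k \<tau>) n) (logL \<tau>)))) (Wop \<tau>)) \<and>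
          opmap (dX n) (Wbop \<tau>) =
            opmul (opplus (opscale 2 (opmul (oppow (Lax k \<tau>) n) (logL \<tau>)))) (Wbop \<tau>))"

definition MMb :: "nat \<Rightarrow> nat \<Rightarrow> R \<Rightarrow> op" where
  "MMb k m \<tau> =
     opadd (opscale (1 / of_nat k) (opmul (opmul (Wop \<tau>) (sLam (- int k))) (inv_mm (Wop \<tau>))))
    (opadd (opscale (1 / of_nat m) (opmul (opmul (Wbop \<tau>) (sLam (int m))) (inv_pp (Wbop \<tau>))))
    (opadd (opsum (\<lambda>n. if n = 0 then (\<lambda>_. rzero) else
              opmul (opadd (opscale (1 / of_nat k + 1 / of_nat m) (opmap (rvar (X n)) (lam 0)))
                           (opscale (2 * of_nat n) (opmap (rvar (X n)) (logL \<tau>))))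
                    (oppow (Lax k \<tau>) (n - 1))))
           (opsum (\<lambda>n. if n = 0 then (\<lambda>_. rzero) else
              opadd (opscale (of_nat n / of_nat k) (opmap (rvar (T n)) (Lk \<tau> (int n - int k))))
                    (opscale (of_nat n / of_nat m) (opmap (rvar (TB n)) (Lm \<tau> (int n - int m))))))))"

definition D0 :: "nat \<Rightarrow> nat \<Rightarrow> R \<Rightarrow> R" where
  "D0 k m f = (\<lambda>\<alpha> s.
     (1 / of_nat k) * rsum (\<lambda>n. if n = 0 then rzero else
        radd (rvar (X (n+1)) (rdvar (T (n*k)) f)) (rscale (of_nat (n+k)) (rvar (T (n+k)) (rdvar (T n) f)))) \<alpha> s
   + (1 / (2 * of_nat k)) * (\<Sum>n=1..k-1. of_nat (n * (k - n)) * rvar (T n) (rvar (T (k - n)) f) \<alpha> s)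
   + (1 / of_nat m) * rsum (\<lambda>n. if n = 0 then rzero else
        radd (rvar (X (n+1)) (rdvar (TB (n*m)) f)) (rscale (of_nat (n+m)) (rvar (TB (n+m)) (rdvar (TB n) f)))) \<alpha> s
   + (1 / (2 * of_nat m)) * (\<Sum>n=1..m-1. of_nat (n * (m - n)) * rvar (TB n) (rvar (TB (m - n)) f) \<alpha> s)
   + rsum (\<lambda>n. if n = 0 then rzero else rscale (of_nat n) (rvar (X n) (dX (n - 1) f))) \<alpha> s
   + (1 / of_nat k + 1 / of_nat m) * rS (rvar (X 1) f) \<alpha> s
   + rS (radd (rvar (T k) f) (rvar (TB m) f)) \<alpha> s)"

definition D1 :: "nat \<Rightarrow> nat \<Rightarrow> R \<Rightarrow> R" where
  "D1 k m f = (\<lambda>\<alpha> s.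
     (1 / of_nat k) * rsum (\<lambda>n. if n = 0 then rzero else
        radd (rvar (X n) (rdvar (T (n*k)) f)) (rscale (of_nat n) (rvar (T n) (rdvar (T n) f)))) \<alpha> s
   + (1 / of_nat m) * rsum (\<lambda>n. if n = 0 then rzero else
        radd (rvar (X n) (rdvar (TB (n*m)) f)) (rscale (of_nat n) (rvar (TB n) (rdvar (TB n) f)))) \<alpha> s
   + rsum (\<lambda>n. if n = 0 then rzero else rscale (of_nat n) (rvar (X n) (rdvar (X n) f))) \<alpha> s
   + (1 / of_nat k + 1 / of_nat m) / 2 * rS (rS f) \<alpha> s)"

text \<open>D_{p+1} for p >= 1 (here n t_n vanishes for n = 0, and x_0 = s)\<close>
definition Dsucc :: "nat \<Rightarrow> nat \<Rightarrow> nat \<Rightarrow> R \<Rightarrow> R" where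
  "Dsucc k m p f = (\<lambda>\<alpha> s.
     rsum (\<lambda>n. if n = 0 then rzero else rscale (of_nat n) (rvar (X n) (rdvar (X (p+n)) f))) \<alpha> s
   + (1 / of_nat k) * rsum (\<lambda>n.
        radd (xmul n (rdvar (T ((p+n)*k)) f))
             (if n = 0 then rzero else rscale (of_nat n) (rvar (T n) (rdvar (T (p*k+n)) f)))) \<alpha> s
   + (1 / (2 * of_nat k)) * (\<Sum>n=1..p*k-1. rdvar (T n) (rdvar (T (p*k - n)) f) \<alpha> s)
   + (1 / of_nat m) * rsum (\<lambda>n.
        radd (xmul n (rdvar (TB ((p+n)*m)) f))
             (if n = 0 then rzero else rscale (of_nat n) (rvar (TB n) (rdvar (TB (p*m+n)) f)))) \<alpha> s
   + (1 / (2 * of_nat m)) * (\<Sum>n=1..p*m-1. rdvar (TB n) (rdvar (TB (p*m - n)) f) \<alpha> s))"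

text \<open>Vir k m p f is L_{p-1} f (p :: nat, so p - 1 ranges over -1, 0, 1, ...)\<close>
definition Vir :: "nat \<Rightarrow> nat \<Rightarrow> nat \<Rightarrow> R \<Rightarrow> R" where
  "Vir k m p f =
    (if p = 0 then (\<lambda>\<alpha> s. D0 k m f \<alpha> s + (of_nat k - 1) / 2 * rvar (T k) f \<alpha> s
                                       - (of_nat m + 1) / 2 * rvar (TB m) f \<alpha> s)
     else if p = 1 then (\<lambda>\<alpha> s. D1 k m f \<alpha> s - (1 / (2 * of_nat k) + 1 / (2 * of_nat m)) * rS f \<alpha> s
              + (of_nat (k + m) * (of_nat (k * m) + 2)) / (24 * of_nat k * of_nat m) * f \<alpha> s)
     else (\<lambda>\<alpha> s. Dsucc k m (p - 1) f \<alpha> s - 1 / (2 * of_nat k) * rdvar (T ((p - 1) * k)) f \<alpha> s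
                                         - 1 / (2 * of_nat m) * rdvar (TB ((p - 1) * m)) f \<alpha> s))"

end

theory Submission
  imports Defs "HOL-Library.Function_Algebras"
begin

text \<open>
  Everything is read off from the Sato equations \<open>\<partial>W = - (\<dots>)\<^sub>- W\<close>, \<open>\<partial>W' = (\<dots>)\<^sub>+ W'\<close> for the two
  wave operators; no bilinear identity is needed.  Multiplying the claim for \<open>h\<close> by \<open>\<tau>\<close> turns it into
  \<open>- \<tau> (a\<^sub>- W) z\<^sup>s / z\<^sup>s = G(z) h - (h / \<tau>) G(z) \<tau>\<close> (and similarly for the other sign), in which both
  sides are linear, in \<open>a\<close> and in \<open>h\<close>, so that the summands of \<open>L\<^sup>p (M - M')\<close> can be treated one by
  one.  For a power of \<open>L\<close>, or for \<open>L\<^sup>n log L\<close>, the claim is the corresponding flow.  The operators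
  \<open>W s \<Lambda>\<^sup>j W\<^sup>-\<^sup>1\<close> are reduced to powers of \<open>L\<close>: Euler's identity
  \<open>z \<partial>\<^sub>z G(z) \<tau> = \<Sum>\<^sub>n z\<^sup>-\<^sup>n G(z) \<partial>\<^bsub>t n\<^esub> \<tau>\<close> expresses \<open>[W, s]\<close> as \<open>\<Sum>\<^sub>n (\<partial>\<^bsub>t n\<^esub> log \<tau> + \<partial>\<^bsub>t n\<^esub>) W \<Lambda>\<^sup>-\<^sup>n\<close>, the part \<open>n > j\<close> of this
  sum matches the commutator of \<open>G(z)\<close> with the factors \<open>t\<^sub>n\<close>, and the part \<open>n < j\<close>, symmetrised under
  \<open>n \<mapsto> j - n\<close> by means of the zero curvature equations, gives the second order derivatives.  The
  infinite sums over the variables are cut off at \<open>N\<close>: coefficient by coefficient the identity is exact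
  for large \<open>N\<close>.
\<close>

section \<open>The ring of coefficients\<close>

text \<open>Two points shape the proof. First, W and Wbar live in different algebras (bounded above,
  bounded below). Powers of L are finite, hence in both; log L is in general in neither. So log L is
  only multiplied by finite operators, and every operator is projected before it meets a wave
  operator. Second, there is a dictionary as for the modes of a free boson: L^(n/k) with n > 0
  corresponds to d/dt_n, the identity to s, and L^(-n/k) to n t_n. Hence W s Lambda^j W^(-1),
  completed by the sum of n t_n L^((n+j)/k), corresponds to a quadratic expression in these modes.
  The linear terms of L_(p-1) are ordering terms: they come from the j - 1 pairs n + n' = j and from
  Gbar shifting s while G does not. The dictionary is not injective: L^q, q >= 1, is both the
  (kq)-th power of L^(1/k) and the (mq)-th of L^(1/m), so d/dt_(kq) tau and d/dtbar_(mq) tau have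
  the same image. This freedom reconciles the ordering terms that arise with those in the definition
  of L_(p-1) for p >= 2.\<close>

text \<open>A copy of \<open>R\<close> that can be made an instance of \<^class>\<open>comm_ring_1\<close>.\<close>

typedef fser = "UNIV :: R set" morphisms coeff of_coeff by auto

setup_lifting type_definition_fser

text \<open>A splitting is determined by its first part on the finitely many keys of
  \<open>\<alpha>\<close>, where its exponents are bounded by those of \<open>\<alpha>\<close>. This
  makes \<open>rmul\<close> a genuine convolution, not a default-valued sum.\<close>

lemma finite_splits: "finite {(\<beta>, \<gamma>). \<beta> + \<gamma> = (\<alpha>::mono)}"
proof -
  define K where "K = Poly_Mapping.keys \<alpha>"
  define f where "f = (\<lambda>p::mono \<times> mono. (restrict (Poly_Mapping.lookup (fst p)) K))"
  let ?D = "{(\<beta>, \<gamma>). \<beta> + \<gamma> = \<alpha>}"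
  have lk: "Poly_Mapping.lookup \<beta> v + Poly_Mapping.lookup \<gamma> v = Poly_Mapping.lookup \<alpha> v"
    if "(\<beta>, \<gamma>) \<in> ?D" for \<beta> \<gamma> v using that by (auto simp: lookup_add)
  have "f ` ?D \<subseteq> (\<Pi>\<^sub>E v\<in>K. {..Poly_Mapping.lookup \<alpha> v})"
  proof (rule image_subsetI, clarify)
    fix \<beta> \<gamma> assume "\<alpha> = \<beta> + \<gamma>"
    thus "f (\<beta>, \<gamma>) \<in> (\<Pi>\<^sub>E v\<in>K. {..Poly_Mapping.lookup (\<beta> + \<gamma>) v})"
      by (auto simp: f_def lookup_add)
  qed
  moreover have "finite (\<Pi>\<^sub>E v\<in>K. {..Poly_Mapping.lookup \<alpha> v})"
    by (intro finite_PiE) (auto simp: K_def)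
  ultimately have "finite (f ` ?D)" by (rule finite_subset)
  moreover have "inj_on f ?D"
  proof (rule inj_onI)
    fix p q assume p: "p \<in> ?D" and q: "q \<in> ?D" and eq: "f p = f q"
    obtain b c where p': "p = (b, c)" by (cases p)
    obtain b' c' where q': "q = (b', c')" by (cases q)
    have "Poly_Mapping.lookup b v = Poly_Mapping.lookup b' v" for v
    proof (cases "v \<in> K")
      case True
      thus ?thesis using fun_cong[OF eq, of v] by (simp add: f_def p' q')
    next
      case False
      hence "Poly_Mapping.lookup \<alpha> v = 0" by (simp add: K_def in_keys_iff)
      thus ?thesis using lk[of b c v] lk[of b' c' v] p q by (simp add: p' q')
    qed
    hence "b = b'" by (intro poly_mapping_eqI)
    moreover have "b + c = b' + c'" using p q by (simp add: p' q')
    ultimately show "p = q" by (simp add: p' q')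
  qed
  ultimately show ?thesis by (rule finite_imageD)
qed

lemma rmul_comm: "rmul f g = rmul g f"
proof (intro ext)
  fix \<alpha> s
  show "rmul f g \<alpha> s = rmul g f \<alpha> s"
    unfolding rmul_def
    by (rule sum.reindex_bij_witness[of _ "\<lambda>(a,b). (b,a)" "\<lambda>(a,b). (b,a)"])
       (auto simp: add.commute)
qed

lemma rmul_assoc: "rmul (rmul f g) h = rmul f (rmul g h)"
proof (intro ext)
  fix \<alpha> s
  let ?D = "\<lambda>\<alpha>::mono. {(\<beta>, \<gamma>). \<beta> + \<gamma> = \<alpha>}"
  have "rmul (rmul f g) h \<alpha> s =
      (\<Sum>p\<in>?D \<alpha>. \<Sum>q\<in>?D (fst p). f (fst q) s * g (snd q) s * h (snd p) s)"
    unfolding rmul_def by (simp add: case_prod_unfold sum_distrib_right)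
  also have "\<dots> = (\<Sum>(p, q) \<in> Sigma (?D \<alpha>) (\<lambda>p. ?D (fst p)). f (fst q) s * g (snd q) s * h (snd p) s)"
    by (rule sum.Sigma) (auto simp: finite_splits)
  also have "\<dots> = (\<Sum>(p, q) \<in> Sigma (?D \<alpha>) (\<lambda>p. ?D (snd p)). f (fst p) s * (g (fst q) s * h (snd q) s))"
    by (rule sum.reindex_bij_witness[of _
        "\<lambda>(p, q). ((fst p + fst q, snd q), (fst p, fst q))"
        "\<lambda>(p, q). ((fst q, snd q + snd p), (snd q, snd p))"]) (auto simp: add.assoc)
  also have "\<dots> = (\<Sum>p\<in>?D \<alpha>. \<Sum>q\<in>?D (snd p). f (fst p) s * (g (fst q) s * h (snd q) s))"
    by (rule sum.Sigma[symmetric]) (auto simp: finite_splits)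
  also have "\<dots> = rmul f (rmul g h) \<alpha> s"
    unfolding rmul_def by (simp add: case_prod_unfold sum_distrib_left)
  finally show "rmul (rmul f g) h \<alpha> s = rmul f (rmul g h) \<alpha> s" .
qed

text \<open>By cancellation in the monoid of monomials only one splitting contributes. This is what
  turns \<open>rscale\<close> and \<open>rS\<close>, and with a support computation also
  \<open>rvar\<close>, into products with ring elements.\<close>

lemma rmul_single_supp:
  assumes "\<And>\<gamma>. \<gamma> \<noteq> \<delta> \<Longrightarrow> f \<gamma> = (\<lambda>s. 0)"
  shows "rmul f g (\<delta> + \<alpha>) s = f \<delta> s * g \<alpha> s"
proof -
  have "rmul f g (\<delta> + \<alpha>) s = (\<Sum>(\<beta>,\<gamma>) \<in> {(\<delta>, \<alpha>)}. f \<beta> s * g \<gamma> s)"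
    unfolding rmul_def using assms
    by (intro sum.mono_neutral_right finite_splits) (auto, metis, metis add_left_imp_eq)
  thus ?thesis by simp
qed

lemma rmul_rone: "rmul rone g = g"
proof (intro ext)
  fix \<alpha> s
  have "rmul rone g (0 + \<alpha>) s = rone 0 s * g \<alpha> s"
    by (rule rmul_single_supp) (simp add: rone_def)
  thus "rmul rone g \<alpha> s = g \<alpha> s" by (simp add: rone_def)
qed

instantiation fser :: comm_ring_1
begin
lift_definition zero_fser :: fser is rzero .
lift_definition one_fser :: fser is rone .
lift_definition plus_fser :: "fser \<Rightarrow> fser \<Rightarrow> fser" is radd .
lift_definition uminus_fser :: "fser \<Rightarrow> fser" is "\<lambda>f \<alpha> s. - f \<alpha> s" .
lift_definition minus_fser :: "fser \<Rightarrow> fser \<Rightarrow> fser" is "\<lambda>f g \<alpha> s. f \<alpha> s - g \<alpha> s" .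
lift_definition times_fser :: "fser \<Rightarrow> fser \<Rightarrow> fser" is rmul .
instance
proof
  fix a b c :: fser
  show "a * b * c = a * (b * c)" by transfer (rule rmul_assoc)
  show "a * b = b * a" by transfer (rule rmul_comm)
  show "1 * a = a" by transfer (rule rmul_rone)
  show "(a + b) * c = a * c + b * c"
    by transfer (simp add: radd_def rmul_def fun_eq_iff case_prod_unfold algebra_simps sum.distrib)
  show "(0::fser) \<noteq> 1" by transfer (auto simp: rzero_def rone_def fun_eq_iff)
qed (transfer; simp add: radd_def rzero_def fun_eq_iff algebra_simps)+
end

section \<open>Constants, s and the variables as ring elements; shifts and derivatives as
  maps\<close>

lift_definition fcst :: "complex \<Rightarrow> fser" is "\<lambda>c \<alpha> s. if \<alpha> = 0 then c else 0" .
lift_definition fS :: fser is "rS rone" .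
lift_definition fvar :: "var \<Rightarrow> fser" is "\<lambda>v. rvar v rone" .
lift_definition fsh :: "int \<Rightarrow> fser \<Rightarrow> fser" is rshift .
lift_definition fdv :: "var \<Rightarrow> fser \<Rightarrow> fser" is rdvar .
lift_definition fds :: "fser \<Rightarrow> fser" is rds .
lift_definition fdX :: "nat \<Rightarrow> fser \<Rightarrow> fser" is dX .
lift_definition fdiff :: "fser \<Rightarrow> bool" is "\<lambda>f. \<forall>\<alpha> s. f \<alpha> differentiable (at s)" .

lemma rscale_eq: "rscale c (coeff f) = coeff (fcst c * f)"
proof (transfer, intro ext)
  fix c f \<alpha> s
  have "rmul (\<lambda>\<alpha> s. if \<alpha> = 0 then c else 0) f (0 + \<alpha>) s = c * f \<alpha> s"
    by (subst rmul_single_supp) auto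
  thus "rscale c f \<alpha> s = rmul (\<lambda>\<alpha> s. if \<alpha> = 0 then c else 0) f \<alpha> s"
    by (simp add: rscale_def)
qed

lemma rS_eq: "rS (coeff f) = coeff (fS * f)"
proof (transfer, intro ext)
  fix f \<alpha> s
  have "rmul (rS rone) f (0 + \<alpha>) s = complex_of_real s * f \<alpha> s"
    by (subst rmul_single_supp) (auto simp: rS_def rone_def)
  thus "rS f \<alpha> s = rmul (rS rone) f \<alpha> s" by (simp add: rS_def)
qed

lemma rvar_eq: "rvar v (coeff f) = coeff (fvar v * f)"
proof (transfer, intro ext)
  fix v :: var and f \<alpha> s
  let ?e = "Poly_Mapping.single v (1::nat)"
  have supp: "rvar v rone \<gamma> = (\<lambda>s. 0)" if "\<gamma> \<noteq> ?e" for \<gamma>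
  proof (cases "1 \<le> Poly_Mapping.lookup \<gamma> v")
    case True
    have "\<gamma> - ?e \<noteq> 0"
    proof
      assume "\<gamma> - ?e = 0"
      moreover have "?e + (\<gamma> - ?e) = \<gamma>"
        using True by (intro poly_mapping_eqI) (auto simp: lookup_add lookup_minus lookup_single when_def)
      ultimately show False using that by simp
    qed
    thus ?thesis by (simp add: rvar_def rone_def fun_eq_iff)
  qed (simp add: rvar_def fun_eq_iff)
  show "rvar v f \<alpha> s = rmul (rvar v rone) f \<alpha> s"
  proof (cases "1 \<le> Poly_Mapping.lookup \<alpha> v")
    case True
    have eq: "?e + (\<alpha> - ?e) = \<alpha>"
      using True by (intro poly_mapping_eqI) (auto simp: lookup_add lookup_minus lookup_single when_def)
    have "rmul (rvar v rone) f (?e + (\<alpha> - ?e)) s = rvar v rone ?e s * f (\<alpha> - ?e) s"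
      by (rule rmul_single_supp[OF supp])
    thus ?thesis unfolding eq using True by (simp add: rvar_def rone_def)
  next
    case False
    have "rvar v rone \<beta> s = 0" if "\<beta> + \<gamma> = \<alpha>" for \<beta> \<gamma>
      using False that by (auto simp: rvar_def lookup_add)
    hence "rmul (rvar v rone) f \<alpha> s = 0" unfolding rmul_def by (intro sum.neutral) auto
    thus ?thesis using False by (simp add: rvar_def)
  qed
qed

lemma fcst_0 [simp]: "fcst 0 = 0"
  and fcst_1 [simp]: "fcst 1 = 1"
  and fcst_add: "fcst (a + b) = fcst a + fcst b"
  and fcst_minus: "fcst (- a) = - fcst a"
  and fcst_diff: "fcst (a - b) = fcst a - fcst b"
  by (transfer; auto simp: rzero_def rone_def radd_def fun_eq_iff)+

lemma fcst_mult: "fcst (a * b) = fcst a * fcst b"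
proof -
  have "coeff (fcst a * fcst b) = rscale a (coeff (fcst b))" by (simp add: rscale_eq)
  also have "\<dots> = coeff (fcst (a * b))" by transfer (auto simp: rscale_def)
  finally show ?thesis by (simp add: coeff_inject)
qed

lemma of_nat_fser: "of_nat n = fcst (of_nat n)"
  by (induction n) (simp_all add: fcst_add)

lemma of_int_fser: "of_int n = fcst (of_int n)"
  by (cases n rule: int_cases2) (simp_all add: of_nat_fser fcst_minus)

lemma numeral_fser: "numeral n = fcst (numeral n)"
  using of_nat_fser[of "numeral n"] by simp

lemma fcst_unit: "c \<noteq> 0 \<Longrightarrow> fcst (inverse c) * fcst c = 1"
  by (simp flip: fcst_mult)

text \<open>Nonzero integers are units, inverted by constant series. This allows division by N in
  Euler's identity and by 2 in the symmetrised identities.\<close>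

lemma of_int_fser_cancel: "(n::int) \<noteq> 0 \<Longrightarrow> of_int n * x = of_int n * y \<Longrightarrow> x = (y::fser)"
  by (metis fcst_unit of_int_fser mult.assoc mult_1 of_int_eq_0_iff)

lemma fsh_0 [simp]: "fsh i 0 = 0" and fsh_1 [simp]: "fsh i 1 = 1"
  and fsh_cst [simp]: "fsh i (fcst c) = fcst c"
  and fsh_var [simp]: "fsh i (fvar v) = fvar v"
  and fsh_S: "fsh i fS = fS + of_int i"
  and fsh_add: "fsh i (f + g) = fsh i f + fsh i g"
  and fsh_minus: "fsh i (- f) = - fsh i f"
  and fsh_mult: "fsh i (f * g) = fsh i f * fsh i g"
  and fsh_fsh [simp]: "fsh i (fsh j f) = fsh (i + j) f"
  and fsh_zero [simp]: "fsh 0 f = f"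
  unfolding of_int_fser
  by (transfer; auto simp: rshift_def rS_def rzero_def rone_def radd_def rvar_def rmul_def fun_eq_iff algebra_simps)+

lemma fsh_of_int [simp]: "fsh i (of_int n) = of_int n" and fsh_of_nat [simp]: "fsh i (of_nat m) = of_nat m"
  by (simp_all add: of_int_fser of_nat_fser)

lemma fsh_sum: "fsh i (sum f A) = (\<Sum>x\<in>A. fsh i (f x))"
  by (induction A rule: infinite_finite_induct) (auto simp: fsh_add)

lemma coeff_sum: "coeff (sum f A) \<alpha> s = (\<Sum>x\<in>A. coeff (f x) \<alpha> s)"
  by (induction A rule: infinite_finite_induct)
     (auto simp: zero_fser.rep_eq plus_fser.rep_eq rzero_def radd_def)

lemma fser_eqI: "(\<And>\<alpha> s. coeff f \<alpha> s = coeff g \<alpha> s) \<Longrightarrow> f = g"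
  by (simp add: fun_eq_iff flip: coeff_inject)

lemma lookup_split_single:
  "\<beta> + \<gamma> = \<alpha> + Poly_Mapping.single v (1::nat) \<Longrightarrow>
   Poly_Mapping.lookup \<beta> v + Poly_Mapping.lookup \<gamma> v = Poly_Mapping.lookup \<alpha> v + 1"
  by (metis lookup_add lookup_single_eq)

lemma minus_single_plus:
  "Poly_Mapping.lookup \<beta> v \<noteq> 0 \<Longrightarrow> \<beta> - Poly_Mapping.single v (1::nat) + Poly_Mapping.single v 1 = (\<beta>::mono)"
  by (intro poly_mapping_eqI) (auto simp: lookup_add lookup_minus lookup_single when_def)

text \<open>One half of the Leibniz rule: only the exponent of \<open>v\<close> in the first factor
  is counted. Splittings where it is 0 drop out; in the others one factor \<open>v\<close> is
  removed.\<close>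

lemma rdvar_rmul_aux:
  "(\<Sum>(\<beta>,\<gamma>) \<in> {(\<beta>,\<gamma>). \<beta> + \<gamma> = \<alpha> + Poly_Mapping.single v 1}.
       of_nat (Poly_Mapping.lookup \<beta> v) * (f \<beta> s * g \<gamma> s)) = rmul (rdvar v f) g \<alpha> s"
proof -
  let ?e = "Poly_Mapping.single v (1::nat)"
  have "(\<Sum>(\<beta>,\<gamma>) \<in> {(\<beta>,\<gamma>). \<beta> + \<gamma> = \<alpha> + ?e}.
       of_nat (Poly_Mapping.lookup \<beta> v) * (f \<beta> s * g \<gamma> s)) =
    (\<Sum>(\<beta>,\<gamma>) \<in> {(\<beta>,\<gamma>). \<beta> + \<gamma> = \<alpha> + ?e \<and> Poly_Mapping.lookup \<beta> v \<noteq> 0}.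
       of_nat (Poly_Mapping.lookup \<beta> v) * (f \<beta> s * g \<gamma> s))"
    by (rule sum.mono_neutral_right) (auto simp: finite_splits)
  also have "\<dots> = rmul (rdvar v f) g \<alpha> s"
    unfolding rmul_def rdvar_def
  proof (rule sum.reindex_bij_witness[of _ "\<lambda>(b, c). (b + ?e, c)" "\<lambda>(b, c). (b - ?e, c)"], goal_cases)
    case (1 a)
    thus ?case by (auto simp: minus_single_plus[unfolded One_nat_def])
  next
    case (2 a)
    obtain b c where a: "a = (b, c)" by (cases a)
    with 2 have bc: "b + c = \<alpha> + ?e" "Poly_Mapping.lookup b v \<noteq> 0" by auto
    have "(b - ?e + c) + ?e = \<alpha> + ?e"
      using minus_single_plus[OF bc(2)] bc(1) by (metis add.commute add.left_commute)
    thus ?case by (simp add: a)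
  next
    case (5 a)
    obtain b c where a: "a = (b, c)" by (cases a)
    with 5 have bc: "b + c = \<alpha> + ?e" "Poly_Mapping.lookup b v \<noteq> 0" by auto
    have "Poly_Mapping.lookup (b - ?e) v + 1 = Poly_Mapping.lookup b v"
      using bc(2) by (simp add: lookup_minus)
    hence "of_nat (Poly_Mapping.lookup (b - ?e) v + 1) = (of_nat (Poly_Mapping.lookup b v) :: complex)"
      by (rule arg_cong)
    thus ?case using minus_single_plus[OF bc(2)] by (simp add: a)
  qed (auto simp: lookup_add add.assoc add.commute add.left_commute)
  finally show ?thesis .
qed

lemma fdv_mult: "fdv v (f * g) = fdv v f * g + f * fdv v g"
proof (transfer, intro ext)
  fix v :: var and f g \<alpha> s
  let ?D = "{(\<beta>,\<gamma>). \<beta> + \<gamma> = \<alpha> + Poly_Mapping.single v (1::nat)}"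
  have "rdvar v (rmul f g) \<alpha> s = (\<Sum>(\<beta>,\<gamma>)\<in>?D. of_nat (Poly_Mapping.lookup \<alpha> v + 1) * (f \<beta> s * g \<gamma> s))"
    unfolding rdvar_def rmul_def by (simp add: sum_distrib_left case_prod_unfold del: of_nat_add)
  \<comment> \<open>The prefactor of the derivative is the exponent of \<open>v\<close> in the whole
    monomial, hence the sum of its exponents in the two parts.\<close>
  also have "\<dots> = (\<Sum>(\<beta>,\<gamma>)\<in>?D. of_nat (Poly_Mapping.lookup \<beta> v) * (f \<beta> s * g \<gamma> s) +
        of_nat (Poly_Mapping.lookup \<gamma> v) * (g \<gamma> s * f \<beta> s))"
    by (intro sum.cong refl, clarify)
       (subst lookup_split_single[symmetric], assumption, simp add: algebra_simps)
  also have "\<dots> = (\<Sum>(\<beta>,\<gamma>)\<in>?D. of_nat (Poly_Mapping.lookup \<beta> v) * (f \<beta> s * g \<gamma> s)) +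
     (\<Sum>(\<beta>,\<gamma>)\<in>?D. of_nat (Poly_Mapping.lookup \<gamma> v) * (g \<gamma> s * f \<beta> s))"
    by (simp add: case_prod_unfold sum.distrib)
  also have "(\<Sum>(\<beta>,\<gamma>)\<in>?D. of_nat (Poly_Mapping.lookup \<gamma> v) * (g \<gamma> s * f \<beta> s)) =
     (\<Sum>(\<beta>,\<gamma>)\<in>?D. of_nat (Poly_Mapping.lookup \<beta> v) * (g \<beta> s * f \<gamma> s))"
    by (rule sum.reindex_bij_witness[of _ "\<lambda>(a,b). (b,a)" "\<lambda>(a,b). (b,a)"]) (auto simp: add.commute)
  finally show "rdvar v (rmul f g) \<alpha> s = radd (rmul (rdvar v f) g) (rmul f (rdvar v g)) \<alpha> s"
    unfolding rdvar_rmul_aux by (simp add: radd_def rmul_comm[of f])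
qed

lemma add_single_nonzero [simp]: "\<alpha> + Poly_Mapping.single v (Suc 0) \<noteq> (0 :: mono)"
proof
  assume "\<alpha> + Poly_Mapping.single v (Suc 0) = 0"
  hence "Poly_Mapping.lookup (\<alpha> + Poly_Mapping.single v (Suc 0)) v = 0" by simp
  thus False by (simp add: lookup_add)
qed

lemma fdv_add: "fdv v (f + g) = fdv v f + fdv v g"
  and fdv_0 [simp]: "fdv v 0 = 0"
  and fdv_cst [simp]: "fdv v (fcst c) = 0"
  and fdv_S [simp]: "fdv v fS = 0"
  and fdv_sh: "fdv v (fsh i f) = fsh i (fdv v f)"
  by (transfer; auto simp: rdvar_def radd_def rzero_def rone_def rS_def rshift_def fun_eq_iff algebra_simps)+

lemma fdv_1 [simp]: "fdv v 1 = 0"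
  using fdv_cst[of v 1] by simp

lemma fdv_comm: "fdv v (fdv w f) = fdv w (fdv v f)"
  by (cases "v = w", simp, transfer)
     (auto simp: rdvar_def fun_eq_iff lookup_add lookup_single when_def add.assoc add.commute add.left_commute)

lemma fdv_var: "fdv v (fvar w) = (if v = w then 1 else 0)"
proof (rule fser_eqI)
  fix \<alpha> :: mono and s
  have *: "\<alpha> + Poly_Mapping.single v 1 - Poly_Mapping.single w 1 \<noteq> 0" if "v \<noteq> w"
  proof -
    have "Poly_Mapping.lookup (\<alpha> + Poly_Mapping.single v 1 - Poly_Mapping.single w (1::nat)) v \<noteq> 0"
      using that by (simp add: lookup_minus lookup_add lookup_single when_def)
    thus ?thesis by force
  qed
  show "coeff (fdv v (fvar w)) \<alpha> s = coeff (if v = w then 1 else 0) \<alpha> s"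
    using * by (auto simp: fdv.rep_eq fvar.rep_eq one_fser.rep_eq zero_fser.rep_eq rdvar_def rvar_def rone_def
        rzero_def lookup_add)
qed

lemma fdiff_0 [simp]: "fdiff 0" and fdiff_1 [simp]: "fdiff 1" and fdiff_cst [simp]: "fdiff (fcst c)"
  and fdiff_add: "fdiff f \<Longrightarrow> fdiff g \<Longrightarrow> fdiff (f + g)"
  and fdiff_mult: "fdiff f \<Longrightarrow> fdiff g \<Longrightarrow> fdiff (f * g)"
  by (transfer; auto simp: rzero_def rone_def radd_def rmul_def case_prod_unfold
       intro!: differentiable_sum differentiable_mult finite_splits[unfolded case_prod_unfold])+

section \<open>Derivations and coefficientwise limits\<close>

lemma fdiff_S [simp]: "fdiff fS"
  and fdiff_var [simp]: "fdiff (fvar v)"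
  and fdiff_fdv: "fdiff f \<Longrightarrow> fdiff (fdv v f)"
proof -
  have "((\<lambda>s. complex_of_real s * c) has_vector_derivative c) (at s)" for c s
    by (auto intro!: derivative_eq_intros)
  hence "(\<lambda>s. complex_of_real s * c) differentiable at s" for c s
    by (rule differentiableI_vector)
  thus "fdiff fS" by transfer (simp add: rS_def rone_def)
  show "fdiff (fvar v)" by transfer (auto simp: rvar_def rone_def)
  show "fdiff f \<Longrightarrow> fdiff (fdv v f)"
    by transfer (auto simp: rdvar_def intro!: differentiable_mult)
qed

lemma has_vderiv_fds:
  "fdiff f \<Longrightarrow> (coeff f \<alpha> has_vector_derivative coeff (fds f) \<alpha> s) (at s)"
  by (transfer) (auto simp: rds_def vector_derivative_works)

lemma fds_eqI:
  assumes "\<And>\<alpha> s. (coeff f \<alpha> has_vector_derivative coeff g \<alpha> s) (at s)"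
  shows "fds f = g"
  using assms by (intro fser_eqI) (simp add: fds.rep_eq rds_def vector_derivative_at)

lemma fdiff_sh: "fdiff f \<Longrightarrow> fdiff (fsh i f)"
  and fds_sh: "fdiff f \<Longrightarrow> fds (fsh i f) = fsh i (fds f)"
proof -
  have *: "(coeff (fsh i f) \<alpha> has_vector_derivative coeff (fsh i (fds f)) \<alpha> s) (at s)"
    if "fdiff f" for \<alpha> s
  proof -
    have "((coeff f \<alpha> \<circ> (\<lambda>s. s + of_int i)) has_vector_derivative
        1 *\<^sub>R coeff (fds f) \<alpha> (s + of_int i)) (at s)"
      by (rule vector_diff_chain_at)
         (auto intro!: derivative_eq_intros has_vderiv_fds[OF that])
    thus ?thesis by (simp add: fsh.rep_eq rshift_def o_def)
  qed
  thus "fdiff f \<Longrightarrow> fds (fsh i f) = fsh i (fds f)" by (intro fds_eqI) auto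
  show "fdiff f \<Longrightarrow> fdiff (fsh i f)"
    unfolding fdiff.rep_eq using * differentiableI_vector by (auto simp: fdiff.rep_eq) blast
qed

lemma fds_add: "fdiff f \<Longrightarrow> fdiff g \<Longrightarrow> fds (f + g) = fds f + fds g"
proof (rule fds_eqI)
  fix \<alpha> s assume "fdiff f" "fdiff g"
  thus "(coeff (f + g) \<alpha> has_vector_derivative coeff (fds f + fds g) \<alpha> s) (at s)"
    using has_vderiv_fds[of f \<alpha> s] has_vderiv_fds[of g \<alpha> s]
    by (auto simp: plus_fser.rep_eq radd_def intro!: derivative_eq_intros)
qed

lemma fds_mult: "fdiff f \<Longrightarrow> fdiff g \<Longrightarrow> fds (f * g) = fds f * g + f * fds g"
proof (rule fds_eqI)
  fix \<alpha> s assume f: "fdiff f" and g: "fdiff g"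
  show "(coeff (f * g) \<alpha> has_vector_derivative coeff (fds f * g + f * fds g) \<alpha> s) (at s)"
    unfolding plus_fser.rep_eq times_fser.rep_eq radd_def rmul_def case_prod_unfold
    by (rule has_vector_derivative_eq_rhs)
       (rule has_vector_derivative_sum has_vector_derivative_mult has_vderiv_fds f g
        | simp add: sum.distrib add.commute)+
qed

lemma fds_cst [simp]: "fds (fcst c) = 0" and fds_S [simp]: "fds fS = 1" and fds_var [simp]: "fds (fvar v) = 0"
  and fds_0 [simp]: "fds 0 = 0" and fds_1 [simp]: "fds 1 = 0"
proof -
  show *: "fds (fcst c) = 0" for c
    by (rule fds_eqI) (auto simp: fcst.rep_eq zero_fser.rep_eq rzero_def)
  show "fds fS = 1"
    by (rule fds_eqI) (auto simp: fS.rep_eq one_fser.rep_eq rone_def rS_def intro!: derivative_eq_intros)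
  show "fds (fvar v) = 0"
    by (rule fds_eqI) (auto simp: fvar.rep_eq zero_fser.rep_eq rone_def rvar_def rzero_def)
  show "fds 0 = 0" "fds 1 = 0" using *[of 0] *[of 1] by simp_all
qed

lemma fds_fdv: "fdiff f \<Longrightarrow> fds (fdv v f) = fdv v (fds f)"
proof (rule fds_eqI)
  fix \<alpha> s assume f: "fdiff f"
  show "(coeff (fdv v f) \<alpha> has_vector_derivative coeff (fdv v (fds f)) \<alpha> s) (at s)"
    unfolding fdv.rep_eq rdvar_def
    by (intro has_vector_derivative_mult_right has_vderiv_fds f)
qed

lemma fdX_eq: "fdX n f = (if n = 0 then fds f else fdv (X n) f)"
  by transfer (simp add: dX_def)

text \<open>The domain \<open>P\<close> is needed for \<open>\<partial>\<^sub>s\<close>, which obeys the product rule only for differentiable coefficients.\<close>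

locale fderiv =
  fixes D :: "fser \<Rightarrow> fser" and P :: "fser \<Rightarrow> bool"
  assumes P_cst [simp]: "P (fcst c)"
    and P_add: "P f \<Longrightarrow> P g \<Longrightarrow> P (f + g)"
    and P_mult: "P f \<Longrightarrow> P g \<Longrightarrow> P (f * g)"
    and P_sh: "P f \<Longrightarrow> P (fsh i f)"
    and P_fdv: "P f \<Longrightarrow> P (fdv v f)"
    and D_cst [simp]: "D (fcst c) = 0"
    and D_add: "P f \<Longrightarrow> P g \<Longrightarrow> D (f + g) = D f + D g"
    and D_mult: "P f \<Longrightarrow> P g \<Longrightarrow> D (f * g) = D f * g + f * D g"
    and D_sh: "P f \<Longrightarrow> D (fsh i f) = fsh i (D f)"
    and D_fdv: "P f \<Longrightarrow> D (fdv v f) = fdv v (D f)"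
begin

lemma P_0 [simp]: "P 0" and P_1 [simp]: "P 1" and D_0 [simp]: "D 0 = 0" and D_1 [simp]: "D 1 = 0"
  and P_of_int [simp]: "P (of_int i)" and D_of_int [simp]: "D (of_int i) = 0"
  using P_cst[of 0] P_cst[of 1] D_cst[of 0] D_cst[of 1] by (simp_all add: of_int_fser)

lemma P_minus: "P f \<Longrightarrow> P (- f)"
  using P_mult[of "fcst (-1)" f] P_cst[of "-1"] by (simp add: fcst_minus del: P_cst)

lemma P_diff: "P f \<Longrightarrow> P g \<Longrightarrow> P (f - g)"
  using P_add[OF _ P_minus, of f g] by simp

lemma D_minus: "P f \<Longrightarrow> D (- f) = - D f"
  using D_mult[of "fcst (-1)" f] P_cst[of "-1"] D_cst[of "-1"] by (simp add: fcst_minus del: P_cst D_cst)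

lemma P_sum: "(\<And>x. x \<in> A \<Longrightarrow> P (f x)) \<Longrightarrow> P (sum f A)"
  by (induction A rule: infinite_finite_induct) (auto intro: P_add)

lemma D_sum: "(\<And>x. x \<in> A \<Longrightarrow> P (f x)) \<Longrightarrow> D (sum f A) = (\<Sum>x\<in>A. D (f x))"
  by (induction A rule: infinite_finite_induct) (auto simp: D_add P_sum)

end

interpretation fdv: fderiv "fdv v" "\<lambda>_. True" for v
  by unfold_locales (auto simp: fdv_add fdv_mult fdv_sh fdv_comm)

interpretation fds: fderiv fds fdiff
  by unfold_locales
    (auto simp: fds_add fds_mult fds_sh fds_fdv fdiff_add fdiff_mult fdiff_sh fdiff_fdv)

definition mdeg :: "mono \<Rightarrow> nat" where
  "mdeg \<alpha> = (\<Sum>v\<in>Poly_Mapping.keys \<alpha>. Poly_Mapping.lookup \<alpha> v)"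

lemma mdeg_add: "mdeg (\<alpha> + \<beta>) = mdeg \<alpha> + mdeg \<beta>"
proof -
  let ?K = "Poly_Mapping.keys \<alpha> \<union> Poly_Mapping.keys \<beta>"
  have *: "mdeg \<gamma> = (\<Sum>v\<in>?K. Poly_Mapping.lookup \<gamma> v)"
    if "Poly_Mapping.keys \<gamma> \<subseteq> ?K" for \<gamma>
    unfolding mdeg_def using that
    by (intro sum.mono_neutral_left) (auto simp: in_keys_iff)
  have "Poly_Mapping.keys (\<alpha> + \<beta>) \<subseteq> ?K" by (rule Poly_Mapping.keys_add)
  thus ?thesis by (simp add: * lookup_add sum.distrib)
qed

lemma mdeg_0 [simp]: "mdeg 0 = 0"
  by (simp add: mdeg_def)

lemma mdeg_eq_0: "mdeg \<alpha> = 0 \<longleftrightarrow> \<alpha> = 0"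
  unfolding mdeg_def by (auto simp: in_keys_iff intro!: poly_mapping_eqI)

text \<open>The coefficient of \<open>u\<close> at \<open>\<alpha>\<close> is the inverse of the
  constant term of \<open>f\<close> times an expression in \<open>f\<close> and in coefficients of
  \<open>u\<close> of smaller total degree, so differentiability propagates by induction on
  \<open>mdeg\<close>.\<close>

lemma fdiff_inverse:
  assumes u: "u * f = 1" and f: "fdiff f"
  shows "fdiff u"
proof -
  let ?D = "\<lambda>\<alpha>::mono. {(\<beta>,\<gamma>). \<beta> + \<gamma> = \<alpha>}"
  have c: "(\<Sum>(\<beta>,\<gamma>)\<in>?D \<alpha>. coeff f \<beta> s * coeff u \<gamma> s) = (if \<alpha> = 0 then 1 else 0)" for \<alpha> s
    using fun_cong[OF fun_cong[OF arg_cong[of _ _ coeff, OF u]], of \<alpha> s]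
    by (simp add: mult.commute[of u] times_fser.rep_eq one_fser.rep_eq rmul_def rone_def)
  have sum0: "a = 0 \<and> b = 0" if "a + b = 0" for a b :: mono
    using arg_cong[OF that, of mdeg] by (simp add: mdeg_add mdeg_eq_0)
  have D0: "?D 0 = {(0, 0)}" by (auto dest: sum0)
  have f0: "coeff f 0 s * coeff u 0 s = 1" for s
    using c[of s 0] unfolding D0 by simp
  have rec: "coeff u \<alpha> = (\<lambda>s. inverse (coeff f 0 s) * ((if \<alpha> = 0 then 1 else 0) -
      (\<Sum>(\<beta>,\<gamma>)\<in>?D \<alpha> - {(0, \<alpha>)}. coeff f \<beta> s * coeff u \<gamma> s)))" for \<alpha>
  proof
    fix s
    have "coeff f 0 s * coeff u \<alpha> s + (\<Sum>(\<beta>,\<gamma>)\<in>?D \<alpha> - {(0, \<alpha>)}. coeff f \<beta> s * coeff u \<gamma> s)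
        = (if \<alpha> = 0 then 1 else 0)"
      using c[of s \<alpha>] by (subst (asm) sum.remove[of _ "(0, \<alpha>)"]) (auto simp: finite_splits)
    moreover have "coeff f 0 s \<noteq> 0" using f0[of s] by auto
    ultimately show "coeff u \<alpha> s = inverse (coeff f 0 s) * ((if \<alpha> = 0 then 1 else 0) -
      (\<Sum>(\<beta>,\<gamma>)\<in>?D \<alpha> - {(0, \<alpha>)}. coeff f \<beta> s * coeff u \<gamma> s))"
      by (simp add: field_simps split: if_splits)
  qed
  have df: "coeff f \<beta> differentiable (at s)" for \<beta> s using f by (simp add: fdiff.rep_eq)
  have "\<forall>s. coeff u \<alpha> differentiable (at s)" for \<alpha>
  proof (induction "mdeg \<alpha>" arbitrary: \<alpha> rule: less_induct)
    case less
    have *: "coeff u (snd p) differentiable (at s)" if "p \<in> ?D \<alpha> - {(0, \<alpha>)}" for p s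
    proof (rule less[rule_format])
      obtain b g where p: "p = (b, g)" by (cases p)
      with that have "b + g = \<alpha>" "b \<noteq> 0" by auto
      thus "mdeg (snd p) < mdeg \<alpha>" using mdeg_eq_0[of b] by (auto simp: p mdeg_add)
    qed
    show ?case
    proof
      fix s
      have "coeff f 0 s \<noteq> 0" using f0[of s] by auto
      thus "coeff u \<alpha> differentiable (at s)"
        using * finite_Diff[OF finite_splits, of \<alpha> "{(0, \<alpha>)}"] unfolding case_prod_unfold
        by (subst rec[unfolded case_prod_unfold])
           (intro differentiable_mult differentiable_diff differentiable_sum differentiable_inverse df ballI;
            simp)
    qed
  qed
  thus ?thesis by (simp add: fdiff.rep_eq)
qed

text \<open>Each coefficient stabilises as a function of s, not just pointwise in s. Identities at
  finite stages thus pass to the limit exactly, without any topology.\<close>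

definition fconv :: "(nat \<Rightarrow> fser) \<Rightarrow> fser \<Rightarrow> bool" where
  "fconv F f \<longleftrightarrow> (\<forall>\<alpha>. \<forall>\<^sub>F n in sequentially. coeff (F n) \<alpha> = coeff f \<alpha>)"

lemma fconv_const [simp]: "fconv (\<lambda>_. f) f"
  by (simp add: fconv_def)

lemma fconv_unique:
  assumes "fconv F f" "fconv F g"
  shows "f = g"
proof (rule fser_eqI)
  fix \<alpha> s
  have "\<forall>\<^sub>F n in sequentially. coeff f \<alpha> = coeff g \<alpha>"
    using eventually_conj[OF assms[unfolded fconv_def, rule_format, of \<alpha>]]
    by (rule eventually_mono) auto
  thus "coeff f \<alpha> s = coeff g \<alpha> s" by simp
qed

lemma fconv_eventually: "\<forall>\<^sub>F n in sequentially. F n = G n \<Longrightarrow> fconv F f \<Longrightarrow> fconv G f"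
  unfolding fconv_def by (auto elim: eventually_elim2)

lemma fconv_add: "fconv F f \<Longrightarrow> fconv G g \<Longrightarrow> fconv (\<lambda>n. F n + G n) (f + g)"
  unfolding fconv_def
proof
  fix \<alpha>
  assume "\<forall>\<alpha>. \<forall>\<^sub>F n in sequentially. coeff (F n) \<alpha> = coeff f \<alpha>"
    and "\<forall>\<alpha>. \<forall>\<^sub>F n in sequentially. coeff (G n) \<alpha> = coeff g \<alpha>"
  hence "\<forall>\<^sub>F n in sequentially. coeff (F n) \<alpha> = coeff f \<alpha>"
    "\<forall>\<^sub>F n in sequentially. coeff (G n) \<alpha> = coeff g \<alpha>" by blast+
  thus "\<forall>\<^sub>F n in sequentially. coeff (F n + G n) \<alpha> = coeff (f + g) \<alpha>"
    by eventually_elim (simp add: plus_fser.rep_eq radd_def)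
qed

lemma fconv_mult:
  assumes F: "fconv F f" and G: "fconv G g"
  shows "fconv (\<lambda>n. F n * G n) (f * g)"
  unfolding fconv_def
proof
  fix \<alpha>
  have "\<forall>\<^sub>F n in sequentially. \<forall>p\<in>{(\<beta>,\<gamma>). \<beta> + \<gamma> = \<alpha>}.
     coeff (F n) (fst p) = coeff f (fst p) \<and> coeff (G n) (snd p) = coeff g (snd p)"
    using F G by (intro eventually_ball_finite finite_splits ballI eventually_conj) (auto simp: fconv_def)
  thus "\<forall>\<^sub>F n in sequentially. coeff (F n * G n) \<alpha> = coeff (f * g) \<alpha>"
    by (rule eventually_mono) (auto simp: times_fser.rep_eq rmul_def intro!: ext sum.cong)
qed

lemma fconv_minus: "fconv F f \<Longrightarrow> fconv (\<lambda>n. - F n) (- f)"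
  using fconv_mult[OF fconv_const[of "- 1"], of F f] by simp

lemma fconv_diff: "fconv F f \<Longrightarrow> fconv G g \<Longrightarrow> fconv (\<lambda>n. F n - G n) (f - g)"
  using fconv_add[OF _ fconv_minus, of F f G g] by simp

lemma fconv_sum: "(\<And>x. x \<in> A \<Longrightarrow> fconv (F x) (f x)) \<Longrightarrow> fconv (\<lambda>n. \<Sum>x\<in>A. F x n) (\<Sum>x\<in>A. f x)"
  by (induction A rule: infinite_finite_induct) (auto intro: fconv_add)

lemma fconv_coeff_map:
  assumes "fconv F f" "\<And>n \<alpha>. coeff (F n) (\<phi> \<alpha>) = coeff f (\<phi> \<alpha>) \<Longrightarrow> coeff (G n) \<alpha> = coeff g \<alpha>"
  shows "fconv G g"
  unfolding fconv_def
proof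
  fix \<alpha>
  have "\<forall>\<^sub>F n in sequentially. coeff (F n) (\<phi> \<alpha>) = coeff f (\<phi> \<alpha>)"
    using assms(1) by (simp add: fconv_def)
  thus "\<forall>\<^sub>F n in sequentially. coeff (G n) \<alpha> = coeff g \<alpha>"
    by (rule eventually_mono) (rule assms(2))
qed

lemma fconv_sh: "fconv F f \<Longrightarrow> fconv (\<lambda>n. fsh i (F n)) (fsh i f)"
  by (erule fconv_coeff_map[of _ _ "\<lambda>\<alpha>. \<alpha>"]) (simp add: fsh.rep_eq rshift_def)

text \<open>\<open>rsum\<close> ranges over an index set that depends on s and defaults to 0 if that
  set is infinite; the hypothesis gives, for a fixed monomial, one bound valid for all s.\<close>

lemma fconv_rsum:
  assumes "\<And>\<alpha>. \<forall>\<^sub>F n in sequentially. coeff (F n) \<alpha> = (\<lambda>s. 0)"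
  shows "fconv (\<lambda>N. \<Sum>n\<le>N. F n) (of_coeff (rsum (\<lambda>n. coeff (F n))))"
  unfolding fconv_def
proof
  fix \<alpha>
  obtain K where K: "\<And>n. n \<ge> K \<Longrightarrow> coeff (F n) \<alpha> = (\<lambda>s. 0)"
    using assms[of \<alpha>] by (auto simp: eventually_sequentially)
  show "\<forall>\<^sub>F N in sequentially. coeff (\<Sum>n\<le>N. F n) \<alpha> =
      coeff (of_coeff (rsum (\<lambda>n. coeff (F n)))) \<alpha>"
    unfolding eventually_sequentially
  proof (intro exI[of _ K] allI impI ext)
    fix N s assume "K \<le> N"
    have "(\<Sum>n\<in>{n. coeff (F n) \<alpha> s \<noteq> 0}. coeff (F n) \<alpha> s) = (\<Sum>n\<le>N. coeff (F n) \<alpha> s)"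
    proof (rule sum.mono_neutral_left)
      show "{n. coeff (F n) \<alpha> s \<noteq> 0} \<subseteq> {..N}"
      proof clarify
        fix n assume "coeff (F n) \<alpha> s \<noteq> 0"
        hence "n < K" using K[of n] by (cases "K \<le> n") auto
        thus "n \<le> N" using \<open>K \<le> N\<close> by simp
      qed
    qed auto
    thus "coeff (\<Sum>n\<le>N. F n) \<alpha> s = coeff (of_coeff (rsum (\<lambda>n. coeff (F n)))) \<alpha> s"
      by (simp add: coeff_sum of_coeff_inverse rsum_def)
  qed
qed

section \<open>Vertex operators\<close>

text \<open>The two halves of the theory are treated together by means of a Boolean: \<open>True\<close> stands for the
  variables \<open>t\<^sub>n\<close>, the vertex operator \<open>G(z)\<close>, the wave operator \<open>W\<close>, operators bounded above and the projection
  to negative powers; \<open>False\<close> for their barred counterparts, operators bounded below and the projection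
  to nonnegative powers.\<close>

definition sg :: "bool \<Rightarrow> int" where "sg b = (if b then 1 else - 1)"
definition bv :: "bool \<Rightarrow> nat \<Rightarrow> var" where "bv b n = (if b then T n else TB n)"
definition bwt :: "bool \<Rightarrow> var \<Rightarrow> nat" where "bwt b = (if b then tw else tbw)"
text \<open>The shift of s made by the vertex operator: G keeps s, Gbar moves it to s + 1.\<close>

definition kap :: "bool \<Rightarrow> int" where "kap b = (if b then 0 else 1)"

lemma sg_sq [simp]: "sg b * sg b = 1" and sg_sq' [simp]: "sg b * (sg b * x) = x"
  by (simp_all add: sg_def)

lemma bv_inj [simp]: "bv b n = bv b n' \<longleftrightarrow> n = n'"
  and bv_neq: "b \<noteq> c \<Longrightarrow> bv b n \<noteq> bv c n'"
  and bv_neq_X [simp]: "bv b n \<noteq> X i" and bv_neq_X' [simp]: "X i \<noteq> bv b n"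
  and bwt_bv [simp]: "bwt b (bv b n) = n"
  by (simp_all add: bv_def bwt_def tw_def tbw_def)

definition wset :: "bool \<Rightarrow> nat \<Rightarrow> mono set" where
  "wset b N = {\<gamma>. Poly_Mapping.keys \<gamma> \<subseteq> {bv b n | n. 1 \<le> n} \<and>
     (\<Sum>v\<in>Poly_Mapping.keys \<gamma>. bwt b v * Poly_Mapping.lookup \<gamma> v) = N}"

text \<open>Taylor's formula: the coefficient of \<open>\<alpha>\<close> in f(t + y) is the sum over
  \<open>\<gamma>\<close> of the coefficient of f at \<open>\<alpha> + \<gamma>\<close>, times
  binomials, times y^\<open>\<gamma>\<close>; here the n-th entry of y is \<open>- sg b / n\<close>,
  its power of z being recorded by the weight.\<close>

definition tcoeff :: "bool \<Rightarrow> mono \<Rightarrow> mono \<Rightarrow> complex" where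
  "tcoeff b \<alpha> \<gamma> = (\<Prod>v\<in>Poly_Mapping.keys \<gamma>.
     of_nat ((Poly_Mapping.lookup \<alpha> v + Poly_Mapping.lookup \<gamma> v) choose Poly_Mapping.lookup \<gamma> v)
     * (- of_int (sg b) / of_nat (bwt b v)) ^ Poly_Mapping.lookup \<gamma> v)"

definition gco :: "bool \<Rightarrow> fser \<Rightarrow> nat \<Rightarrow> fser" where
  "gco b f N = of_coeff (\<lambda>\<alpha> s. \<Sum>\<gamma>\<in>wset b N. coeff f (\<alpha> + \<gamma>) s * tcoeff b \<alpha> \<gamma>)"

lemma wset_keys:
  assumes "\<gamma> \<in> wset b N" "v \<in> Poly_Mapping.keys \<gamma>"
  obtains n where "v = bv b n" "1 \<le> n" "n \<le> N" "Poly_Mapping.lookup \<gamma> v \<le> N"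
proof -
  obtain n where n: "v = bv b n" "1 \<le> n" using assms by (auto simp: wset_def)
  have "bwt b v * Poly_Mapping.lookup \<gamma> v \<le> (\<Sum>v\<in>Poly_Mapping.keys \<gamma>. bwt b v * Poly_Mapping.lookup \<gamma> v)"
    using assms by (intro member_le_sum) auto
  hence le: "n * Poly_Mapping.lookup \<gamma> v \<le> N" using assms n by (simp add: wset_def)
  have "1 \<le> Poly_Mapping.lookup \<gamma> v" using assms(2) by (simp add: in_keys_iff Suc_le_eq)
  hence "n * 1 \<le> n * Poly_Mapping.lookup \<gamma> v" "1 * Poly_Mapping.lookup \<gamma> v \<le> n * Poly_Mapping.lookup \<gamma> v"
    using n(2) by (intro mult_le_mono; simp)+
  with le n that show ?thesis by (metis le_trans mult_1 mult.right_neutral)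
qed

lemma wset_finite: "finite (wset b N)"
proof -
  define top where "top = (\<Sum>n=1..N. Poly_Mapping.single (bv b n) N)"
  have top: "Poly_Mapping.lookup top (bv b n) = N" if "1 \<le> n" "n \<le> N" for n
  proof -
    have "Poly_Mapping.lookup top (bv b n) = (\<Sum>i=1..N. if i = n then N else 0)"
      unfolding top_def lookup_sum by (intro sum.cong) (auto simp: lookup_single when_def)
    thus ?thesis using that by simp
  qed
  have "wset b N \<subseteq> fst ` {(\<beta>, \<gamma>). \<beta> + \<gamma> = top}"
  proof
    fix \<gamma> assume \<gamma>: "\<gamma> \<in> wset b N"
    have "\<gamma> + (top - \<gamma>) = top"
    proof (rule poly_mapping_eqI)
      fix v
      show "Poly_Mapping.lookup (\<gamma> + (top - \<gamma>)) v = Poly_Mapping.lookup top v"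
      proof (cases "v \<in> Poly_Mapping.keys \<gamma>")
        case True
        obtain n where "v = bv b n" "1 \<le> n" "n \<le> N" "Poly_Mapping.lookup \<gamma> v \<le> N"
          using wset_keys[OF \<gamma> True] by blast
        thus ?thesis using top[of n] by (simp add: lookup_add lookup_minus)
      qed (simp add: lookup_add lookup_minus in_keys_iff)
    qed
    thus "\<gamma> \<in> fst ` {(\<beta>, \<gamma>). \<beta> + \<gamma> = top}" by (force simp: image_iff)
  qed
  thus ?thesis by (rule finite_subset) (intro finite_imageI finite_splits)
qed

lemma wset_0: "wset b 0 = {0}"
proof -
  have "\<gamma> = 0" if "\<gamma> \<in> wset b 0" for \<gamma>
  proof (rule ccontr)
    assume "\<gamma> \<noteq> 0"
    then obtain v where "v \<in> Poly_Mapping.keys \<gamma>" by (metis all_not_in_conv keys_eq_empty)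
    with that show False by (auto elim: wset_keys)
  qed
  moreover have "0 \<in> wset b 0" by (simp add: wset_def)
  ultimately show ?thesis by auto
qed

lemma tcoeff_superset:
  assumes "finite K" "Poly_Mapping.keys \<gamma> \<subseteq> K"
  shows "tcoeff b \<alpha> \<gamma> = (\<Prod>v\<in>K.
     of_nat ((Poly_Mapping.lookup \<alpha> v + Poly_Mapping.lookup \<gamma> v) choose Poly_Mapping.lookup \<gamma> v)
     * (- of_int (sg b) / of_nat (bwt b v)) ^ Poly_Mapping.lookup \<gamma> v)"
  unfolding tcoeff_def using assms by (intro prod.mono_neutral_left) (auto simp: in_keys_iff)

lemma wt_superset:
  assumes "finite K" "Poly_Mapping.keys \<gamma> \<subseteq> K"
  shows "(\<Sum>v\<in>Poly_Mapping.keys \<gamma>. bwt b v * Poly_Mapping.lookup \<gamma> v) = (\<Sum>v\<in>K. bwt b v * Poly_Mapping.lookup \<gamma> v)"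
  using assms by (intro sum.mono_neutral_left) (auto simp: in_keys_iff)

lemma keys_add_single:
  "Poly_Mapping.keys (\<gamma> + Poly_Mapping.single v (1::nat)) = insert v (Poly_Mapping.keys \<gamma>)"
  by (auto simp: in_keys_iff lookup_add lookup_single when_def split: if_splits)

lemma wset_add_single:
  assumes "1 \<le> n"
  shows "\<gamma> + Poly_Mapping.single (bv b n) 1 \<in> wset b (n + N) \<longleftrightarrow> \<gamma> \<in> wset b N"
proof -
  let ?K = "insert (bv b n) (Poly_Mapping.keys \<gamma>)"
  let ?g = "\<gamma> + Poly_Mapping.single (bv b n) (1::nat)"
  have "(\<Sum>v\<in>?K. bwt b v * Poly_Mapping.lookup ?g v) =
     (\<Sum>v\<in>?K. bwt b v * Poly_Mapping.lookup \<gamma> v + (if v = bv b n then n else 0))"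
    by (intro sum.cong refl) (auto simp: lookup_add lookup_single when_def)
  also have "\<dots> = (\<Sum>v\<in>?K. bwt b v * Poly_Mapping.lookup \<gamma> v) + n"
    by (subst sum.distrib, subst sum.delta) simp_all
  also have "(\<Sum>v\<in>?K. bwt b v * Poly_Mapping.lookup \<gamma> v) = (\<Sum>v\<in>Poly_Mapping.keys \<gamma>. bwt b v * Poly_Mapping.lookup \<gamma> v)"
    by (rule wt_superset[symmetric]) auto
  finally show ?thesis using assms unfolding wset_def mem_Collect_eq keys_add_single by auto
qed

text \<open>Rests on (g+1) binom(a+g+1, g+1) = (a+g+1) binom(a+g, g) at the variable in question;
  the other factors, collected in \<open>R\<close>, do not change. The factor n cancels the 1/n of
  the shift, and a+g+1 is the factor produced by \<open>rdvar\<close>.\<close>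

lemma tcoeff_add_single:
  assumes "1 \<le> n"
  shows "of_nat n * of_nat (Poly_Mapping.lookup \<gamma> (bv b n) + 1) * tcoeff b \<alpha> (\<gamma> + Poly_Mapping.single (bv b n) 1)
     = - of_int (sg b) * of_nat (Poly_Mapping.lookup (\<alpha> + \<gamma>) (bv b n) + 1) * tcoeff b \<alpha> \<gamma>"
proof -
  define v where "v = bv b n"
  define g where "g = Poly_Mapping.lookup \<gamma> v"
  define a where "a = Poly_Mapping.lookup \<alpha> v"
  define K where "K = insert v (Poly_Mapping.keys \<gamma>)"
  let ?t = "\<lambda>\<gamma> v. of_nat ((Poly_Mapping.lookup \<alpha> v + Poly_Mapping.lookup \<gamma> v) choose Poly_Mapping.lookup \<gamma> v)
     * (- of_int (sg b) / of_nat (bwt b v)) ^ Poly_Mapping.lookup \<gamma> v :: complex"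
  define R where "R = (\<Prod>w\<in>K - {v}. ?t \<gamma> w)"
  have K: "finite K" "v \<in> K" "Poly_Mapping.keys \<gamma> \<subseteq> K"
      "Poly_Mapping.keys (\<gamma> + Poly_Mapping.single v 1) \<subseteq> K"
    by (auto simp: K_def keys_add_single[simplified])
  have 1: "tcoeff b \<alpha> \<gamma> = ?t \<gamma> v * R"
    unfolding R_def tcoeff_superset[OF K(1,3)] by (rule prod.remove[OF K(1,2)])
  have 2: "tcoeff b \<alpha> (\<gamma> + Poly_Mapping.single v 1) = ?t (\<gamma> + Poly_Mapping.single v 1) v * R"
    unfolding R_def tcoeff_superset[OF K(1,4)] prod.remove[OF K(1,2)]
    by (intro arg_cong2[where f = "(*)"] refl prod.cong) (auto simp: lookup_add lookup_single when_def)
  have 3: "Suc g * (Suc (a + g) choose Suc g) = Suc (a + g) * ((a + g) choose g)"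
    by (rule Suc_times_binomial)
  have "of_nat n * of_nat (g + 1) * (of_nat (Suc (a + g) choose Suc g) * (- of_int (sg b) / of_nat n) ^ Suc g * R)
      = of_nat (Suc g * (Suc (a + g) choose Suc g)) * (- of_int (sg b)) * (- of_int (sg b) / of_nat n) ^ g * R"
    using assms unfolding of_nat_mult by (simp add: field_simps del: binomial_Suc_Suc)
  also have "\<dots> = - of_int (sg b) * of_nat (a + g + 1) * (of_nat ((a + g) choose g) * (- of_int (sg b) / of_nat n) ^ g * R)"
    unfolding 3 of_nat_mult by (simp add: mult_ac)
  finally have eq: "of_nat n * of_nat (g + 1) * (of_nat (Suc (a + g) choose Suc g) * (- of_int (sg b) / of_nat n) ^ Suc g * R)
      = - of_int (sg b) * of_nat (a + g + 1) * (of_nat ((a + g) choose g) * (- of_int (sg b) / of_nat n) ^ g * R)" .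
  have t: "?t \<gamma> v = of_nat ((a + g) choose g) * (- of_int (sg b) / of_nat n) ^ g"
    "?t (\<gamma> + Poly_Mapping.single v 1) v = of_nat (Suc (a + g) choose Suc g) * (- of_int (sg b) / of_nat n) ^ Suc g"
    "Poly_Mapping.lookup (\<alpha> + \<gamma>) v = a + g"
    unfolding a_def g_def lookup_add lookup_single_eq by (simp_all only: v_def bwt_bv add_Suc_right One_nat_def add_0_right)
  show ?thesis
    using eq unfolding v_def[symmetric] 1 2 t unfolding g_def .
qed

text \<open>This recursion determines the Taylor coefficients; all further properties of the vertex operators
  (multiplicativity, commutation with derivations) follow from it by induction.\<close>

lemma gco_euler:
  "of_nat N * gco b f N = - of_int (sg b) * (\<Sum>n=1..N. gco b (fdv (bv b n) f) (N - n))"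
proof (rule fser_eqI)
  fix \<alpha> s
  let ?e = "\<lambda>n. Poly_Mapping.single (bv b n) (1::nat)"
  let ?h = "\<lambda>\<gamma>. coeff f (\<alpha> + \<gamma>) s * tcoeff b \<alpha> \<gamma>"
  \<comment> \<open>On monomials of weight N the number N is itself the weighted sum of exponents;
    inserting this under the Taylor sum is Euler's identity.\<close>
  have wt: "(\<Sum>n=1..N. n * Poly_Mapping.lookup \<gamma> (bv b n)) = N" if "\<gamma> \<in> wset b N" for \<gamma>
  proof -
    have "(\<Sum>n=1..N. n * Poly_Mapping.lookup \<gamma> (bv b n)) =
        (\<Sum>v\<in>bv b ` {1..N}. bwt b v * Poly_Mapping.lookup \<gamma> v)"
      by (subst sum.reindex) (auto simp: inj_on_def)
    also have "\<dots> = (\<Sum>v\<in>Poly_Mapping.keys \<gamma>. bwt b v * Poly_Mapping.lookup \<gamma> v)"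
    proof (rule wt_superset[symmetric])
      show "Poly_Mapping.keys \<gamma> \<subseteq> bv b ` {1..N}" by (auto elim!: wset_keys[OF that])
    qed auto
    also have "\<dots> = N" using that by (simp add: wset_def)
    finally show ?thesis .
  qed
  have step: "(\<Sum>\<gamma>\<in>wset b N. of_nat (n * Poly_Mapping.lookup \<gamma> (bv b n)) * ?h \<gamma>) =
      (\<Sum>\<gamma>\<in>wset b (N - n). - of_int (sg b) *
        (coeff (fdv (bv b n) f) (\<alpha> + \<gamma>) s * tcoeff b \<alpha> \<gamma>))"
    if n: "n \<in> {1..N}" for n
  proof -
    have eqN: "n + (N - n) = N" and n1: "1 \<le> n" using n by auto
    have "(\<Sum>\<gamma>\<in>wset b N. of_nat (n * Poly_Mapping.lookup \<gamma> (bv b n)) * ?h \<gamma>) =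
      (\<Sum>\<gamma>\<in>{\<gamma>\<in>wset b N. Poly_Mapping.lookup \<gamma> (bv b n) \<noteq> 0}. of_nat (n * Poly_Mapping.lookup \<gamma> (bv b n)) * ?h \<gamma>)"
      by (rule sum.mono_neutral_right) (auto simp: wset_finite)
    also have "\<dots> = (\<Sum>\<gamma>\<in>wset b (N - n). of_nat (n * Poly_Mapping.lookup (\<gamma> + ?e n) (bv b n)) * ?h (\<gamma> + ?e n))"
    proof (rule sum.reindex_bij_witness[of _ "\<lambda>\<gamma>. \<gamma> + ?e n" "\<lambda>\<gamma>. \<gamma> - ?e n"], goal_cases)
      case (1 \<gamma>)
      thus ?case using minus_single_plus[of \<gamma> "bv b n"] by simp
    next
      case (2 \<gamma>)
      hence "\<gamma> - ?e n + ?e n \<in> wset b (n + (N - n))"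
        using minus_single_plus[of \<gamma> "bv b n"] eqN by simp
      thus ?case by (simp only: wset_add_single[OF n1])
    next
      case (4 \<gamma>)
      hence "\<gamma> + ?e n \<in> wset b (n + (N - n))" by (simp only: wset_add_single[OF n1])
      thus ?case unfolding eqN by (simp add: lookup_add)
    next
      case (5 \<gamma>)
      thus ?case using minus_single_plus[of \<gamma> "bv b n"] by simp
    qed simp
    also have "\<dots> = (\<Sum>\<gamma>\<in>wset b (N - n). - of_int (sg b) *
        (coeff (fdv (bv b n) f) (\<alpha> + \<gamma>) s * tcoeff b \<alpha> \<gamma>))"
    proof (intro sum.cong refl)
      fix \<gamma>
      have "of_nat (n * Poly_Mapping.lookup (\<gamma> + ?e n) (bv b n)) * ?h (\<gamma> + ?e n) =
        (of_nat n * of_nat (Poly_Mapping.lookup \<gamma> (bv b n) + 1) * tcoeff b \<alpha> (\<gamma> + ?e n))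
         * coeff f (\<alpha> + (\<gamma> + ?e n)) s"
        by (simp add: lookup_add algebra_simps)
      also have "\<dots> = - of_int (sg b) *
        (coeff (fdv (bv b n) f) (\<alpha> + \<gamma>) s * tcoeff b \<alpha> \<gamma>)"
        unfolding tcoeff_add_single[OF n1] fdv.rep_eq rdvar_def by (simp add: add.assoc)
      finally show "of_nat (n * Poly_Mapping.lookup (\<gamma> + ?e n) (bv b n)) * ?h (\<gamma> + ?e n) = \<dots>" .
    qed
    finally show ?thesis .
  qed
  have "coeff (of_nat N * gco b f N) \<alpha> s = of_nat N * (\<Sum>\<gamma>\<in>wset b N. ?h \<gamma>)"
    unfolding of_nat_fser by (simp add: rscale_def gco_def of_coeff_inverse flip: rscale_eq)
  also have "\<dots> = (\<Sum>\<gamma>\<in>wset b N. of_nat (\<Sum>n=1..N. n * Poly_Mapping.lookup \<gamma> (bv b n)) * ?h \<gamma>)"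
    unfolding sum_distrib_left by (intro sum.cong refl) (simp only: wt)
  also have "\<dots> = (\<Sum>\<gamma>\<in>wset b N. \<Sum>n=1..N. of_nat (n * Poly_Mapping.lookup \<gamma> (bv b n)) * ?h \<gamma>)"
    unfolding of_nat_sum sum_distrib_right ..
  also have "\<dots> = (\<Sum>n=1..N. \<Sum>\<gamma>\<in>wset b N. of_nat (n * Poly_Mapping.lookup \<gamma> (bv b n)) * ?h \<gamma>)"
    by (rule sum.swap)
  also have "\<dots> = - of_int (sg b) * (\<Sum>n=1..N. \<Sum>\<gamma>\<in>wset b (N - n).
      coeff (fdv (bv b n) f) (\<alpha> + \<gamma>) s * tcoeff b \<alpha> \<gamma>)"
    unfolding sum_distrib_left by (intro sum.cong refl step)
  also have "\<dots> = coeff (- of_int (sg b) * (\<Sum>n=1..N. gco b (fdv (bv b n) f) (N - n))) \<alpha> s"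
    unfolding of_int_fser fcst_minus[symmetric] rscale_eq[symmetric]
    by (simp add: rscale_def coeff_sum gco_def of_coeff_inverse)
  finally show "coeff (of_nat N * gco b f N) \<alpha> s = \<dots>" .
qed

lemma gco_0 [simp]: "gco b f 0 = f"
  by (rule fser_eqI) (simp add: gco_def wset_0 of_coeff_inverse tcoeff_def)

text \<open>Euler's identity expresses weight N by smaller weights of derivatives of
  \<open>f\<close>, and \<open>D\<close> commutes with \<open>fdv\<close>, so strong induction on N
  applies.\<close>

lemma fderiv_gco:
  assumes "fderiv D P" "P f"
  shows "P (gco b f N) \<and> D (gco b f N) = gco b (D f) N"
  using assms(2)
proof (induction N arbitrary: f rule: less_induct)
  case (less N)
  interpret fderiv D P by (rule assms(1))
  show ?case
  proof (cases "N = 0")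
    case False
    have IH: "P (gco b (fdv (bv b n) f) (N - n))"
      "D (gco b (fdv (bv b n) f) (N - n)) = gco b (fdv (bv b n) (D f)) (N - n)" if "n \<in> {1..N}" for n
      using less.IH[of "N - n" "fdv (bv b n) f"] that less.prems by (auto simp: P_fdv D_fdv)
    let ?c = "fcst (inverse (of_nat N))"
    have c: "?c * of_nat N = 1" using False by (simp add: of_nat_fser fcst_unit)
    have eq: "gco b f N = ?c * (- of_int (sg b) * (\<Sum>n=1..N. gco b (fdv (bv b n) f) (N - n)))"
      using arg_cong[OF gco_euler[of N b f], of "(*) ?c"] c by (metis mult.assoc mult_1)
    have eq': "gco b (D f) N = ?c * (- of_int (sg b) * (\<Sum>n=1..N. gco b (fdv (bv b n) (D f)) (N - n)))"
      using arg_cong[OF gco_euler[of N b "D f"], of "(*) ?c"] c by (metis mult.assoc mult_1)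
    have S: "P (\<Sum>n=1..N. gco b (fdv (bv b n) f) (N - n))"
      "D (\<Sum>n=1..N. gco b (fdv (bv b n) f) (N - n)) = (\<Sum>n=1..N. gco b (fdv (bv b n) (D f)) (N - n))"
      by (rule P_sum, erule IH, subst D_sum, erule IH, rule sum.cong[OF refl], erule IH)
    show ?thesis
      unfolding eq eq' by (simp add: P_mult P_minus D_mult D_minus S[simplified])
  qed (use less.prems in simp)
qed

lemma gco_add: "gco b (f + g) N = gco b f N + gco b g N"
  by (rule fser_eqI)
     (simp add: gco_def of_coeff_inverse plus_fser.rep_eq radd_def sum.distrib algebra_simps)

lemma gco_fcst_mult: "gco b (fcst c * f) N = fcst c * gco b f N"
  by (rule fser_eqI)
     (simp add: gco_def of_coeff_inverse rscale_def sum_distrib_left mult.assoc flip: rscale_eq)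

lemma gco_eqI:
  assumes "N \<noteq> 0" "of_nat N * gco b f N = of_nat N * g"
  shows "gco b f N = g"
  using assms of_int_fser_cancel[of "int N" "gco b f N" g] by simp

lemma gco_0': "gco b 0 N = 0"
  using gco_fcst_mult[of b 0 0 N] by simp

text \<open>A substitution is multiplicative. Formally: write N = i + (N - i), apply Euler's
  identity to the factor carrying i or N - i, and reassemble by the Leibniz rule and the induction
  hypothesis into Euler's identity for the product.\<close>

lemma gco_mult: "gco b (f * g) N = (\<Sum>i\<le>N. gco b f i * gco b g (N - i))"
proof (induction N arbitrary: f g rule: less_induct)
  case (less N)
  let ?d = "\<lambda>n. fdv (bv b n)" and ?s = "- of_int (sg b) :: fser"
  show ?case
  proof (cases "N = 0")
    case False
    let ?A = "\<lambda>(n, i). gco b (?d n f) i * gco b g (N - n - i)"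
    let ?B = "\<lambda>(n, i). gco b f i * gco b (?d n g) (N - n - i)"
    have 1: "of_nat i * gco b f i * gco b g (N - i) = ?s * (\<Sum>n=1..i. ?A (n, i - n))"
      if "i \<le> N" for i
      unfolding gco_euler using that by (simp add: sum_distrib_right sum_distrib_left mult.assoc)
    have 2: "gco b f i * (of_nat (N - i) * gco b g (N - i)) = ?s * (\<Sum>n=1..N-i. ?B (n, i))"
      if "i \<le> N" for i
      unfolding gco_euler by (simp add: sum_distrib_right sum_distrib_left mult.left_commute diff_commute add.commute)
    have IH: "gco b (?d n (f * g)) (N - n) = (\<Sum>i\<le>N-n. ?A (n, i)) + (\<Sum>i\<le>N-n. ?B (n, i))"
      if "n \<in> {1..N}" for n
      using that less.IH[of "N - n"] by (simp add: fdv_mult gco_add)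
    have A: "(\<Sum>n=1..N. \<Sum>i\<le>N-n. ?A (n, i)) = (\<Sum>i\<le>N. \<Sum>n=1..i. ?A (n, i - n))"
      unfolding sum.Sigma[OF finite_atLeastAtMost ballI[OF finite_atMost]]
        sum.Sigma[OF finite_atMost ballI[OF finite_atLeastAtMost]]
      by (rule sum.reindex_bij_witness[of _ "\<lambda>(i, n). (n, i - n)" "\<lambda>(n, i). (n + i, n)"]) auto
    have B: "(\<Sum>n=1..N. \<Sum>i\<le>N-n. ?B (n, i)) = (\<Sum>i\<le>N. \<Sum>n=1..N-i. ?B (n, i))"
      unfolding sum.Sigma[OF finite_atLeastAtMost ballI[OF finite_atMost]]
        sum.Sigma[OF finite_atMost ballI[OF finite_atLeastAtMost]]
      by (rule sum.reindex_bij_witness[of _ "\<lambda>(i, n). (n, i)" "\<lambda>(n, i). (i, n)"]) auto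
    have "of_nat N * gco b (f * g) N = ?s * (\<Sum>n=1..N. gco b (?d n (f * g)) (N - n))"
      by (rule gco_euler)
    also have "\<dots> = ?s * (\<Sum>n=1..N. (\<Sum>i\<le>N-n. ?A (n, i)) + (\<Sum>i\<le>N-n. ?B (n, i)))"
      by (intro arg_cong2[where f = "(*)"] refl sum.cong IH)
    also have "\<dots> = ?s * (\<Sum>i\<le>N. \<Sum>n=1..i. ?A (n, i - n)) + ?s * (\<Sum>i\<le>N. \<Sum>n=1..N-i. ?B (n, i))"
      unfolding sum.distrib A B by (simp add: distrib_left)
    also have "\<dots> = (\<Sum>i\<le>N. of_nat i * gco b f i * gco b g (N - i)) +
        (\<Sum>i\<le>N. gco b f i * (of_nat (N - i) * gco b g (N - i)))"
      unfolding sum_distrib_left[of ?s _ "{..N}"]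
      by (intro arg_cong2[where f = "(+)"] sum.cong refl) (simp_all only: 1 2 atMost_iff)
    also have "\<dots> = (\<Sum>i\<le>N. of_nat N * (gco b f i * gco b g (N - i)))"
      unfolding sum.distrib[symmetric] by (intro sum.cong refl) (auto simp: of_nat_diff algebra_simps)
    also have "\<dots> = of_nat N * (\<Sum>i\<le>N. gco b f i * gco b g (N - i))"
      by (rule sum_distrib_left[symmetric])
    finally show ?thesis by (rule gco_eqI[OF False])
  qed simp
qed

lemma gco_const:
  assumes "\<And>n. 1 \<le> n \<Longrightarrow> fdv (bv b n) f = 0"
  shows "gco b f N = (if N = 0 then f else 0)"
proof (cases "N = 0")
  case False
  have "of_nat N * gco b f N = of_nat N * 0"
    unfolding gco_euler using assms by (simp add: gco_0')
  with False show ?thesis using gco_eqI by auto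
qed simp

lemma gco_const_mult:
  assumes "\<And>n. 1 \<le> n \<Longrightarrow> fdv (bv b n) f = 0"
  shows "gco b (f * g) N = f * gco b g N"
proof -
  have "gco b (f * g) N = (\<Sum>i\<le>N. if i = 0 then f * gco b g N else 0)"
    unfolding gco_mult by (intro sum.cong refl) (auto simp: gco_const[OF assms])
  thus ?thesis by simp
qed

lemma gco_var:
  assumes "1 \<le> n"
  shows "gco b (fvar (bv b n)) N = (if N = 0 then fvar (bv b n) else if N = n then - (of_int (sg b) * fcst (1 / of_nat n)) else 0)"
proof (cases "N = 0")
  case False
  have "of_nat N * gco b (fvar (bv b n)) N = - of_int (sg b) * (\<Sum>l=1..N. if l = N then if l = n then 1 else 0 else 0)"
    unfolding gco_euler
    by (intro arg_cong2[where f = "(*)"] refl sum.cong)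
       (auto simp: fdv_var gco_0' gco_const[of _ 1, simplified])
  also have "\<dots> = - of_int (sg b) * (if N = n then 1 else 0)"
    using False by (subst sum.delta) auto
  also have "\<dots> = of_nat N * (if N = n then - (of_int (sg b) * fcst (1 / of_nat n)) else 0)"
    using False by (auto simp: of_nat_fser mult.left_commute simp flip: fcst_mult)
  finally have "gco b (fvar (bv b n)) N = (if N = n then - (of_int (sg b) * fcst (1 / of_nat n)) else 0)"
    by (rule gco_eqI[OF False])
  thus ?thesis using False by simp
qed simp

lemma gco_var_mult:
  assumes "1 \<le> n"
  shows "gco b (fvar (bv b n) * g) N = fvar (bv b n) * gco b g N
    - (if n \<le> N then of_int (sg b) * fcst (1 / of_nat n) * gco b g (N - n) else 0)"
proof -
  have "gco b (fvar (bv b n) * g) N = (\<Sum>i\<le>N. (if i = 0 then fvar (bv b n) * gco b g N else 0)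
     - (if i = n then of_int (sg b) * fcst (1 / of_nat n) * gco b g (N - n) else 0))"
    unfolding gco_mult using assms by (intro sum.cong refl) (auto simp: gco_var)
  also have "\<dots> = fvar (bv b n) * gco b g N
    - (if n \<le> N then of_int (sg b) * fcst (1 / of_nat n) * gco b g (N - n) else 0)"
    unfolding sum_subtractf by (simp add: sum.delta)
  finally show ?thesis .
qed

lemma fconv_gco:
  assumes "fconv F f"
  shows "fconv (\<lambda>n. gco b (F n) N) (gco b f N)"
  unfolding fconv_def
proof
  fix \<alpha>
  have "\<forall>\<^sub>F n in sequentially. \<forall>\<gamma>\<in>wset b N. coeff (F n) (\<alpha> + \<gamma>) = coeff f (\<alpha> + \<gamma>)"
    using assms by (intro eventually_ball_finite wset_finite ballI) (simp add: fconv_def)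
  thus "\<forall>\<^sub>F n in sequentially. coeff (gco b (F n) N) \<alpha> = coeff (gco b f N) \<alpha>"
    by (rule eventually_mono) (simp add: gco_def of_coeff_inverse)
qed

definition Gs :: "bool \<Rightarrow> fser \<Rightarrow> int \<Rightarrow> fser" where
  "Gs b f j = (if sg b * j \<le> 0 then gco b (fsh (kap b) f) (nat (- (sg b * j))) else 0)"

lemma Gs_pos [simp]: "sg b * j > 0 \<Longrightarrow> Gs b f j = 0"
  by (simp add: Gs_def)

lemma Gs_0 [simp]: "Gs b f 0 = fsh (kap b) f"
  by (simp add: Gs_def)

lemma Gs_add: "Gs b (f + g) j = Gs b f j + Gs b g j"
  by (simp add: Gs_def fsh_add gco_add)

lemma Gs_fcst_mult: "Gs b (fcst c * f) j = fcst c * Gs b f j"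
  by (simp add: Gs_def fsh_mult gco_fcst_mult)

lemma Gs_zero [simp]: "Gs b 0 j = 0"
  by (simp add: Gs_def gco_0')

lemma Gs_minus: "Gs b (- f) j = - Gs b f j"
  using Gs_fcst_mult[of b "- 1" f j] by (simp add: fcst_minus)

lemma Gs_diff: "Gs b (f - g) j = Gs b f j - Gs b g j"
  using Gs_add[of b f "- g" j] by (simp add: Gs_minus)

lemma Gs_S_mult: "Gs b (fS * f) j = (fS + of_int (kap b)) * Gs b f j"
  unfolding Gs_def fsh_mult fsh_S
  by (auto intro!: gco_const_mult simp: fdv_add fdv.D_of_int)

lemma Gs_other_mult:
  assumes "\<And>n. 1 \<le> n \<Longrightarrow> v \<noteq> bv b n"
  shows "Gs b (fvar v * f) j = fvar v * Gs b f j"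
  unfolding Gs_def fsh_mult by (auto intro!: gco_const_mult simp: fdv_var dest: assms[simplified])

text \<open>The vertex operator moves this variable by \<open>- sg b / n\<close> times z^(-n),
  respectively z^n, so the correction is read off at the power \<open>j + sg b * n\<close>. The
  failure of \<open>Gs\<close> to commute with these variables is the source of many later ordering
  terms.\<close>

lemma Gs_var_mult:
  assumes "1 \<le> n"
  shows "Gs b (fvar (bv b n) * f) j = fvar (bv b n) * Gs b f j
     - of_int (sg b) * fcst (1 / of_nat n) * Gs b f (j + sg b * int n)"
proof (cases "sg b * j \<le> 0")
  case True
  have "sg b * (j + sg b * int n) \<le> 0 \<longleftrightarrow> n \<le> nat (- (sg b * j))"
    using True by (auto simp: distrib_left nat_le_eq_zle le_nat_iff)
  moreover have "nat (- (sg b * (j + sg b * int n))) = nat (- (sg b * j)) - n"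
    by (simp add: distrib_left nat_diff_distrib')
  ultimately show ?thesis
    unfolding Gs_def fsh_mult fsh_var gco_var_mult[OF assms] using True by simp
next
  case False
  hence "sg b * (j + sg b * int n) > 0" by (simp add: distrib_left)
  with False show ?thesis by simp
qed

text \<open>This is z d/dz of the vertex operator. Summands with n beyond the order of the
  coefficient vanish, so every sufficiently large cutoff N gives the same sum; the truncations below
  are exact for this reason.\<close>

lemma Gs_euler:
  assumes "- (sg b * j) \<le> int N"
  shows "of_int j * Gs b f j = (\<Sum>n=1..N. Gs b (fdv (bv b n) f) (j + sg b * int n))"
proof (cases "sg b * j \<le> 0")
  case True
  define M where "M = nat (- (sg b * j))"
  have M: "M \<le> N" "int M = - (sg b * j)" using assms True by (auto simp: M_def)
  have j: "j = - sg b * int M" using M(2) by (simp add: mult.assoc[symmetric])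
  have "of_int j * Gs b f j = - of_int (sg b) * (of_nat M * gco b (fsh (kap b) f) M)"
    using True unfolding Gs_def M_def[symmetric] by (simp add: j)
  also have "\<dots> = (of_int (sg b) * of_int (sg b)) * (\<Sum>n=1..M. gco b (fdv (bv b n) (fsh (kap b) f)) (M - n))"
    unfolding gco_euler by (simp add: mult.assoc)
  also have "of_int (sg b) * of_int (sg b) = (1::fser)" by (simp add: sg_def)
  also have "1 * (\<Sum>n=1..M. gco b (fdv (bv b n) (fsh (kap b) f)) (M - n)) =
     (\<Sum>n=1..M. Gs b (fdv (bv b n) f) (j + sg b * int n))"
    unfolding mult_1
  proof (intro sum.cong refl)
    fix n assume "n \<in> {1..M}"
    hence "- (sg b * (j + sg b * int n)) = int (M - n)" by (simp add: j distrib_left right_diff_distrib)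
    hence "nat (- (sg b * (j + sg b * int n))) = M - n" "sg b * (j + sg b * int n) \<le> 0" by linarith+
    thus "gco b (fdv (bv b n) (fsh (kap b) f)) (M - n) = Gs b (fdv (bv b n) f) (j + sg b * int n)"
      by (simp add: Gs_def fdv_sh)
  qed
  also have "\<dots> = (\<Sum>n=1..N. Gs b (fdv (bv b n) f) (j + sg b * int n))"
    using M by (intro sum.mono_neutral_left) (auto simp: j distrib_left right_diff_distrib)
  finally show ?thesis .
next
  case False
  hence "sg b * (j + sg b * int n) > 0" for n by (simp add: distrib_left)
  with False show ?thesis by simp
qed

lemma fderiv_Gs:
  assumes "fderiv D P" "P f"
  shows "P (Gs b f j)" "D (Gs b f j) = Gs b (D f) j"
proof -
  interpret fderiv D P by (rule assms(1))
  have "P (fsh (kap b) f)" "D (fsh (kap b) f) = fsh (kap b) (D f)"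
    using assms(2) by (auto simp: P_sh D_sh)
  with fderiv_gco[OF assms(1)] show "P (Gs b f j)" "D (Gs b f j) = Gs b (D f) j"
    by (auto simp: Gs_def)
qed

lemma fconv_Gs: "fconv F f \<Longrightarrow> fconv (\<lambda>n. Gs b (F n) j) (Gs b f j)"
  by (auto simp: Gs_def intro: fconv_gco fconv_sh)

lemma Gser_eq: "Gser (coeff f) j = coeff (Gs True f j)"
  by (simp add: Gser_def Gs_def gco_def sg_def kap_def of_coeff_inverse wset_def tcoeff_def bwt_def bv_def fun_eq_iff zero_fser.rep_eq rzero_def)

lemma Gbser_eq: "Gbser (coeff f) j = coeff (Gs False f j)"
  by (simp add: Gbser_def Gs_def gco_def sg_def kap_def of_coeff_inverse wset_def tcoeff_def bwt_def bv_def
      fun_eq_iff fsh.rep_eq rshift_def zero_fser.rep_eq rzero_def)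

section \<open>Difference operators\<close>

type_synonym fop = "int \<Rightarrow> fser"

text \<open>For \<open>h = 1\<close> this is the product of difference operators, for \<open>h = 0\<close> the product of their symbols.\<close>

definition mul :: "int \<Rightarrow> fop \<Rightarrow> fop \<Rightarrow> fop" where
  "mul h A B = (\<lambda>n. \<Sum>i\<in>{i. A i \<noteq> 0 \<and> B (n - i) \<noteq> 0}. A i * fsh (h * i) (B (n - i)))"

definition lamb :: "int \<Rightarrow> fop" where "lamb j = (\<lambda>i. if i = j then 1 else 0)"
definition sm :: "fser \<Rightarrow> fop \<Rightarrow> fop" where "sm f A = (\<lambda>i. f * A i)"
definition bd :: "bool \<Rightarrow> fop \<Rightarrow> bool" where "bd b A \<longleftrightarrow> (\<exists>N. \<forall>i. sg b * i > N \<longrightarrow> A i = 0)"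
definition proj :: "bool \<Rightarrow> fop \<Rightarrow> fop" where "proj b A = (\<lambda>i. if b \<longleftrightarrow> i < 0 then A i else 0)"
definition neg_supp :: "bool \<Rightarrow> fop \<Rightarrow> bool" where "neg_supp b A \<longleftrightarrow> (\<forall>i. sg b * i > 0 \<longrightarrow> A i = 0)"
text \<open>\<open>mul\<close> returns 0 at a power where infinitely many terms meet, so bilinearity
  needs this condition. It holds if both factors are bounded on the same side or if one is
  finite.\<close>

definition mulok :: "fop \<Rightarrow> fop \<Rightarrow> bool" where
  "mulok A B \<longleftrightarrow> (\<forall>n. finite {i. A i \<noteq> 0 \<and> B (n - i) \<noteq> 0})"
definition finop :: "fop \<Rightarrow> bool" where "finop A \<longleftrightarrow> finite {i. A i \<noteq> 0}"

lemma mul_superset: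
  assumes "finite S" "{i. A i \<noteq> 0 \<and> B (n - i) \<noteq> 0} \<subseteq> S"
  shows "mul h A B n = (\<Sum>i\<in>S. A i * fsh (h * i) (B (n - i)))"
  unfolding mul_def using assms by (intro sum.mono_neutral_left) auto

lemma mul_nonzeroE:
  assumes "mul h A B n \<noteq> 0"
  obtains i where "A i \<noteq> 0" "B (n - i) \<noteq> 0"
proof -
  have "{i. A i \<noteq> 0 \<and> B (n - i) \<noteq> 0} \<noteq> {}"
    using assms unfolding mul_def by (metis sum.empty)
  thus ?thesis using that by blast
qed

lemma bdE:
  assumes "bd b A"
  obtains N where "N \<ge> 0" "\<And>i. sg b * i > N \<Longrightarrow> A i = 0"
proof -
  obtain N where "\<And>i. sg b * i > N \<Longrightarrow> A i = 0" using assms by (auto simp: bd_def)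
  thus ?thesis using that[of "max N 0"] by auto
qed

lemma abs_sg: "sg b * i \<le> N \<Longrightarrow> - M \<le> sg b * i \<Longrightarrow> i \<in> {- (\<bar>N\<bar> + \<bar>M\<bar>)..\<bar>N\<bar> + \<bar>M\<bar>}"
  by (auto simp: sg_def split: if_splits)

lemma finop_iff: "finop A \<longleftrightarrow> bd b A \<and> bd (\<not> b) A"
proof
  assume f: "finop A"
  have "bd c A" for c
  proof -
    define N where "N = Max (insert 0 ((\<lambda>i. sg c * i) ` {i. A i \<noteq> 0}))"
    have "sg c * i \<le> N" if "A i \<noteq> 0" for i
      unfolding N_def using f that by (intro Max_ge) (auto simp: finop_def)
    thus ?thesis unfolding bd_def by (intro exI[of _ N]) force
  qed
  thus "bd b A \<and> bd (\<not> b) A" by simp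
next
  assume "bd b A \<and> bd (\<not> b) A"
  then obtain N M where "N \<ge> 0" "\<And>i. sg b * i > N \<Longrightarrow> A i = 0" "M \<ge> 0" "\<And>i. sg (\<not> b) * i > M \<Longrightarrow> A i = 0"
    by (metis bdE)
  hence "{i. A i \<noteq> 0} \<subseteq> {- (N + M)..N + M}"
    by (force simp: sg_def split: if_splits)
  thus "finop A" unfolding finop_def by (rule finite_subset) simp
qed

lemma finop_bd: "finop A \<Longrightarrow> bd b A" using finop_iff by blast

lemma mulok_bd:
  assumes "bd b A" "bd b B"
  shows "mulok A B"
  unfolding mulok_def
proof
  fix n
  obtain N where N: "\<And>i. sg b * i > N \<Longrightarrow> A i = 0" using assms(1) by (auto simp: bd_def)
  obtain M where M: "\<And>i. sg b * i > M \<Longrightarrow> B i = 0" using assms(2) by (auto simp: bd_def)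
  have "{i. A i \<noteq> 0 \<and> B (n - i) \<noteq> 0} \<subseteq> {- (\<bar>N\<bar> + \<bar>M - sg b * n\<bar>)..\<bar>N\<bar> + \<bar>M - sg b * n\<bar>}"
  proof
    fix i assume "i \<in> {i. A i \<noteq> 0 \<and> B (n - i) \<noteq> 0}"
    hence "sg b * i \<le> N" "sg b * (n - i) \<le> M" using N M by force+
    thus "i \<in> {- (\<bar>N\<bar> + \<bar>M - sg b * n\<bar>)..\<bar>N\<bar> + \<bar>M - sg b * n\<bar>}"
      by (intro abs_sg) (auto simp: right_diff_distrib)
  qed
  thus "finite {i. A i \<noteq> 0 \<and> B (n - i) \<noteq> 0}" by (rule finite_subset) simp
qed

lemma mulok_fin_left: "finop A \<Longrightarrow> mulok A B"
  unfolding mulok_def finop_def by (auto elim: rev_finite_subset)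

lemma mulok_fin_right: "finop B \<Longrightarrow> mulok A B"
  unfolding mulok_def finop_def
proof
  fix n assume "finite {i. B i \<noteq> 0}"
  hence "finite ((\<lambda>i. n - i) ` {i. B i \<noteq> 0})" by simp
  moreover have "{i. A i \<noteq> 0 \<and> B (n - i) \<noteq> 0} \<subseteq> (\<lambda>i. n - i) ` {i. B i \<noteq> 0}"
    by (auto intro: image_eqI[of _ _ "n - i" for i])
  ultimately show "finite {i. A i \<noteq> 0 \<and> B (n - i) \<noteq> 0}" by (rule rev_finite_subset)
qed

lemma mul_add_left:
  assumes "mulok A C" "mulok B C"
  shows "mul h (A + B) C = mul h A C + mul h B C"
proof
  fix n
  let ?S = "{i. A i \<noteq> 0 \<and> C (n - i) \<noteq> 0} \<union> {i. B i \<noteq> 0 \<and> C (n - i) \<noteq> 0}"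
  have "finite ?S" using assms by (simp add: mulok_def)
  hence *: "mul h X C n = (\<Sum>i\<in>?S. X i * fsh (h * i) (C (n - i)))" if "X \<in> {A, B, A + B}" for X
    using that by (intro mul_superset) auto
  show "mul h (A + B) C n = (mul h A C + mul h B C) n"
    by (simp add: * algebra_simps sum.distrib)
qed

lemma mul_add_right:
  assumes "mulok C A" "mulok C B"
  shows "mul h C (A + B) = mul h C A + mul h C B"
proof
  fix n
  let ?S = "{i. C i \<noteq> 0 \<and> A (n - i) \<noteq> 0} \<union> {i. C i \<noteq> 0 \<and> B (n - i) \<noteq> 0}"
  have "finite ?S" using assms by (simp add: mulok_def)
  hence *: "mul h C X n = (\<Sum>i\<in>?S. C i * fsh (h * i) (X (n - i)))" if "X \<in> {A, B, A + B}" for X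
    using that by (intro mul_superset) auto
  show "mul h C (A + B) n = (mul h C A + mul h C B) n"
    by (simp add: * fsh_add algebra_simps sum.distrib)
qed

lemma mul_sm_left: "mulok A B \<Longrightarrow> mul h (sm f A) B = sm f (mul h A B)"
  unfolding sm_def
  by (rule ext, subst mul_superset[where S = "{i. A i \<noteq> 0 \<and> B (n - i) \<noteq> 0}" for n])
     (auto simp: mulok_def mul_def sum_distrib_left mult.assoc)

lemma mul_sm_right:
  assumes "mulok A B" "\<And>i. fsh i f = f"
  shows "mul h A (sm f B) = sm f (mul h A B)"
  unfolding sm_def using assms
  by (intro ext, subst mul_superset[where S = "{i. A i \<noteq> 0 \<and> B (n - i) \<noteq> 0}" for n])
     (auto simp: mulok_def mul_def sum_distrib_left mult.left_commute fsh_mult)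

lemma mul_zero_left [simp]: "mul h 0 B = 0" and mul_zero_right [simp]: "mul h A 0 = 0"
  by (auto simp: mul_def)

lemma mul_minus_left: "mul h (- A) B = - mul h A B"
  by (simp add: mul_def sum_negf fun_eq_iff)

lemma mul_minus_right: "mul h A (- B) = - mul h A B"
  by (simp add: mul_def sum_negf fun_eq_iff fsh_minus)

lemma mulok_minus_left [simp]: "mulok (- A) B \<longleftrightarrow> mulok A B"
  and mulok_minus_right [simp]: "mulok A (- B) \<longleftrightarrow> mulok A B"
  by (simp_all add: mulok_def)

lemma mul_diff_left: "mulok A C \<Longrightarrow> mulok B C \<Longrightarrow> mul h (A - B) C = mul h A C - mul h B C"
  using mul_add_left[of A C "- B" h] by (simp add: mul_minus_left)

text \<open>At a fixed power n both bracketings are the same sum over the finite set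
  \<open>T\<close> of index pairs for which all three factors are nonzero.\<close>

lemma mul_assoc_gen:
  assumes fin: "\<And>n. finite {(i, j). A i \<noteq> 0 \<and> B j \<noteq> 0 \<and> C (n - i - j) \<noteq> 0}"
  shows "mul h (mul h A B) C = mul h A (mul h B C)"
proof
  fix n
  define T where "T = {(i, j). A i \<noteq> 0 \<and> B j \<noteq> 0 \<and> C (n - i - j) \<noteq> 0}"
  have T: "finite T" unfolding T_def by (rule fin)
  let ?t = "\<lambda>(i, j). A i * fsh (h * i) (B j) * fsh (h * (i + j)) (C (n - i - j))"
  let ?I = "(\<lambda>(i, j). i + j) ` T"
  let ?S = "\<lambda>l. {i. A i \<noteq> 0 \<and> B (l - i) \<noteq> 0}" and ?R = "\<lambda>i. {j. B j \<noteq> 0 \<and> C (n - i - j) \<noteq> 0}"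
  \<comment> \<open>An inner product is only evaluated at powers \<open>l\<close> with
    \<open>C (n - l)\<close> nonzero; there each of its terms is a point of \<open>T\<close>, which
    also gives its finiteness.\<close>
  have memT: "(i, l - i) \<in> T" if "l \<in> ?I" "i \<in> ?S l" for l i
  proof -
    have "C (n - l) \<noteq> 0" using that(1) by (auto simp: T_def diff_diff_eq)
    thus ?thesis using that(2) by (simp add: T_def)
  qed
  have finS: "finite (?S l)" if "l \<in> ?I" for l
  proof (rule finite_subset)
    show "?S l \<subseteq> fst ` T" using memT[OF that] by force
  qed (use T in simp)
  have finR: "finite (?R i)" if "i \<in> fst ` T" for i
  proof (rule finite_subset)
    have "A i \<noteq> 0" using that by (auto simp: T_def)
    hence "(i, j) \<in> T" if "j \<in> ?R i" for j using that by (simp add: T_def)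
    thus "?R i \<subseteq> snd ` T" by force
  qed (use T in simp)
  have "mul h (mul h A B) C n = (\<Sum>l\<in>?I. mul h A B l * fsh (h * l) (C (n - l)))"
  proof (rule mul_superset)
    show "{l. mul h A B l \<noteq> 0 \<and> C (n - l) \<noteq> 0} \<subseteq> ?I"
    proof clarify
      fix l assume l: "mul h A B l \<noteq> 0" "C (n - l) \<noteq> 0"
      obtain i where "A i \<noteq> 0" "B (l - i) \<noteq> 0" using l(1) by (rule mul_nonzeroE)
      with l have "(i, l - i) \<in> T" by (simp add: T_def)
      thus "l \<in> ?I" by force
    qed
  qed (use T in simp)
  also have "\<dots> = (\<Sum>l\<in>?I. \<Sum>i\<in>?S l. ?t (i, l - i))"
    unfolding mul_def sum_distrib_right by (intro sum.cong refl) simp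
  also have "\<dots> = (\<Sum>(l, i)\<in>Sigma ?I ?S. ?t (i, l - i))"
    using T finS by (subst sum.Sigma) auto
  also have "\<dots> = sum ?t T"
  proof (rule sum.reindex_bij_witness[of _ "\<lambda>(i, j). (i + j, i)" "\<lambda>(l, i). (i, l - i)"], goal_cases)
    case (2 a)
    obtain l i where "a = (l, i)" by (cases a)
    with 2 memT[of l i] show ?case by simp
  next
    case (4 b)
    obtain i j where b: "b = (i, j)" by (cases b)
    with 4 have "i + j \<in> ?I" by force
    thus ?case using 4 by (simp add: b T_def)
  qed (auto simp: algebra_simps)
  also have "\<dots> = (\<Sum>(i, j)\<in>Sigma (fst ` T) ?R. ?t (i, j))"
    by (intro sum.cong) (auto simp: T_def image_iff, blast)
  also have "\<dots> = (\<Sum>i\<in>fst ` T. \<Sum>j\<in>?R i. ?t (i, j))"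
    using T finR by (subst sum.Sigma) auto
  also have "\<dots> = (\<Sum>i\<in>fst ` T. A i * fsh (h * i) (mul h B C (n - i)))"
    unfolding mul_def fsh_sum sum_distrib_left
    by (intro sum.cong refl) (simp add: fsh_mult mult.assoc distrib_left)
  also have "\<dots> = mul h A (mul h B C) n"
  proof (rule mul_superset[symmetric])
    show "{i. A i \<noteq> 0 \<and> mul h B C (n - i) \<noteq> 0} \<subseteq> fst ` T"
    proof clarify
      fix i assume i: "A i \<noteq> 0" "mul h B C (n - i) \<noteq> 0"
      obtain j where "B j \<noteq> 0" "C (n - i - j) \<noteq> 0" using i(2) by (rule mul_nonzeroE)
      with i have "(i, j) \<in> T" by (simp add: T_def)
      thus "i \<in> fst ` T" by force
    qed
  qed (use T in simp)
  finally show "mul h (mul h A B) C n = mul h A (mul h B C) n" .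
qed

lemma mul_assoc_bd:
  assumes "bd b A" "bd b B" "bd b C"
  shows "mul h (mul h A B) C = mul h A (mul h B C)"
proof (rule mul_assoc_gen)
  fix n
  obtain N where N: "N \<ge> 0" "\<And>i. sg b * i > N \<Longrightarrow> A i = 0" using bdE[OF assms(1)] by metis
  obtain M where M: "M \<ge> 0" "\<And>i. sg b * i > M \<Longrightarrow> B i = 0" using bdE[OF assms(2)] by metis
  obtain K where K: "K \<ge> 0" "\<And>i. sg b * i > K \<Longrightarrow> C i = 0" using bdE[OF assms(3)] by metis
  let ?I = "{- (N + M + K + \<bar>n\<bar>)..N + M + K + \<bar>n\<bar>}"
  have "{(i, j). A i \<noteq> 0 \<and> B j \<noteq> 0 \<and> C (n - i - j) \<noteq> 0} \<subseteq> ?I \<times> ?I"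
  proof
    fix p assume "p \<in> {(i, j). A i \<noteq> 0 \<and> B j \<noteq> 0 \<and> C (n - i - j) \<noteq> 0}"
    then obtain i j where p: "p = (i, j)" "A i \<noteq> 0" "B j \<noteq> 0" "C (n - i - j) \<noteq> 0" by blast
    hence "sg b * i \<le> N" "sg b * j \<le> M" "sg b * (n - i - j) \<le> K" using N(2) M(2) K(2) by force+
    thus "p \<in> ?I \<times> ?I" using N(1) M(1) K(1) p(1) by (auto simp: sg_def split: if_splits)
  qed
  thus "finite {(i, j). A i \<noteq> 0 \<and> B j \<noteq> 0 \<and> C (n - i - j) \<noteq> 0}"
    by (rule finite_subset) simp
qed

text \<open>Needed for log L, which may be unbounded in both directions, next to two powers of L:
  two finite factors leave only finitely many index pairs.\<close>

lemma mul_assoc_fin: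
  assumes "finop A \<and> finop B \<or> finop A \<and> finop C \<or> finop B \<and> finop C"
  shows "mul h (mul h A B) C = mul h A (mul h B C)"
proof (rule mul_assoc_gen)
  fix n
  let ?T = "{(i, j). A i \<noteq> 0 \<and> B j \<noteq> 0 \<and> C (n - i - j) \<noteq> 0}"
  let ?S = "\<lambda>X. {i. X i \<noteq> (0::fser)}"
  show "finite ?T"
    using assms unfolding finop_def
  proof (elim disjE conjE)
    assume "finite (?S A)" "finite (?S B)"
    thus ?thesis by (auto intro: finite_subset[of _ "?S A \<times> ?S B"])
  next
    assume "finite (?S A)" "finite (?S C)"
    hence "finite ((\<lambda>(i, l). (i, n - i - l)) ` (?S A \<times> ?S C))" by simp
    moreover have "?T \<subseteq> (\<lambda>(i, l). (i, n - i - l)) ` (?S A \<times> ?S C)"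
      by (force simp: image_iff intro: bexI[of _ "(i, n - i - j)" for i j])
    ultimately show ?thesis by (rule rev_finite_subset)
  next
    assume "finite (?S B)" "finite (?S C)"
    hence "finite ((\<lambda>(j, l). (n - j - l, j)) ` (?S B \<times> ?S C))" by simp
    moreover have "?T \<subseteq> (\<lambda>(j, l). (n - j - l, j)) ` (?S B \<times> ?S C)"
      by (force simp: image_iff intro: bexI[of _ "(j, n - i - j)" for i j])
    ultimately show ?thesis by (rule rev_finite_subset)
  qed
qed

lemma bd_add: "bd b A \<Longrightarrow> bd b B \<Longrightarrow> bd b (A + B)"
proof (elim bdE)
  fix N M assume "\<And>i. N < sg b * i \<Longrightarrow> A i = 0" "\<And>i. M < sg b * i \<Longrightarrow> B i = 0"
  thus ?thesis unfolding bd_def by (intro exI[of _ "max N M"]) auto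
qed

lemma bd_minus [simp]: "bd b (- A) \<longleftrightarrow> bd b A"
  by (simp add: bd_def)

lemma bd_diff: "bd b A \<Longrightarrow> bd b B \<Longrightarrow> bd b (A - B)"
  using bd_add[of b A "- B"] by simp

lemma bd_zero [simp]: "bd b 0" by (simp add: bd_def)

lemma bd_sum: "(\<And>x. x \<in> S \<Longrightarrow> bd b (F x)) \<Longrightarrow> bd b (sum F S)"
  by (induction S rule: infinite_finite_induct) (auto intro: bd_add)

lemma bd_sm: "bd b A \<Longrightarrow> bd b (sm f A)"
  unfolding bd_def sm_def by (metis mult_zero_right)

lemma bd_proj: "bd b A \<Longrightarrow> bd b (proj c A)"
  by (auto simp: bd_def proj_def)

lemma bd_proj_same [simp]: "bd b (proj b A)"
  unfolding bd_def proj_def by (intro exI[of _ 0]) (auto simp: sg_def)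

lemma bd_mul:
  assumes "bd b A" "bd b B"
  shows "bd b (mul h A B)"
proof -
  obtain N where N: "N \<ge> 0" "\<And>i. sg b * i > N \<Longrightarrow> A i = 0" using bdE[OF assms(1)] by metis
  obtain M where M: "M \<ge> 0" "\<And>i. sg b * i > M \<Longrightarrow> B i = 0" using bdE[OF assms(2)] by metis
  have "mul h A B n = 0" if "sg b * n > N + M" for n
  proof (rule ccontr)
    assume "mul h A B n \<noteq> 0"
    then obtain i where "A i \<noteq> 0" "B (n - i) \<noteq> 0" by (rule mul_nonzeroE)
    hence "sg b * i \<le> N" "sg b * (n - i) \<le> M" using N(2)[of i] M(2)[of "n - i"] by fastforce+
    with that show False by (simp add: right_diff_distrib)
  qed
  thus ?thesis unfolding bd_def by blast
qed

lemma finop_lamb [simp]: "finop (lamb j)"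
  by (simp add: finop_def lamb_def)

lemma bd_lamb [simp]: "bd b (lamb j)" by (simp add: finop_bd)

lemma mul_lamb_right: "mul h A (lamb j) n = A (n - j)"
  by (subst mul_superset[of "{n - j}"]) (auto simp: lamb_def)

lemma mul_lamb_left: "mul h (lamb j) A n = fsh (h * j) (A (n - j))"
  by (subst mul_superset[of "{j}"]) (auto simp: lamb_def)

lemma mul_one_left [simp]: "mul h (lamb 0) A = A" and mul_one_right [simp]: "mul h A (lamb 0) = A"
  by (auto simp: mul_lamb_right mul_lamb_left)

lemma mul_lamb_lamb: "mul h (lamb i) (lamb j) = lamb (i + j)"
  by (rule ext, subst mul_lamb_right) (auto simp: lamb_def)

lemma proj_add: "proj b (A + B) = proj b A + proj b B"
  and proj_diff: "proj b (A - B) = proj b A - proj b B"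
  and proj_sm: "proj b (sm f A) = sm f (proj b A)"
  and proj_proj: "proj b (proj c A) = (if b = c then proj b A else 0)"
  and proj_zero [simp]: "proj b 0 = 0"
  and proj_split: "proj b A + proj (\<not> b) A = A"
  by (auto simp: proj_def sm_def fun_eq_iff)

lemma sm_add: "sm f (A + B) = sm f A + sm f B" and sm_add': "sm (f + g) A = sm f A + sm g A"
  and sm_sm: "sm f (sm g A) = sm (f * g) A" and sm_1 [simp]: "sm 1 A = A" and sm_0 [simp]: "sm 0 A = 0"
  and sm_zero [simp]: "sm f 0 = 0"
  and sm_minus: "sm (- f) A = - sm f A"
  by (auto simp: sm_def fun_eq_iff algebra_simps)

text \<open>The negative powers and the nonnegative powers each span a subalgebra.\<close>

lemma proj_mul_proj:
  "proj b (mul h (proj b A) (proj b B)) = mul h (proj b A) (proj b B)"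
proof
  fix n
  have "mul h (proj b A) (proj b B) n = 0" if "\<not> (b \<longleftrightarrow> n < 0)"
  proof -
    have e: "{i. proj b A i \<noteq> 0 \<and> proj b B (n - i) \<noteq> 0} = {}"
      using that by (auto simp: proj_def split: if_splits)
    show ?thesis unfolding mul_def e by simp
  qed
  thus "proj b (mul h (proj b A) (proj b B)) n = mul h (proj b A) (proj b B) n"
    by (auto simp: proj_def)
qed

lemma neg_suppD: "neg_supp b A \<Longrightarrow> sg b * i > 0 \<Longrightarrow> A i = 0"
  by (auto simp: neg_supp_def)

lemma neg_supp_bd: "neg_supp b A \<Longrightarrow> bd b A"
  unfolding neg_supp_def bd_def by blast

lemma neg_supp_mul:
  assumes "neg_supp b A" "neg_supp b B"
  shows "mul h A B (- sg b * int n) =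
     (\<Sum>l\<le>n. A (- sg b * int l) * fsh (h * (- sg b * int l)) (B (- sg b * int (n - l))))"
    and "neg_supp b (mul h A B)"
proof -
  let ?f = "\<lambda>l. - sg b * int l"
  have inj: "inj_on ?f {..n}" by (auto simp: inj_on_def sg_def)
  have "mul h A B (?f n) = (\<Sum>i\<in>?f ` {..n}. A i * fsh (h * i) (B (?f n - i)))"
  proof (rule mul_superset)
    show "{i. A i \<noteq> 0 \<and> B (?f n - i) \<noteq> 0} \<subseteq> ?f ` {..n}"
    proof
      fix i assume "i \<in> {i. A i \<noteq> 0 \<and> B (?f n - i) \<noteq> 0}"
      hence i: "sg b * i \<le> 0" "sg b * (?f n - i) \<le> 0"
        using neg_suppD[OF assms(1), of i] neg_suppD[OF assms(2), of "?f n - i"] by fastforce+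
      hence "i = ?f (nat (- (sg b * i)))" by (simp add: mult.assoc[symmetric])
      moreover have "nat (- (sg b * i)) \<le> n" using i by (simp add: right_diff_distrib nat_le_iff)
      ultimately show "i \<in> ?f ` {..n}" by blast
    qed
  qed simp
  also have "\<dots> = (\<Sum>l\<le>n. A (?f l) * fsh (h * ?f l) (B (?f n - ?f l)))"
    by (subst sum.reindex[OF inj]) simp
  also have "\<dots> = (\<Sum>l\<le>n. A (?f l) * fsh (h * ?f l) (B (?f (n - l))))"
    by (intro sum.cong refl) (simp add: of_nat_diff right_diff_distrib)
  finally show "mul h A B (- sg b * int n) =
     (\<Sum>l\<le>n. A (- sg b * int l) * fsh (h * (- sg b * int l)) (B (- sg b * int (n - l))))" .
  show "neg_supp b (mul h A B)"
    unfolding neg_supp_def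
  proof (intro allI impI)
    fix n assume n: "sg b * n > 0"
    show "mul h A B n = 0"
    proof (rule ccontr)
      assume "mul h A B n \<noteq> 0"
      then obtain i where "A i \<noteq> 0" "B (n - i) \<noteq> 0" by (rule mul_nonzeroE)
      hence "sg b * i \<le> 0" "sg b * (n - i) \<le> 0"
        using neg_suppD[OF assms(1), of i] neg_suppD[OF assms(2), of "n - i"] by fastforce+
      with n show False by (simp add: right_diff_distrib)
    qed
  qed
qed

section \<open>Inverses and cancellation for half-bounded operators\<close>

fun inv_coeff :: "int \<Rightarrow> bool \<Rightarrow> fop \<Rightarrow> fser \<Rightarrow> nat \<Rightarrow> fser" where
  "inv_coeff h b A u n = u * ((if n = 0 then 1 else 0) -
     (\<Sum>i<n. A (- sg b * int (n - i)) * fsh (h * (- sg b * int (n - i))) (inv_coeff h b A u i)))"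

declare inv_coeff.simps [simp del]

lemma fderiv_inv_coeff:
  assumes "fderiv D P" "P u" "\<And>i. P (A i)"
  shows "P (inv_coeff h b A u n)"
proof (induction n rule: less_induct)
  case (less n)
  interpret fderiv D P by (rule assms(1))
  show ?case using less assms(2,3)
    by (subst inv_coeff.simps) (intro P_mult P_diff P_sum P_sh; simp)
qed

text \<open>The coefficients are solved recursively from the leading one. The recursion uses only
  ring operations and shifts, so it stays in the domain \<open>P\<close> of any derivation; this
  later yields differentiability of the inverse wave operators in s.\<close>

lemma right_inverse_exists:
  assumes A: "neg_supp b A" and u: "u * A 0 = 1"
  obtains V where "neg_supp b V" "mul h A V = lamb 0" "A 0 * V 0 = 1"
    "\<And>D P. fderiv D P \<Longrightarrow> P u \<Longrightarrow> (\<And>i. P (A i)) \<Longrightarrow> (\<And>i. P (V i))"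
proof -
  define v where "v = inv_coeff h b A u"
  define V where "V = (\<lambda>i. if sg b * i > 0 then 0 else v (nat (- (sg b * i))))"
  have Vn: "V (- sg b * int n) = v n" for n
    by (simp add: V_def mult.assoc[symmetric])
  have V: "neg_supp b V" by (simp add: neg_supp_def V_def)
  have rec: "A 0 * v n = (if n = 0 then 1 else 0) -
      (\<Sum>i<n. A (- sg b * int (n - i)) * fsh (h * (- sg b * int (n - i))) (v i))" for n
    unfolding v_def by (subst inv_coeff.simps) (use u in \<open>simp add: mult.assoc[symmetric] mult.commute[of "A 0"]\<close>)
  have "mul h A V i = lamb 0 i" for i
  proof (cases "sg b * i > 0")
    case True
    hence "i \<noteq> 0" by auto
    with True neg_supp_mul(2)[OF A V, of h] show ?thesis by (auto simp: neg_supp_def lamb_def)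
  next
    case False
    define n where "n = nat (- (sg b * i))"
    have i: "i = - sg b * int n" using False by (simp add: n_def)
    have "mul h A V i = (\<Sum>l\<le>n. A (- sg b * int l) * fsh (h * (- sg b * int l)) (v (n - l)))"
      unfolding i neg_supp_mul(1)[OF A V] Vn ..
    also have "\<dots> = (\<Sum>l\<le>n. A (- sg b * int (n - l)) * fsh (h * (- sg b * int (n - l))) (v l))"
      by (rule sum.reindex_bij_witness[of _ "\<lambda>l. n - l" "\<lambda>l. n - l"]) auto
    also have "\<dots> = A 0 * v n + (\<Sum>l<n. A (- sg b * int (n - l)) * fsh (h * (- sg b * int (n - l))) (v l))"
      unfolding lessThan_Suc_atMost[symmetric] sum.lessThan_Suc by (simp add: add.commute)
    also have "\<dots> = lamb 0 i" unfolding rec by (auto simp: i lamb_def sg_def)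
    finally show ?thesis .
  qed
  moreover have "A 0 * V 0 = 1" using Vn[of 0] rec[of 0] by simp
  moreover have "P (V i)" if "fderiv D P" "P u" "\<And>i. P (A i)" for D P i
  proof -
    interpret fderiv D P by fact
    show ?thesis using fderiv_inv_coeff[OF that, where h = h] by (simp add: V_def v_def)
  qed
  ultimately show ?thesis using that V by blast
qed

lemma inverse_exists:
  assumes A: "neg_supp b A" and u: "u * A 0 = 1"
  obtains V where "neg_supp b V" "mul h A V = lamb 0" "mul h V A = lamb 0"
    "\<And>D P. fderiv D P \<Longrightarrow> P u \<Longrightarrow> (\<And>i. P (A i)) \<Longrightarrow> (\<And>i. P (V i))"
proof -
  obtain V where V: "neg_supp b V" "mul h A V = lamb 0" "A 0 * V 0 = 1"
    "\<And>D P i. fderiv D P \<Longrightarrow> P u \<Longrightarrow> (\<And>i. P (A i)) \<Longrightarrow> P (V i)"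
    using right_inverse_exists[OF A u, of h] by metis
  obtain X where X: "neg_supp b X" "mul h V X = lamb 0"
    using right_inverse_exists[OF V(1,3), of h] by metis
  \<comment> \<open>\<open>V\<close> has a right inverse \<open>X\<close> of its own, and
    associativity forces \<open>X = A\<close>; hence \<open>V\<close> is also a left
    inverse.\<close>
  have "A = mul h A (mul h V X)" by (simp add: X)
  also have "\<dots> = mul h (mul h A V) X"
    by (rule mul_assoc_bd[symmetric, of b]) (rule neg_supp_bd A V(1) X(1))+
  finally have "A = X" by (simp add: V)
  with X V that show ?thesis by blast
qed

text \<open>Gives the uniqueness behind the descriptions \<open>inv_mm\<close> and
  \<open>inv_pp\<close>; the right-handed version below does the same for \<open>sdiv_minus\<close>
  and \<open>sdiv_plus\<close>.\<close>

lemma left_cancel: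
  assumes A: "neg_supp b A" and u: "u * A 0 = 1" and "bd b Y" "bd b Z" "mul h A Y = mul h A Z"
  shows "Y = Z"
proof -
  obtain V where V: "neg_supp b V" "mul h V A = lamb 0" using inverse_exists[OF A u, of h] by metis
  have "mul h (mul h V A) Z = mul h V (mul h A Z)" if "bd b Z" for Z
    by (intro mul_assoc_bd[of b] that neg_supp_bd[OF A] neg_supp_bd[OF V(1)])
  thus ?thesis using assms V by (metis mul_one_left)
qed

lemma right_cancel:
  assumes A: "neg_supp b A" and u: "u * A 0 = 1" and "bd b Y" "bd b Z" "mul h Y A = mul h Z A"
  shows "Y = Z"
proof -
  obtain V where V: "neg_supp b V" "mul h A V = lamb 0" using inverse_exists[OF A u, of h] by metis
  have "mul h (mul h Z A) V = mul h Z (mul h A V)" if "bd b Z" for Z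
    by (intro mul_assoc_bd[of b] that neg_supp_bd[OF A] neg_supp_bd[OF V(1)])
  thus ?thesis using assms V by (metis mul_one_right)
qed

definition dop :: "(fser \<Rightarrow> fser) \<Rightarrow> fop \<Rightarrow> fop" where "dop D A = (\<lambda>i. D (A i))"

lemma dop_mul:
  assumes "fderiv D P" "mulok A B" "\<And>i. P (A i)" "\<And>i. P (B i)"
  shows "dop D (mul h A B) = mul h (dop D A) B + mul h A (dop D B)"
proof
  fix n
  interpret fderiv D P by fact
  let ?S = "{i. A i \<noteq> 0 \<and> B (n - i) \<noteq> 0}"
  have S: "finite ?S" using assms(2) by (simp add: mulok_def)
  have 1: "mul h (dop D A) B n = (\<Sum>i\<in>?S. D (A i) * fsh (h * i) (B (n - i)))"
    unfolding dop_def by (subst mul_superset[OF S]) (auto simp: D_0)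
  have 2: "mul h A (dop D B) n = (\<Sum>i\<in>?S. A i * fsh (h * i) (D (B (n - i))))"
    unfolding dop_def by (subst mul_superset[OF S]) (auto simp: D_0)
  show "dop D (mul h A B) n = (mul h (dop D A) B + mul h A (dop D B)) n"
    unfolding plus_fun_apply 1 2 using assms(3,4)
    by (simp add: dop_def mul_def D_sum P_mult P_sh D_mult D_sh sum.distrib)
qed

lemma bd_dop: "fderiv D P \<Longrightarrow> bd b A \<Longrightarrow> bd b (dop D A)"
  by (auto simp: bd_def dop_def fderiv.D_0) (metis fderiv.D_0)

lemma P_mul:
  assumes "fderiv D P" "\<And>i. P (A i)" "\<And>i. P (B i)"
  shows "P (mul h A B n)"
proof -
  interpret fderiv D P by fact
  show ?thesis unfolding mul_def using assms(2,3) by (auto intro!: P_sum P_mult P_sh)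
qed

section \<open>Wave operators and the two sides of the identity\<close>

text \<open>The power 0 belongs to \<open>proj False\<close>, so the two halves are not mirror
  images. Operators supported strictly on side \<open>b\<close>, away from the power 0, fall
  entirely into \<open>proj b\<close> in either case.\<close>

lemma proj_strict:
  assumes "\<And>i. sg b * i \<ge> 0 \<Longrightarrow> A i = 0"
  shows "proj b A = A" "proj (\<not> b) A = 0"
proof -
  have "A i = 0" if "b \<noteq> (i < 0)" for i
    using assms[of i] that by (cases b) (auto simp: sg_def)
  thus "proj b A = A" by (auto simp: proj_def fun_eq_iff)
  have "A i = 0" if "(\<not> b) = (i < 0)" for i
    using assms[of i] that by (cases b) (auto simp: sg_def)
  thus "proj (\<not> b) A = 0" by (auto simp: proj_def fun_eq_iff)
qed

lemma sgf_sq [simp]: "of_int (sg b) * of_int (sg b) = (1 :: fser)"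
  by (simp add: sg_def)

lemma sgf_sq' [simp]: "of_int (sg b) * (of_int (sg b) * f) = (f :: fser)"
  by (simp add: mult.assoc[symmetric])

lemma sm_sum: "sm f (sum g S) = (\<Sum>x\<in>S. sm f (g x))"
  by (induction S rule: infinite_finite_induct) (simp_all only: sum.infinite sum.empty sum.insert sm_add sm_zero not_False_eq_True)

lemma sum_op_apply: "(sum f S :: fop) i = (\<Sum>x\<in>S. f x i)"
  by (induction S rule: infinite_finite_induct) simp_all

locale unit_series =
  fixes t u :: fser
  assumes ut: "u * t = 1" and fdiff_t: "fdiff t"
begin

definition Wv :: "bool \<Rightarrow> fop" where "Wv b = (\<lambda>i. Gs b t i * u)"

lemma tu: "t * u = 1" using ut by (simp add: mult.commute)

lemma tu' [simp]: "t * (u * f) = f" "u * (t * f) = f"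
  by (simp_all add: mult.assoc[symmetric] tu ut)

lemma fdiff_u: "fdiff u" by (rule fdiff_inverse[OF ut fdiff_t])

lemma neg_W: "neg_supp b (Wv b)"
  by (auto simp: neg_supp_def Wv_def)

text \<open>The leading coefficient is 1 for W and tau(s+1)/tau(s) for Wbar.\<close>

lemma W_unit: "fsh (kap b) u * t * Wv b 0 = 1"
proof -
  have "fsh (kap b) (u * t) = 1" by (simp add: ut)
  hence e: "fsh (kap b) u * fsh (kap b) t = 1" by (simp add: fsh_mult)
  have "fsh (kap b) u * t * Wv b 0 = (fsh (kap b) u * fsh (kap b) t) * (t * u)"
    by (simp only: Wv_def Gs_0 ac_simps)
  thus ?thesis by (simp add: e tu)
qed

lemma P_W:
  assumes "fderiv D P" "P t" "P u"
  shows "P (Wv c i)"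
proof -
  interpret fderiv D P by fact
  show ?thesis unfolding Wv_def using assms by (intro P_mult fderiv_Gs(1)[OF assms(1)])
qed

lemma fdiff_W: "fdiff (Wv b i)"
  by (rule P_W[OF fds.fderiv_axioms fdiff_t fdiff_u])

end

locale wave = unit_series +
  fixes Wi :: "bool \<Rightarrow> fop"
  assumes Wi_neg: "neg_supp b (Wi b)"
    and W_Wi: "mul 1 (Wv b) (Wi b) = lamb 0"
    and Wi_W: "mul 1 (Wi b) (Wv b) = lamb 0"
    and fdiff_Wi: "fdiff (Wi b i)"
begin

text \<open>The fractional powers L^(n/k) for \<open>True\<close> and L^(n/m) for
  \<open>False\<close>; the sign \<open>sg b\<close> accounts for Lambda^(-n) in the barred
  case.\<close>

definition B :: "bool \<Rightarrow> int \<Rightarrow> fop" where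
  "B b n = mul 1 (mul 1 (Wv b) (lamb (sg b * n))) (Wi b)"

text \<open>Dressed multiplication by s: with n = -k and n = -m these are the first two terms of M -
  Mbar, before the factors 1/k and 1/m.\<close>

definition A :: "bool \<Rightarrow> int \<Rightarrow> fop" where
  "A b n = mul 1 (mul 1 (Wv b) (sm fS (lamb (sg b * n)))) (Wi b)"

text \<open>The theorem says that \<open>Del c a = del c h\<close> for both \<open>c\<close>, where \<open>h = L\<^bsub>p-1\<^esub> \<tau>\<close>.\<close>

definition Del :: "bool \<Rightarrow> fop \<Rightarrow> fop" where
  "Del c Q = sm (- of_int (sg c) * t) (mul 1 (proj c Q) (Wv c))"

definition del :: "bool \<Rightarrow> fser \<Rightarrow> fop" where
  "del c h = (\<lambda>i. Gs c h i - h * u * Gs c t i)"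

lemma bd_W [simp]: "bd b (Wv b)" and bd_Wi [simp]: "bd b (Wi b)"
  by (auto intro: neg_supp_bd neg_W Wi_neg)

lemma bd_B [simp]: "bd b (B b n)" and bd_A [simp]: "bd b (A b n)"
  unfolding B_def A_def by (auto intro!: bd_mul bd_sm)

lemma assoc_W: "bd b Q \<Longrightarrow> bd b Y \<Longrightarrow> mul 1 (mul 1 Q Y) (Wv b) = mul 1 Q (mul 1 Y (Wv b))"
  by (intro mul_assoc_bd[of b] bd_W)

lemma conj_W:
  assumes "bd b Q"
  shows "mul 1 (mul 1 (mul 1 (Wv b) Q) (Wi b)) (Wv b) = mul 1 (Wv b) Q"
proof -
  have "mul 1 (mul 1 (mul 1 (Wv b) Q) (Wi b)) (Wv b) = mul 1 (mul 1 (Wv b) Q) (mul 1 (Wi b) (Wv b))"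
    using assms by (intro assoc_W bd_mul) auto
  thus ?thesis by (simp add: Wi_W)
qed

lemma B_W: "mul 1 (B b n) (Wv b) = mul 1 (Wv b) (lamb (sg b * n))"
  unfolding B_def by (rule conj_W) simp

lemma A_W: "mul 1 (A b n) (Wv b) = mul 1 (Wv b) (sm fS (lamb (sg b * n)))"
  unfolding A_def by (rule conj_W) (simp add: bd_sm)

lemma W_cancel: "bd b Y \<Longrightarrow> bd b Z \<Longrightarrow> mul 1 Y (Wv b) = mul 1 Z (Wv b) \<Longrightarrow> Y = Z"
  by (rule right_cancel[OF neg_W W_unit])

lemma conj_mul:
  assumes "bd b Q" "bd b Y"
  shows "mul 1 (mul 1 (mul 1 (Wv b) Q) (Wi b)) (mul 1 (mul 1 (Wv b) Y) (Wi b)) =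
    mul 1 (mul 1 (Wv b) (mul 1 Q Y)) (Wi b)"
proof (rule W_cancel[of b])
  show "bd b (mul 1 (mul 1 (mul 1 (Wv b) Q) (Wi b)) (mul 1 (mul 1 (Wv b) Y) (Wi b)))"
    "bd b (mul 1 (mul 1 (Wv b) (mul 1 Q Y)) (Wi b))"
    using assms by (auto intro!: bd_mul)
  have "mul 1 (mul 1 (mul 1 (mul 1 (Wv b) Q) (Wi b)) (mul 1 (mul 1 (Wv b) Y) (Wi b))) (Wv b) =
      mul 1 (mul 1 (mul 1 (Wv b) Q) (Wi b)) (mul 1 (Wv b) Y)"
    using assms by (subst assoc_W) (auto intro!: bd_mul simp: conj_W)
  also have "\<dots> = mul 1 (mul 1 (mul 1 (mul 1 (Wv b) Q) (Wi b)) (Wv b)) Y"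
    using assms by (intro mul_assoc_bd[symmetric, of b] bd_mul) auto
  also have "\<dots> = mul 1 (Wv b) (mul 1 Q Y)"
    by (simp only: conj_W[OF assms(1)] mul_assoc_bd[OF bd_W assms])
  also have "\<dots> = mul 1 (mul 1 (mul 1 (Wv b) (mul 1 Q Y)) (Wi b)) (Wv b)"
    using assms by (simp add: conj_W bd_mul)
  finally show "mul 1 (mul 1 (mul 1 (mul 1 (Wv b) Q) (Wi b)) (mul 1 (mul 1 (Wv b) Y) (Wi b))) (Wv b) = \<dots>" .
qed

lemma B_mul: "mul 1 (B b n) (B b n') = B b (n + n')"
  unfolding B_def by (simp add: conj_mul mul_lamb_lamb distrib_left)

lemma B_0 [simp]: "B b 0 = lamb 0"
  by (simp add: B_def W_Wi)

lemma neg_strict: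
  assumes "neg_supp b Y" "\<And>i. sg b * i \<ge> 0 \<Longrightarrow> Q i = 0" "sg b * i \<ge> 0"
  shows "mul h Q Y i = 0"
proof (rule ccontr)
  assume "mul h Q Y i \<noteq> 0"
  then obtain l where l: "Q l \<noteq> 0" "Y (i - l) \<noteq> 0" by (rule mul_nonzeroE)
  hence "sg b * l < 0" "sg b * (i - l) \<le> 0"
    using assms(2)[of l] neg_suppD[OF assms(1), of "i - l"] by fastforce+
  with assms(3) show False by (simp add: right_diff_distrib)
qed

lemma B_neg_strict:
  assumes "n < 0" "sg b * i \<ge> 0"
  shows "B b n i = 0"
  unfolding B_def
proof (rule neg_strict[OF Wi_neg _ assms(2)])
  fix i assume "sg b * i \<ge> 0"
  thus "mul 1 (Wv b) (lamb (sg b * n)) i = 0"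
    using assms(1) unfolding mul_lamb_right by (intro neg_suppD[OF neg_W]) (simp add: right_diff_distrib)
qed

lemma mul_S_lamb: "mul 1 Q (sm f (lamb j)) i = Q (i - j) * fsh (i - j) f"
  by (subst mul_superset[of "{i - j}"]) (auto simp: lamb_def sm_def)

lemma A_neg_strict:
  assumes "n < 0" "sg b * i \<ge> 0"
  shows "A b n i = 0"
  unfolding A_def
proof (rule neg_strict[OF Wi_neg _ assms(2)])
  fix i assume "sg b * i \<ge> 0"
  hence "Wv b (i - sg b * n) = 0"
    using assms(1) by (intro neg_suppD[OF neg_W]) (simp add: right_diff_distrib)
  thus "mul 1 (Wv b) (sm fS (lamb (sg b * n))) i = 0" by (simp add: mul_S_lamb)
qed

lemma Del_add: "Del c (Q + Y) = Del c Q + Del c Y"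
  unfolding Del_def proj_add by (subst mul_add_left) (auto intro!: mulok_bd[of c] simp: sm_add)

lemma Del_zero [simp]: "Del c 0 = 0"
  by (simp add: Del_def)

lemma Del_sm: "Del c (sm f Q) = sm f (Del c Q)"
  unfolding Del_def proj_sm
  by (subst mul_sm_left) (auto intro!: mulok_bd[of c] simp: sm_sm mult.commute mult.left_commute)

lemma Del_sum: "Del c (sum f S) = (\<Sum>x\<in>S. Del c (f x))"
  by (induction S rule: infinite_finite_induct)
     (simp_all only: sum.infinite sum.empty sum.insert Del_add Del_zero not_False_eq_True)

lemma Del_proj: "Del c (proj b Q) = (if b = c then Del c Q else 0)"
  by (simp add: Del_def proj_proj)

text \<open>An operator strictly on side \<open>b\<close> is seen only by the wave operator of that
  side, and there the projection disappears.\<close>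

lemma Del_strict:
  assumes "\<And>i. sg b * i \<ge> 0 \<Longrightarrow> Q i = 0"
  shows "Del c Q = (if b = c then sm (- of_int (sg c) * t) (mul 1 Q (Wv c)) else 0)"
  unfolding Del_def using proj_strict[of b Q] assms by (cases b; cases c; auto)

lemma del_zero [simp]: "del c 0 = 0" by (auto simp: del_def)

lemma del_add: "del c (f + g) = del c f + del c g"
  by (auto simp: del_def Gs_add algebra_simps)

lemma del_cst: "del c (fcst a * f) = sm (fcst a) (del c f)"
  by (rule ext) (simp only: del_def sm_def Gs_fcst_mult, simp add: algebra_simps)

lemma del_diff: "del c (f - g) = del c f - del c g"
  by (auto simp: del_def Gs_diff algebra_simps)

lemma del_sum: "del c (sum f S) = (\<Sum>x\<in>S. del c (f x))"
  by (induction S rule: infinite_finite_induct) (auto simp: del_add)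

lemma del_other:
  assumes "\<And>n. 1 \<le> n \<Longrightarrow> v \<noteq> bv c n"
  shows "del c (fvar v * f) = sm (fvar v) (del c f)"
  by (rule ext) (simp only: del_def sm_def Gs_other_mult[OF assms], simp add: algebra_simps)

lemma del_S: "del c (fS * f) i = fS * del c f i + of_int (kap c) * Gs c f i"
  by (simp add: del_def Gs_S_mult algebra_simps)

lemma del_var:
  assumes "1 \<le> n"
  shows "del c (of_nat n * fvar (bv c n) * f) i =
    of_nat n * fvar (bv c n) * del c f i - of_int (sg c) * Gs c f (i + sg c * int n)"
proof -
  have n: "of_nat n * fcst (1 / of_nat n) = 1"
    using assms by (simp add: of_nat_fser flip: fcst_mult)
  have "Gs c (of_nat n * fvar (bv c n) * f) i = of_nat n * (fvar (bv c n) * Gs c f i)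
      - of_int (sg c) * (of_nat n * fcst (1 / of_nat n)) * Gs c f (i + sg c * int n)"
    by (simp only: of_nat_fser Gs_fcst_mult mult.assoc Gs_var_mult[OF assms] right_diff_distrib)
       (simp add: mult_ac)
  thus ?thesis unfolding n by (simp add: del_def algebra_simps)
qed

lemma Gs_W: "Gs c t i = t * Wv c i"
  by (simp add: Wv_def mult.commute[of _ u])

lemma del_W: "del c h i = Gs c h i - h * Wv c i"
  by (simp add: del_def Wv_def mult.commute mult.left_commute)

lemma Gs_D_eq:
  assumes "fderiv D P" "P t" "P u"
  shows "Gs c (D t) i = D t * Wv c i + t * D (Wv c i)"
proof -
  interpret fderiv D P by fact
  have "Gs c (D t) i = D (t * Wv c i)"
    unfolding Gs_W[symmetric] by (rule fderiv_Gs(2)[OF assms(1,2), symmetric])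
  thus ?thesis using assms(2) P_W[OF assms] by (simp add: D_mult)
qed

lemma del_D:
  assumes "fderiv D P" "P t" "P u"
  shows "del c (D t) = sm t (dop D (Wv c))"
  by (auto simp: del_W Gs_D_eq[OF assms] sm_def dop_def)

lemma fdv_true: "fderiv (fdv v) (\<lambda>_. True)" by (rule fdv.fderiv_axioms)

lemmas del_fdv = del_D[OF fdv_true TrueI TrueI] and Gs_fdv_eq = Gs_D_eq[OF fdv_true TrueI TrueI]

text \<open>The mixed terms (derivative of tau times derivative of W) are what the
  \<open>dlog\<close> summands of \<open>A_decomp\<close> will supply.\<close>

lemma del_fdv2:
  "del c (fdv v (fdv w t)) i =
     t * fdv v (fdv w (Wv c i)) + fdv v t * fdv w (Wv c i) + fdv w t * fdv v (Wv c i)"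
proof -
  have "Gs c (fdv v (fdv w t)) i = fdv v (fdv w (t * Wv c i))"
    unfolding Gs_W[symmetric] fderiv_Gs(2)[OF fdv_true TrueI] ..
  thus ?thesis by (simp add: del_W fdv_mult fdv_add algebra_simps)
qed

lemma Del_lamb0: "Del c (lamb 0) = del c (fS * t)"
proof
  fix i
  have "proj c (lamb 0) = (if c then 0 else lamb 0)"
    by (auto simp: proj_def lamb_def)
  thus "Del c (lamb 0) i = del c (fS * t) i"
    unfolding del_S by (auto simp: Del_def del_W Gs_W sm_def sg_def kap_def)
qed

text \<open>By dressing, \<open>B b (- n)\<close> acts on the wave operator as multiplication by
  Lambda^(-n), respectively Lambda^n, on the right. This reproduces the term by which the vertex
  operator moves n t_n; the other vertex operator does not see this variable.\<close>

lemma Del_B_neg: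
  assumes "1 \<le> n"
  shows "Del c (B b (- int n)) = del c (of_nat n * fvar (bv b n) * t)"
    and "Del b (B b (- int n)) i = - of_int (sg b) * Gs b t (i + sg b * int n)"
proof -
  have neg: "- int n < 0" using assms by simp
  have z: "del d t = 0" for d by (auto simp: del_W Gs_W)
  have 1: "Del d (B b (- int n)) = (if b = d then sm (- of_int (sg d) * t) (mul 1 (B b (- int n)) (Wv d)) else 0)" for d
    using B_neg_strict[OF neg] by (rule Del_strict)
  have 2: "Del b (B b (- int n)) i = - of_int (sg b) * Gs b t (i + sg b * int n)" for i
    unfolding 1 by (simp add: B_W sm_def mul_lamb_right Gs_W mult.assoc)
  show "Del b (B b (- int n)) i = - of_int (sg b) * Gs b t (i + sg b * int n)" by (rule 2)
  show "Del c (B b (- int n)) = del c (of_nat n * fvar (bv b n) * t)"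
  proof (cases "b = c")
    case True
    show ?thesis unfolding True[symmetric]
      by (rule ext) (simp add: 2 del_var[OF assms] z)
  next
    case False
    have "del c (fvar (bv b n) * t) = 0"
      by (subst del_other) (use False in \<open>auto simp: bv_neq z\<close>)
    hence "del c (of_nat n * fvar (bv b n) * t) = 0" by (simp only: of_nat_fser mult.assoc del_cst sm_zero)
    moreover have "Del c (B b (- int n)) = 0" unfolding 1 using False by (simp only: if_False)
    ultimately show ?thesis by simp
  qed
qed

end

section \<open>Dressed multiplication by s\<close>

lemma mul_sum_left:
  assumes "\<And>x. x \<in> S \<Longrightarrow> bd b (F x)" "bd b Z"
  shows "mul h (sum F S) Z = (\<Sum>x\<in>S. mul h (F x) Z)"
  using assms(1)
proof (induction S rule: infinite_finite_induct)
  case (insert x S)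
  have "mul h (F x + sum F S) Z = mul h (F x) Z + mul h (sum F S) Z"
    using insert.prems assms(2) by (intro mul_add_left mulok_bd[of b] bd_sum) auto
  thus ?case using insert by (simp only: sum.insert not_False_eq_True insert_iff simp_thms)
qed (simp_all only: sum.infinite sum.empty mul_zero_left not_False_eq_True)

lemma sm_apply: "sm f Q i = f * Q i"
  by (simp add: sm_def)

lemma proj_dop: "D 0 = 0 \<Longrightarrow> proj c (dop D Q) = dop D (proj c Q)"
  by (auto simp: proj_def dop_def)

lemma dop_sm_of_int: "dop (fdv v) (sm (of_int a) Q) = sm (of_int a) (dop (fdv v) Q)"
  by (simp add: dop_def sm_def fdv_mult fdv.D_of_int)

lemma dop_lamb [simp]: "dop (fdv v) (lamb j) = 0"
  by (auto simp: dop_def lamb_def)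

lemma half_double: "2 * (fcst (1/2) * f) = f"
  by (simp add: numeral_fser mult.assoc[symmetric] flip: fcst_mult)

lemma double_cancel: "2 * f = 2 * g \<Longrightarrow> f = (g :: fser)"
  using of_int_fser_cancel[of 2 f g] by simp

text \<open>All four families of Sato equations for t_n and tbar_n at once: the minus sign in front
  of the negative part and the plus sign in front of the nonnegative part are both
  \<open>- sg c\<close>.\<close>

locale flow = wave +
  assumes flow: "1 \<le> n \<Longrightarrow> dop (fdv (bv b n)) (Wv c) = sm (- of_int (sg c)) (mul 1 (proj c (B b (int n))) (Wv c))"
begin

abbreviation dd :: "bool \<Rightarrow> nat \<Rightarrow> fser \<Rightarrow> fser" where "dd b n \<equiv> fdv (bv b n)"

definition C :: "bool \<Rightarrow> nat \<Rightarrow> fop" where "C b n = sm (- of_int (sg b)) (proj b (B b (int n)))"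

lemma bd_C [simp]: "bd b (C b n)" by (simp add: C_def bd_sm)

lemma Del_B_pos: "1 \<le> n \<Longrightarrow> Del c (B b (int n)) = del c (dd b n t)"
  unfolding del_fdv flow Del_def by (simp add: sm_sm mult.commute)

lemma flowC: "1 \<le> n \<Longrightarrow> dop (dd b n) (Wv b) = mul 1 (C b n) (Wv b)"
  unfolding flow C_def by (rule mul_sm_left[symmetric], rule mulok_bd[of b]) auto

text \<open>Differentiate the dressing relation \<open>B_W\<close> along the flow and cancel the
  wave operator on the right.\<close>

lemma zero_curvature:
  assumes "1 \<le> n"
  shows "dop (dd b n) (B b l) = mul 1 (C b n) (B b l) - mul 1 (B b l) (C b n)"
proof (rule W_cancel[of b])
  let ?D = "dop (dd b n)" and ?W = "Wv b" and ?C = "C b n" and ?B = "B b l"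
  show "bd b (?D ?B)" "bd b (mul 1 ?C ?B - mul 1 ?B ?C)"
    by (auto intro!: bd_dop[OF fdv_true] bd_diff bd_mul)
  have "mul 1 (?D ?B) ?W + mul 1 ?B (mul 1 ?C ?W) = ?D (mul 1 ?B ?W)"
    unfolding flowC[OF assms, symmetric]
    by (rule dop_mul[OF fdv_true, symmetric]) (auto intro!: mulok_bd[of b])
  also have "\<dots> = mul 1 (?D ?W) (lamb (sg b * l)) + mul 1 ?W (?D (lamb (sg b * l)))"
    unfolding B_W by (rule dop_mul[OF fdv_true]) (auto intro!: mulok_bd[of b])
  also have "\<dots> = mul 1 ?C (mul 1 ?B ?W)"
    unfolding flowC[OF assms] B_W dop_lamb mul_zero_right add_0_right
    by (rule mul_assoc_bd[of b]) auto
  finally have "mul 1 (?D ?B) ?W = mul 1 ?C (mul 1 ?B ?W) - mul 1 ?B (mul 1 ?C ?W)"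
    by (simp only: eq_diff_eq)
  thus "mul 1 (?D ?B) ?W = mul 1 (mul 1 ?C ?B - mul 1 ?B ?C) ?W"
    by (subst mul_diff_left) (auto intro!: mulok_bd[of b] bd_mul simp: assoc_W)
qed

text \<open>With \<open>B\<^sub>n B\<^sub>n\<^sub>' = B\<^bsub>n+n'\<^esub>\<close> the mixed products of projections cancel.\<close>

lemma pair_expand:
  assumes "1 \<le> n'"
  shows "mul 1 (C b n) (B b (int n')) + mul 1 (C b n') (B b (int n)) =
    sm (- of_int (sg b)) (B b (int (n + n'))) +
    mul 1 (proj False (B b (int n))) (proj False (B b (int n'))) -
    mul 1 (proj True (B b (int n))) (proj True (B b (int n'))) +
    dop (dd b n') (B b (int n))"
proof -
  let ?B = "B b (int n)" and ?B' = "B b (int n')"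
  define M P M' P' where "M = proj True ?B" and "P = proj False ?B" and "M' = proj True ?B'" and "P' = proj False ?B'"
  note defs = M_def P_def M'_def P'_def
  have bdd: "bd b M" "bd b P" "bd b M'" "bd b P'"
    by (auto simp: defs bd_proj)
  have B: "?B = M + P" "?B' = M' + P'"
    using proj_split[of True ?B] proj_split[of True ?B'] by (simp_all add: defs)
  have ok: "mulok Y Z" if "Y \<in> {M, P, M', P', M + P, M' + P'}" "Z \<in> {M, P, M', P', M + P, M' + P'}" for Y Z
    using that bdd by (auto intro!: mulok_bd[of b] bd_add)
  have BB: "B b (int (n + n')) = mul 1 M M' + mul 1 M P' + (mul 1 P M' + mul 1 P P')"
    unfolding of_nat_add B_mul[symmetric] B by (simp add: mul_add_left mul_add_right ok)
  have CC: "C b n = (if b then - M else P)" "C b n' = (if b then - M' else P')"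
    by (auto simp: C_def defs sg_def sm_minus)
  \<comment> \<open>With the second product in the opposite order, the mixed products M P' and P M'
    combine exactly into the full product. Restoring the order by zero curvature costs the
    derivative term of the statement.\<close>
  have "mul 1 (C b n) ?B' + mul 1 ?B (C b n') =
      sm (- of_int (sg b)) (B b (int (n + n'))) + mul 1 P P' - mul 1 M M'"
    unfolding BB CC unfolding B
    by (cases b) (simp_all add: sg_def mul_add_left mul_add_right mul_minus_left mul_minus_right ok sm_minus)
  thus ?thesis
    unfolding zero_curvature[OF assms] defs by (simp add: algebra_simps)
qed

text \<open>After projection one square, M M' or P P', survives together with the derivative of the
  projected power. These are the two terms obtained by differentiating the Sato equation twice,
  which is how second derivatives enter.\<close>

lemma Del_pair:
  assumes n: "1 \<le> n" "1 \<le> n'"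
  shows "Del c (mul 1 (C b n) (B b (int n')) + mul 1 (C b n') (B b (int n))) =
    sm t (sm (- of_int (sg b)) (dop (dd b (n + n')) (Wv c)) + dop (dd b n') (dop (dd b n) (Wv c)))"
proof -
  let ?B = "B b (int n)" and ?B' = "B b (int n')" and ?W = "Wv c"
  let ?Z = "proj c ?B" and ?Z' = "proj c ?B'" and ?s = "- of_int (sg c) :: fser"
  let ?Y = "mul 1 (C b n) (B b (int n')) + mul 1 (C b n') (B b (int n))"
  have pp: "proj c (mul 1 (proj d Q) (proj d Z)) = (if c = d then mul 1 (proj c Q) (proj c Z) else 0)" for d Q Z
  proof -
    have "proj c (proj d (mul 1 (proj d Q) (proj d Z))) = (if c = d then mul 1 (proj c Q) (proj c Z) else 0)"
      unfolding proj_proj using proj_mul_proj[of c 1 Q Z] by auto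
    thus ?thesis by (simp only: proj_mul_proj)
  qed
  have 1: "proj c ?Y = sm (- of_int (sg b)) (proj c (B b (int (n + n')))) + sm ?s (mul 1 ?Z ?Z') + dop (dd b n') ?Z"
    unfolding pair_expand[OF n(2)] proj_add proj_diff proj_sm pp
    by (cases c) (auto simp: sg_def sm_minus proj_dop)
  have "mul 1 (proj c ?Y) ?W = sm (- of_int (sg b)) (mul 1 (proj c (B b (int (n + n')))) ?W)
      + sm ?s (mul 1 ?Z (mul 1 ?Z' ?W)) + mul 1 (dop (dd b n') ?Z) ?W"
    unfolding 1
    by (subst mul_add_left mul_sm_left assoc_W |
        (intro mulok_bd[of c] bd_add bd_sm bd_mul bd_dop[OF fdv_true] bd_proj_same bd_W))+ simp
  hence 2: "sm ?s (mul 1 (proj c ?Y) ?W) = sm (- of_int (sg b)) (dop (dd b (n + n')) ?W)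
      + sm ?s (mul 1 (dop (dd b n') ?Z) ?W + mul 1 ?Z (sm ?s (mul 1 ?Z' ?W)))"
    using n by (subst mul_sm_right) (auto intro!: mulok_bd[of c] bd_mul simp: flow sm_add sm_sm fsh_minus mult.commute)
  have 3: "dop (dd b n') (dop (dd b n) ?W) = sm ?s (mul 1 (dop (dd b n') ?Z) ?W + mul 1 ?Z (sm ?s (mul 1 ?Z' ?W)))"
  proof -
    have "dop (dd b n') (dop (dd b n) ?W) = sm ?s (dop (dd b n') (mul 1 ?Z ?W))"
      unfolding flow[OF n(1)] using dop_sm_of_int[of _ "- sg c"] by simp
    also have "dop (dd b n') (mul 1 ?Z ?W) = mul 1 (dop (dd b n') ?Z) ?W + mul 1 ?Z (dop (dd b n') ?W)"
      by (rule dop_mul[OF fdv_true]) (auto intro!: mulok_bd[of c])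
    finally show ?thesis unfolding flow[OF n(2)] .
  qed
  show ?thesis
    unfolding 3 2[symmetric] Del_def by (simp add: sm_sm mult.commute)
qed

definition dlog :: "bool \<Rightarrow> nat \<Rightarrow> fser" where "dlog b n = dd b n t * u"

text \<open>The tail \<open>n > j\<close> of Euler's sum for \<open>[W, s] \<Lambda>\<^sup>j\<close>, written as the whole sum minus its first \<open>j\<close> terms.\<close>

definition Rem :: "bool \<Rightarrow> nat \<Rightarrow> fop" where
  "Rem b j = (\<lambda>i. u * (of_int (i - sg b * int j) * Gs b t (i - sg b * int j)
     - (\<Sum>n=1..j. Gs b (dd b n t) (i - sg b * int j + sg b * int n))))"

text \<open>At these powers the first j terms already exhaust Euler's sum.\<close>

lemma Rem_strict:
  assumes "sg b * i \<ge> 0"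
  shows "Rem b j i = 0"
proof -
  have "- (sg b * (i - sg b * int j)) \<le> int j" using assms by (simp add: right_diff_distrib)
  thus ?thesis unfolding Rem_def by (subst Gs_euler) auto
qed

lemma bd_Rem [simp]: "bd b (Rem b j)"
  unfolding bd_def by (intro exI[of _ 0]) (simp add: Rem_strict)

lemma Rem_eq:
  assumes "- (sg b * i) \<le> int N"
  shows "t * Rem b j i = (\<Sum>n=1..N. Gs b (dd b (n + j) t) (i + sg b * int n))"
proof -
  let ?g = "\<lambda>n. Gs b (dd b n t) (i - sg b * int j + sg b * int n)"
  have "- (sg b * (i - sg b * int j)) \<le> int (N + j)" using assms by (simp add: right_diff_distrib)
  hence "t * Rem b j i = (\<Sum>n=1..N+j. ?g n) - (\<Sum>n=1..j. ?g n)"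
    unfolding Rem_def by (subst Gs_euler[of _ _ "N + j"]) auto
  also have "(\<Sum>n=1..N+j. ?g n) = (\<Sum>n=1..j. ?g n) + (\<Sum>n=j+1..j+N. ?g n)"
    by (subst add.commute, rule sum.ub_add_nat) simp
  also have "(\<Sum>n=j+1..j+N. ?g n) = (\<Sum>n=1..N. ?g (n + j))"
    by (rule sum.reindex_bij_witness[of _ "\<lambda>n. n + j" "\<lambda>n. n - j"]) auto
  finally show ?thesis by (simp add: algebra_simps)
qed

text \<open>Multiply by W on the right. The coefficient of W s Lambda^j at i is W_i' (s + i') with
  i' = \<open>i - sg b * j\<close>, and i' W_i' is Euler's sum divided by tau. Since G(z) applied to
  the n-th derivative of tau is that derivative of tau W, its quotient by tau is
  (\<open>dlog b n\<close> + d_n) W, where the flow replaces d_n W by \<open>C b n\<close> times W.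
  Terms up to j become products with powers of L; the tail is \<open>Rem\<close>.\<close>

lemma A_decomp:
  "A b (int j) = sm fS (B b (int j))
     + (\<Sum>n=1..j. sm (dlog b n) (B b (int (j - n))) + mul 1 (C b n) (B b (int (j - n))))
     + mul 1 (Rem b j) (Wi b)" (is "_ = ?S + ?sum + ?R")
proof (rule W_cancel[of b])
  have bds: "bd b (sm (dlog b n) (B b (int (j - n))) + mul 1 (C b n) (B b (int (j - n))))" for n
    by (auto intro!: bd_add bd_sm bd_mul)
  have bd3: "bd b ?S" "bd b ?sum" "bd b ?R"
    by (intro bd_sm bd_B, intro bd_sum bds, intro bd_mul bd_Rem bd_Wi)
  thus "bd b (A b (int j))" "bd b (?S + ?sum + ?R)" by (auto intro!: bd_add)
  show "mul 1 (A b (int j)) (Wv b) = mul 1 (?S + ?sum + ?R) (Wv b)"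
  proof
    fix i
    let ?i = "i - sg b * int j"
    have 1: "mul 1 ?S (Wv b) i = fS * Wv b ?i"
      by (subst mul_sm_left) (auto intro!: mulok_bd[of b] simp: B_W sm_def mul_lamb_right)
    have "mul 1 ?R (Wv b) = mul 1 (Rem b j) (mul 1 (Wi b) (Wv b))"
      by (rule assoc_W) auto
    hence 3: "mul 1 ?R (Wv b) i = Rem b j i" by (simp add: Wi_W)
    have 2: "mul 1 (sm (dlog b n) (B b (int (j - n))) + mul 1 (C b n) (B b (int (j - n)))) (Wv b) i
        = u * Gs b (dd b n t) (?i + sg b * int n)" if n: "n \<in> {1..j}" for n
    proof -
      let ?l = "sg b * int (j - n)"
      have il: "i - ?l = ?i + sg b * int n" using n by (simp add: of_nat_diff right_diff_distrib)
      have "mul 1 (mul 1 (C b n) (B b (int (j - n)))) (Wv b) = mul 1 (C b n) (mul 1 (Wv b) (lamb ?l))"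
        by (subst assoc_W) (auto simp: B_W)
      also have "\<dots> = mul 1 (mul 1 (C b n) (Wv b)) (lamb ?l)"
        by (rule mul_assoc_bd[of b, symmetric]) auto
      also have "mul 1 (C b n) (Wv b) = dop (dd b n) (Wv b)"
        using n by (simp add: flowC)
      finally have C: "mul 1 (mul 1 (C b n) (B b (int (j - n)))) (Wv b) i = dd b n (Wv b (i - ?l))"
        by (simp add: mul_lamb_right dop_def)
      have "mul 1 (sm (dlog b n) (B b (int (j - n))) + mul 1 (C b n) (B b (int (j - n)))) (Wv b) i
          = dlog b n * Wv b (i - ?l) + dd b n (Wv b (i - ?l))"
      proof -
        have "mul 1 (sm (dlog b n) (B b (int (j - n)))) (Wv b) i = dlog b n * Wv b (i - ?l)"
          by (subst mul_sm_left) (auto intro!: mulok_bd[of b] simp: B_W sm_apply mul_lamb_right)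
        thus ?thesis
          by (subst mul_add_left) (auto intro!: mulok_bd[of b] bd_sm bd_mul simp: C)
      qed
      also have "\<dots> = u * Gs b (dd b n t) (i - ?l)"
        unfolding Gs_fdv_eq dlog_def by (simp add: distrib_left mult_ac)
      finally show ?thesis unfolding il .
    qed
    have "mul 1 (?S + ?sum + ?R) (Wv b) = mul 1 ?S (Wv b) + mul 1 ?sum (Wv b) + mul 1 ?R (Wv b)"
      using mul_add_left[of "?S + ?sum" "Wv b" ?R 1] mul_add_left[of ?S "Wv b" ?sum 1]
        mulok_bd[OF bd_add[OF bd3(1,2)] bd_W] bd3[THEN mulok_bd, OF bd_W] by (simp only:)
    also have "mul 1 ?sum (Wv b) = (\<Sum>n=1..j. mul 1 (sm (dlog b n) (B b (int (j - n))) + mul 1 (C b n) (B b (int (j - n)))) (Wv b))"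
      by (rule mul_sum_left[of _ b], rule bds, rule bd_W)
    finally have E: "mul 1 (?S + ?sum + ?R) (Wv b) = mul 1 ?S (Wv b) +
      (\<Sum>n=1..j. mul 1 (sm (dlog b n) (B b (int (j - n))) + mul 1 (C b n) (B b (int (j - n)))) (Wv b)) + mul 1 ?R (Wv b)" .
    have "(\<Sum>n=1..j. mul 1 (sm (dlog b n) (B b (int (j - n))) + mul 1 (C b n) (B b (int (j - n)))) (Wv b) i)
       = (\<Sum>n=1..j. u * Gs b (dd b n t) (?i + sg b * int n))"
      by (rule sum.cong[OF refl 2])
    hence "mul 1 (?S + ?sum + ?R) (Wv b) i = fS * Wv b ?i + (\<Sum>n=1..j. u * Gs b (dd b n t) (?i + sg b * int n)) + Rem b j i"
      unfolding E plus_fun_apply sum_op_apply 1 3 by (simp only:)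
    also have "\<dots> = fS * Wv b ?i + u * (of_int ?i * Gs b t ?i)"
      by (simp add: Rem_def sum_distrib_left right_diff_distrib)
    also have "\<dots> = mul 1 (A b (int j)) (Wv b) i"
      unfolding A_W mul_S_lamb fsh_S by (simp add: Wv_def distrib_left mult_ac)
    finally show "mul 1 (A b (int j)) (Wv b) i = mul 1 (?S + ?sum + ?R) (Wv b) i" by simp
  qed
qed

lemma Del_Rem: "Del c (mul 1 (Rem b j) (Wi b)) i = (if b = c then - of_int (sg b) * (t * Rem b j i) else 0)"
proof -
  have "Del c (mul 1 (Rem b j) (Wi b)) =
      (if b = c then sm (- of_int (sg c) * t) (mul 1 (mul 1 (Rem b j) (Wi b)) (Wv c)) else 0)"
    by (rule Del_strict, rule neg_strict[OF Wi_neg Rem_strict])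
  moreover have "mul 1 (mul 1 (Rem b j) (Wi b)) (Wv b) = Rem b j"
    by (subst assoc_W) (auto simp: Wi_W)
  ultimately show ?thesis by (auto simp: sm_def mult.assoc)
qed

lemma Del_A_0:
  "Del c (A b 0) i = del c (fcst (1/2) * (fS * (fS * t)) - fcst (1/2) * (fS * t)) i
     + (if b = c then - of_int (sg b) * (t * Rem b 0 i) else 0)"
proof -
  have "Del c (A b (int 0)) i = fS * Del c (lamb 0) i + Del c (mul 1 (Rem b 0) (Wi b)) i"
    unfolding A_decomp Del_add Del_sm by (simp add: sm_def)
  \<comment> \<open>On the barred side (s+1)^2 - s^2 = 2s + 1, so half of s^2 tau overshoots by 1/2;
    the term - s tau / 2 corrects this.\<close>
  also have "fS * Del c (lamb 0) i = del c (fcst (1/2) * (fS * (fS * t)) - fcst (1/2) * (fS * t)) i"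
  proof (rule double_cancel)
    have z: "del d t = 0" for d by (auto simp: del_W Gs_W)
    have kap: "of_int (kap c) * (of_int (kap c) * f) = of_int (kap c) * f" for f :: fser
      by (simp add: kap_def)
    have "2 * (fS * Del c (lamb 0) i) = del c (fS * (fS * t)) i - del c (fS * t) i"
      by (simp add: Del_lamb0 del_S Gs_S_mult z algebra_simps kap)
    thus "2 * (fS * Del c (lamb 0) i) = 2 * del c (fcst (1/2) * (fS * (fS * t)) - fcst (1/2) * (fS * t)) i"
      by (simp add: del_diff del_cst sm_def right_diff_distrib half_double)
  qed
  finally show ?thesis by (simp add: Del_Rem)
qed

text \<open>The last coefficient is \<open>sg b * (j - 1) / 2 + (sg b + 1) / 2\<close>: the first
  part comes from the j - 1 symmetrised pairs, the second balances the summand \<open>C b j\<close>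
  (n = j in \<open>A_decomp\<close>) against the shift of s in Gbar.\<close>

definition quad :: "bool \<Rightarrow> nat \<Rightarrow> fser" where
  "quad b j = fS * dd b j t + fcst (1/2) * (\<Sum>n=1..j-1. dd b n (dd b (j - n) t))
     - fcst (of_int (sg b * int j + 1) / 2) * dd b j t"

lemma Del_A_pos:
  assumes "1 \<le> j"
  shows "Del c (A b (int j)) i = del c (quad b j) i + (if b = c then - of_int (sg b) * (t * Rem b j i) else 0)"
proof -
  define l where "l = j - 1"
  have j: "j = Suc l" using assms by (simp add: l_def)
  let ?W = "\<lambda>n. dd b n (Wv c i)"
  let ?f = "\<lambda>n. Del c (mul 1 (C b n) (B b (int (j - n)))) i"
  have B: "Del c (B b (int n)) i = t * ?W n" if "1 \<le> n" for n
    unfolding Del_B_pos[OF that] del_fdv by (simp add: sm_def dop_def)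
  have vt: "dlog b n * (t * f) = dd b n t * f" for n f
    by (simp add: dlog_def mult.assoc)
  have L: "Del c (A b (int j)) i = fS * (t * ?W j) + ((\<Sum>n=1..l. dd b n t * ?W (j - n)) + (\<Sum>n=1..l. ?f n))
     + (of_int (kap c) * (dd b j t * Wv c i) + Del c (C b j) i) + Del c (mul 1 (Rem b j) (Wi b)) i"
  proof -
    have 1: "(\<Sum>n=1..l. Del c (sm (dlog b n) (B b (int (j - n))) + mul 1 (C b n) (B b (int (j - n)))) i)
      = (\<Sum>n=1..l. dd b n t * ?W (j - n)) + (\<Sum>n=1..l. ?f n)"
      unfolding sum.distrib[symmetric]
    proof (intro sum.cong refl)
      fix n assume "n \<in> {1..l}"
      hence "1 \<le> j - n" by (auto simp: j)
      thus "Del c (sm (dlog b n) (B b (int (j - n))) + mul 1 (C b n) (B b (int (j - n)))) i =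
          dd b n t * ?W (j - n) + ?f n"
        by (simp only: Del_add Del_sm plus_fun_apply) (simp only: sm_def B vt)
    qed
    \<comment> \<open>At n = j the power of L is the identity, which corresponds to s tau and not to
      a flow; hence \<open>kap\<close> instead of a derivative of W.\<close>
    have 2: "Del c (sm (dlog b j) (B b (int (j - j))) + mul 1 (C b j) (B b (int (j - j)))) i =
       of_int (kap c) * (dd b j t * Wv c i) + Del c (C b j) i"
    proof -
      have z: "del c t = 0" by (auto simp: del_W Gs_W)
      have "Del c (sm (dlog b j) (B b (int (j - j))) + mul 1 (C b j) (B b (int (j - j)))) i =
          dlog b j * (of_int (kap c) * (t * Wv c i)) + Del c (C b j) i"
        by (simp add: Del_add Del_sm sm_apply Del_lamb0 del_S z Gs_W)
      thus ?thesis by (simp only: mult.left_commute[of "dlog b j"] vt)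
    qed
    have s: "(\<Sum>n=1..j. g n) = (\<Sum>n=1..l. g n) + g j" for g :: "nat \<Rightarrow> fser"
      by (simp add: j)
    have "Del c (A b (int j)) i = fS * Del c (B b (int j)) i
      + (\<Sum>n=1..j. Del c (sm (dlog b n) (B b (int (j - n))) + mul 1 (C b n) (B b (int (j - n)))) i)
      + Del c (mul 1 (Rem b j) (Wi b)) i"
      by (simp only: A_decomp Del_add[of _ "_ + _"] Del_add[of _ _ "sum _ _"] Del_sum Del_sm plus_fun_apply sum_op_apply)
         (simp add: sm_def)
    thus ?thesis unfolding s 1 2 B[OF assms] by (simp only: add.assoc)
  qed
  have rev: "(\<Sum>n=1..l. g n) = (\<Sum>n=1..l. g (j - n))" for g :: "nat \<Rightarrow> fser"
    by (rule sum.reindex_bij_witness[of _ "\<lambda>n. j - n" "\<lambda>n. j - n"]) (auto simp: j)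
  \<comment> \<open>Doubling the sum pairs n with j - n, so that \<open>Del_pair\<close> applies;
    each pair also leaves one first-order term in the j-th flow.\<close>
  have F: "2 * (\<Sum>n=1..l. ?f n) = - (of_nat l * (of_int (sg b) * (t * ?W j))) + t * (\<Sum>n=1..l. dd b n (?W (j - n)))"
  proof -
    have "2 * (\<Sum>n=1..l. ?f n) = (\<Sum>n=1..l. ?f (j - n)) + (\<Sum>n=1..l. ?f n)"
      using rev[of ?f] by simp
    also have "\<dots> = (\<Sum>n=1..l. ?f (j - n) + ?f n)"
      by (rule sum.distrib[symmetric])
    also have "\<dots> = (\<Sum>n=1..l. - (of_int (sg b) * (t * ?W j)) + t * dd b n (?W (j - n)))"
    proof (intro sum.cong refl)
      fix n assume n: "n \<in> {1..l}"
      have jn: "j - (j - n) = n" "j - n + n = j" using n j by auto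
      have "?f (j - n) + ?f n = Del c (mul 1 (C b (j - n)) (B b (int n)) + mul 1 (C b n) (B b (int (j - n)))) i"
        by (simp add: Del_add jn)
      also have "\<dots> = sm t (sm (- of_int (sg b)) (dop (dd b j) (Wv c)) + dop (dd b n) (dop (dd b (j - n)) (Wv c))) i"
        using n j by (subst Del_pair) (auto simp: jn)
      finally show "?f (j - n) + ?f n = - (of_int (sg b) * (t * ?W j)) + t * dd b n (?W (j - n))"
        by (simp add: sm_def dop_def algebra_simps)
    qed
    also have "\<dots> = - (of_nat l * (of_int (sg b) * (t * ?W j))) + t * (\<Sum>n=1..l. dd b n (?W (j - n)))"
      unfolding sum.distrib sum_distrib_left sum_constant by simp
    finally show ?thesis .
  qed
  have Cj: "Del c (C b j) i = (if b = c then - of_int (sg b) * (t * ?W j) else 0)"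
    unfolding C_def Del_sm Del_proj using B[OF assms] by (auto simp: sm_def)
  have Q: "2 * del c (quad b j) i = 2 * (fS * (t * ?W j) + of_int (kap c) * (dd b j t * Wv c i + t * ?W j))
     + (t * (\<Sum>n=1..l. dd b n (?W (j - n))) + 2 * (\<Sum>n=1..l. dd b n t * ?W (j - n)))
     - of_int (sg b * int j + 1) * (t * ?W j)"
  proof -
    have a: "del c (fS * dd b j t) i = fS * (t * ?W j) + of_int (kap c) * (dd b j t * Wv c i + t * ?W j)"
      by (simp add: del_S del_fdv Gs_fdv_eq sm_def dop_def)
    have h: "2 * (fcst (of_int x / 2) * f) = of_int x * f" for x and f :: fser
      by (simp add: numeral_fser of_int_fser mult.assoc[symmetric] flip: fcst_mult)
    have "(\<Sum>n=1..l. dd b (j - n) t * ?W n) = (\<Sum>n=1..l. dd b n t * ?W (j - n))"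
      by (subst rev) (intro sum.cong refl, auto simp: j)
    hence s: "(\<Sum>n=1..l. del c (dd b n (dd b (j - n) t)) i) =
       t * (\<Sum>n=1..l. dd b n (?W (j - n))) + 2 * (\<Sum>n=1..l. dd b n t * ?W (j - n))"
      unfolding del_fdv2 sum.distrib sum_distrib_left[symmetric] by (simp only: mult_2 add.assoc)
    have "2 * del c (quad b j) i = 2 * del c (fS * dd b j t) i + 2 * (fcst (1/2) * (\<Sum>n=1..l. del c (dd b n (dd b (j - n) t)) i))
      - 2 * (fcst (of_int (sg b * int j + 1) / 2) * del c (dd b j t) i)"
      unfolding quad_def del_add del_diff del_cst del_sum l_def
      by (simp add: sm_def distrib_left right_diff_distrib sum_op_apply)
    thus ?thesis unfolding a half_double h s del_fdv by (simp add: sm_def dop_def)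
  qed
  show ?thesis
  proof (rule double_cancel)
    show "2 * Del c (A b (int j)) i =
      2 * (del c (quad b j) i + (if b = c then - of_int (sg b) * (t * Rem b j i) else 0))"
      unfolding distrib_left Q unfolding L distrib_left F Cj Del_Rem
      by (cases b; cases c; simp add: sg_def kap_def j algebra_simps)
  qed
qed

end

section \<open>The Virasoro currents\<close>

context flow
begin

definition tm :: "bool \<Rightarrow> nat \<Rightarrow> fser" where "tm b n = of_nat n * fvar (bv b n)"

lemma del_t: "del c t = 0" by (auto simp: del_W Gs_W)

lemma Gs_tm:
  assumes "1 \<le> n"
  shows "Gs b (tm b n * h) i = tm b n * Gs b h i - of_int (sg b) * Gs b h (i + sg b * int n)"
  using del_var[OF assms, of b h i] by (simp add: tm_def del_def algebra_simps)

lemma del_tm: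
  assumes "1 \<le> n"
  shows "del c (tm b n * h) i = tm b n * del c h i
    - (if b = c then of_int (sg b) * Gs b h (i + sg b * int n) else 0)"
proof (cases "b = c")
  case True
  thus ?thesis using del_var[OF assms, of b h i] by (simp add: tm_def)
next
  case False
  have "del c (fvar (bv b n) * h) = sm (fvar (bv b n)) (del c h)"
    by (rule del_other) (use False in \<open>simp add: bv_neq\<close>)
  thus ?thesis using False by (simp add: tm_def of_nat_fser mult.assoc del_cst sm_apply)
qed

text \<open>Each factor n t_n leaves a correction under \<open>del\<close>. For N beyond the order
  of the coefficient, \<open>Rem_eq\<close> sums these corrections to the remainder left over by
  \<open>A b j\<close>, and the two cancel.\<close>

lemma current_sum_nonneg:
  assumes A: "Del c (A b (int j)) i = del c h i + (if b = c then - of_int (sg b) * (t * Rem b j i) else 0)"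
    and N: "- (sg c * i) \<le> int N"
  shows "Del c (A b (int j) + (\<Sum>n=1..N. sm (tm b n) (B b (int (n + j))))) i =
    del c (h + (\<Sum>n=1..N. tm b n * dd b (n + j) t)) i"
proof -
  let ?G = "\<lambda>n. Gs b (dd b (n + j) t) (i + sg b * int n)"
  have "Del c (A b (int j) + (\<Sum>n=1..N. sm (tm b n) (B b (int (n + j))))) i =
      Del c (A b (int j)) i + (\<Sum>n=1..N. Del c (sm (tm b n) (B b (int (n + j)))) i)"
    unfolding Del_add Del_sum plus_fun_apply sum_op_apply ..
  also have "(\<Sum>n=1..N. Del c (sm (tm b n) (B b (int (n + j)))) i) =
      (\<Sum>n=1..N. del c (tm b n * dd b (n + j) t) i + (if b = c then of_int (sg b) * ?G n else 0))"
  proof (rule sum.cong[OF refl])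
    fix n assume "n \<in> {1..N}"
    hence n: "1 \<le> n" "1 \<le> n + j" by auto
    show "Del c (sm (tm b n) (B b (int (n + j)))) i =
        del c (tm b n * dd b (n + j) t) i + (if b = c then of_int (sg b) * ?G n else 0)"
      unfolding Del_sm Del_B_pos[OF n(2)] del_tm[OF n(1)] sm_apply by (cases "b = c") simp_all
  qed
  also have "\<dots> = (\<Sum>n=1..N. del c (tm b n * dd b (n + j) t) i) + (if b = c then of_int (sg b) * (\<Sum>n=1..N. ?G n) else 0)"
    unfolding sum.distrib by (simp add: sum_distrib_left)
  also have "(if b = c then of_int (sg b) * (\<Sum>n=1..N. ?G n) else 0) = (if b = c then of_int (sg b) * (t * Rem b j i) else 0)"
    using Rem_eq[of b i N j] N by auto
  finally show ?thesis
    unfolding del_add del_sum plus_fun_apply sum_op_apply A by (cases "b = c") simp_all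
qed

definition quad0 :: fser where "quad0 = fcst (1/2) * (fS * (fS * t)) - fcst (1/2) * (fS * t)"

lemmas current_sum_0 = current_sum_nonneg[of _ _ 0 _ quad0, simplified of_nat_0, OF Del_A_0[folded quad0_def]]
lemmas current_sum_pos = current_sum_nonneg[OF Del_A_pos]

text \<open>In each of the j - 1 products both variables are moved by the same vertex operator,
  which leaves an extra term. The last coefficient,
  \<open>sg b * (j - 1) / 2 + (sg b - 1) / 2\<close>, compensates these terms and the shift of s.
  Divided by j it gives (k-1)/2 for t_k and -(m+1)/2 for tbar_m, as in L_(-1).\<close>

definition quadneg :: "bool \<Rightarrow> nat \<Rightarrow> fser" where
  "quadneg b j = tm b j * (fS * t) + fcst (1/2) * (\<Sum>n=1..j-1. tm b n * (tm b (j - n) * t))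
     + fcst ((of_int (sg b * int j) - 1) / 2) * (tm b j * t)"

lemma Del_A_neg:
  assumes "1 \<le> j"
  shows "Del c (A b (- int j)) i =
    (if b = c then - of_int (sg b) * ((fS + of_int (i + sg b * int j)) * Gs b t (i + sg b * int j)) else 0)"
proof -
  have neg: "- int j < 0" using assms by simp
  have "Del c (A b (- int j)) = (if b = c then sm (- of_int (sg c) * t) (mul 1 (A b (- int j)) (Wv c)) else 0)"
    by (rule Del_strict) (rule A_neg_strict[OF neg])
  thus ?thesis
    by (auto simp: sm_apply A_W mul_S_lamb fsh_S Gs_W mult_ac)
qed

text \<open>Three ranges: for n < j the powers of L are negative and give products of two variables,
  n = j gives the identity and hence s, and n > j gives flows. The corrections from n > j cancel the
  integer added to s in \<open>Del_A_neg\<close>.\<close>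

lemma current_sum_neg:
  assumes j: "1 \<le> j" "j \<le> N" and N: "- (sg c * i) \<le> int N"
  shows "Del c (A b (- int j) + (\<Sum>n=1..N. sm (tm b n) (B b (int n - int j)))) i =
    del c (quadneg b j + (\<Sum>n=j+1..N. tm b n * dd b (n - j) t)) i"
proof -
  let ?d = "\<lambda>f. if b = c then of_int (sg b) * f else (0 :: fser)"
  let ?i = "i + sg b * int j"
  let ?g = "\<lambda>n. Del c (sm (tm b n) (B b (int n - int j))) i"
  let ?G = "\<lambda>n. Gs b t (i + sg b * int n)" and ?E = "\<lambda>n. Gs b (dd b (n - j) t) (i + sg b * int n)"
  have split: "(\<Sum>n=1..N. f n) = (\<Sum>n=1..j-1. f n) + f j + (\<Sum>n=j+1..N. f n)" for f :: "nat \<Rightarrow> fser"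
  proof -
    have "{1..N} = {1..j-1} \<union> ({j} \<union> {j+1..N})" using j by auto
    thus ?thesis by (simp only:) (subst sum.union_disjoint; auto simp: add.assoc)+
  qed
  have lo: "?g n = tm b n * (- ?d (?G (j - n)))" if "n \<in> {1..j-1}" for n
  proof -
    have n: "1 \<le> j - n" "int n - int j = - int (j - n)" using that by auto
    show ?thesis
      unfolding n(2) Del_sm Del_B_neg(1)[OF n(1)] tm_def[symmetric] sm_apply del_tm[OF n(1)] del_t by simp
  qed
  have mid: "?g j = tm b j * del c (fS * t) i"
    by (simp add: Del_sm sm_apply Del_lamb0)
  have hi: "?g n = del c (tm b n * dd b (n - j) t) i + ?d (?E n)" if "n \<in> {j+1..N}" for n
  proof -
    have n: "1 \<le> n - j" "1 \<le> n" "int n - int j = int (n - j)" using that by auto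
    show ?thesis
      unfolding n(3) Del_sm Del_B_pos[OF n(1)] sm_apply del_tm[OF n(2)] by (cases "b = c") simp_all
  qed
  \<comment> \<open>Reindexed by n - j this is Euler's sum for tau itself. The cutoff N - j suffices
    because the coefficient in question has order smaller by j.\<close>
  have E: "?d (\<Sum>n=j+1..N. ?E n) = ?d (of_int ?i * Gs b t ?i)"
  proof (cases "b = c")
    case True
    hence N': "- (sg b * ?i) \<le> int (N - j)" using N j(2) by (simp add: distrib_left of_nat_diff)
    have "(\<Sum>n=j+1..N. ?E n) = (\<Sum>n=1..N-j. Gs b (dd b n t) (?i + sg b * int n))"
      by (rule sum.reindex_bij_witness[of _ "\<lambda>n. n + j" "\<lambda>n. n - j"]) (auto simp: of_nat_diff algebra_simps)
    thus ?thesis by (simp only: Gs_euler[OF N'])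
  qed simp
  let ?L = "\<Sum>n=1..j-1. tm b n * (- ?d (?G (j - n)))"
  have L: "Del c (A b (- int j) + (\<Sum>n=1..N. sm (tm b n) (B b (int n - int j)))) i =
     - ?d ((fS + of_int ?i) * Gs b t ?i) + (?L + tm b j * del c (fS * t) i
      + ((\<Sum>n=j+1..N. del c (tm b n * dd b (n - j) t) i) + ?d (of_int ?i * Gs b t ?i)))"
  proof -
    have "(\<Sum>n=j+1..N. ?g n) = (\<Sum>n=j+1..N. del c (tm b n * dd b (n - j) t) i) + (\<Sum>n=j+1..N. ?d (?E n))"
      unfolding sum.distrib[symmetric] by (rule sum.cong[OF refl hi])
    also have "(\<Sum>n=j+1..N. ?d (?E n)) = ?d (\<Sum>n=j+1..N. ?E n)" by (simp add: sum_distrib_left)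
    finally have H: "(\<Sum>n=j+1..N. ?g n) = (\<Sum>n=j+1..N. del c (tm b n * dd b (n - j) t) i) + ?d (of_int ?i * Gs b t ?i)"
      unfolding E .
    have "(\<Sum>n=1..j-1. ?g n) = ?L" by (rule sum.cong[OF refl lo])
    thus ?thesis
      unfolding Del_add Del_sum plus_fun_apply sum_op_apply split[of ?g] H mid Del_A_neg[OF j(1)]
      by (cases "b = c") simp_all
  qed
  have quadsum: "(\<Sum>n=1..j-1. del c (tm b n * (tm b (j - n) * t)) i) = 2 * ?L + (if b = c then of_nat (j - 1) * Gs b t ?i else 0)"
  proof -
    have qt: "del c (tm b n * (tm b (j - n) * t)) i = tm b n * (- ?d (?G (j - n))) + tm b (j - n) * (- ?d (?G n))
        + (if b = c then Gs b t ?i else 0)" if "n \<in> {1..j-1}" for n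
    proof -
      have n: "1 \<le> n" "1 \<le> j - n" "i + sg b * int n + sg b * int (j - n) = ?i"
        using that by (auto simp: of_nat_diff algebra_simps)
      show ?thesis
        unfolding del_tm[OF n(1)] del_tm[OF n(2)] Gs_tm[OF n(2)] n(3) del_t
        by (cases "b = c") (simp_all add: algebra_simps)
    qed
    have "(\<Sum>n=1..j-1. del c (tm b n * (tm b (j - n) * t)) i) =
      (\<Sum>n=1..j-1. tm b n * (- ?d (?G (j - n))) + tm b (j - n) * (- ?d (?G n)) + (if b = c then Gs b t ?i else 0))"
      by (rule sum.cong[OF refl qt])
    also have "\<dots> = ?L + (\<Sum>n=1..j-1. tm b (j - n) * (- ?d (?G n))) + (if b = c then of_nat (j - 1) * Gs b t ?i else 0)"
      unfolding sum.distrib sum_constant by (cases "b = c") simp_all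
    also have "(\<Sum>n=1..j-1. tm b (j - n) * (- ?d (?G n))) = ?L"
      by (rule sum.reindex_bij_witness[of _ "\<lambda>n. j - n" "\<lambda>n. j - n"]) auto
    finally show ?thesis by (simp only: mult_2)
  qed
  have h: "2 * (fcst (x / 2) * f) = fcst x * f" for x and f :: fser
    by (simp add: numeral_fser mult.assoc[symmetric] flip: fcst_mult)
  have Q: "2 * del c (quadneg b j) i = 2 * (tm b j * del c (fS * t) i - ?d ((fS + of_int (kap b)) * Gs b t ?i))
     + (2 * ?L + (if b = c then of_nat (j - 1) * Gs b t ?i else 0))
     - fcst (of_int (sg b * int j) - 1) * ?d (Gs b t ?i)"
  proof -
    have "2 * del c (quadneg b j) i = 2 * del c (tm b j * (fS * t)) i
      + 2 * (fcst (1/2) * (\<Sum>n=1..j-1. del c (tm b n * (tm b (j - n) * t)) i))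
      + 2 * (fcst ((of_int (sg b * int j) - 1) / 2) * del c (tm b j * t) i)"
      unfolding quadneg_def del_add del_cst del_sum by (simp only: sm_apply distrib_left plus_fun_apply sum_op_apply)
    thus ?thesis unfolding h half_double quadsum del_tm[OF j(1)] Gs_S_mult del_t by (simp add: algebra_simps)
  qed
  show ?thesis
  proof (rule double_cancel)
    show "2 * Del c (A b (- int j) + (\<Sum>n=1..N. sm (tm b n) (B b (int n - int j)))) i =
      2 * del c (quadneg b j + (\<Sum>n=j+1..N. tm b n * dd b (n - j) t)) i"
      unfolding L del_add del_sum plus_fun_apply sum_op_apply distrib_left Q
      using j(1)
      by (cases b; cases c; simp add: sg_def kap_def fcst_diff fcst_minus of_nat_diff algebra_simps flip: of_nat_fser)
  qed
qed

text \<open>Undressed, this is Lambda^a s = (s + a) Lambda^a.\<close>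

lemma B_A:
  "mul 1 (B b l) (A b j) = A b (l + j) + sm (of_int (sg b * l)) (B b (l + j))"
proof -
  let ?S = "sm fS (lamb (sg b * (l + j)))" and ?I = "lamb (sg b * (l + j))"
  have 1: "mul 1 (lamb (sg b * l)) (sm fS (lamb (sg b * j))) = ?S + sm (of_int (sg b * l)) ?I"
    by (rule ext, unfold mul_lamb_left)
       (auto simp: sm_apply lamb_def fsh_mult fsh_S distrib_left algebra_simps)
  have "mul 1 (B b l) (A b j) = mul 1 (mul 1 (Wv b) (?S + sm (of_int (sg b * l)) ?I)) (Wi b)"
    unfolding B_def A_def by (subst conj_mul) (auto simp: bd_sm 1)
  also have "mul 1 (Wv b) (?S + sm (of_int (sg b * l)) ?I) =
      mul 1 (Wv b) ?S + sm (of_int (sg b * l)) (mul 1 (Wv b) ?I)"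
    by (subst mul_add_right; (intro mulok_bd[of b] bd_W bd_sm bd_lamb)?)
       (subst mul_sm_right; (intro mulok_bd[of b] bd_W bd_sm bd_lamb)?; simp del: of_int_mult)
  also have "mul 1 (mul 1 (Wv b) ?S + sm (of_int (sg b * l)) (mul 1 (Wv b) ?I)) (Wi b) =
     A b (l + j) + sm (of_int (sg b * l)) (B b (l + j))"
    unfolding A_def B_def
    by (subst mul_add_left; (intro mulok_bd[of b] bd_mul bd_W bd_Wi bd_sm bd_lamb)?)
       (subst mul_sm_left; (intro mulok_bd[of b] bd_mul bd_W bd_Wi bd_sm bd_lamb)?; simp)
  finally show ?thesis .
qed

text \<open>The dressed derivative W d_s W^(-1) equals d_s plus this operator.\<close>

definition Pd :: "bool \<Rightarrow> fop" where "Pd b = mul 1 (Wv b) (dop fds (Wi b))"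

lemma bd_Pd [simp]: "bd b (Pd b)"
  unfolding Pd_def by (intro bd_mul bd_W bd_dop[OF fds.fderiv_axioms] bd_Wi)

lemma dop_fds_lamb [simp]: "dop fds (lamb j) = 0"
  by (auto simp: dop_def lamb_def)

lemma Pd_W: "mul 1 (Pd b) (Wv b) = - dop fds (Wv b)"
proof -
  note fd = fds.fderiv_axioms
  have bds: "bd b (dop fds (Wi b))" "bd b (dop fds (Wv b))" by (auto intro: bd_dop[OF fd])
  have "0 = dop fds (mul 1 (Wi b) (Wv b))" by (simp add: Wi_W)
  also have "\<dots> = mul 1 (dop fds (Wi b)) (Wv b) + mul 1 (Wi b) (dop fds (Wv b))"
    by (rule dop_mul[OF fd]) (auto intro!: mulok_bd[of b] fdiff_Wi fdiff_W)
  finally have 1: "mul 1 (dop fds (Wi b)) (Wv b) = - mul 1 (Wi b) (dop fds (Wv b))"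
    by (simp add: eq_neg_iff_add_eq_0)
  have "mul 1 (Pd b) (Wv b) = mul 1 (Wv b) (mul 1 (dop fds (Wi b)) (Wv b))"
    unfolding Pd_def by (rule assoc_W) (use bds in auto)
  also have "\<dots> = - mul 1 (mul 1 (Wv b) (Wi b)) (dop fds (Wv b))"
    unfolding 1 mul_minus_right by (subst mul_assoc_bd[of b]) (use bds in auto)
  finally show ?thesis by (simp add: W_Wi)
qed

lemma fdiff_lamb: "fdiff (lamb j i)"
  by (simp add: lamb_def)

lemma fdiff_B: "fdiff (B b l i)"
  unfolding B_def
  by (intro P_mul[OF fds.fderiv_axioms] fdiff_W fdiff_Wi) (simp add: lamb_def)

text \<open>Equivalently, d_s + \<open>Pd b\<close>, the dressed d_s, commutes with every dressed
  power of Lambda, because d_s commutes with Lambda.\<close>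

lemma Pd_B: "mul 1 (Pd b) (B b l) = mul 1 (B b l) (Pd b) - dop fds (B b l)"
proof (rule W_cancel[of b])
  note fd = fds.fderiv_axioms
  let ?W = "Wv b" and ?\<Lambda> = "lamb (sg b * l)"
  have bds: "bd b (dop fds (B b l))" "bd b (dop fds ?W)" by (auto intro: bd_dop[OF fd])
  show "bd b (mul 1 (Pd b) (B b l))" "bd b (mul 1 (B b l) (Pd b) - dop fds (B b l))"
    using bds by (auto intro!: bd_mul bd_diff)
  have "mul 1 (dop fds (B b l)) ?W + mul 1 (B b l) (dop fds ?W) = dop fds (mul 1 (B b l) ?W)"
    by (rule dop_mul[OF fd, symmetric]) (auto intro!: mulok_bd[of b] fdiff_B fdiff_W)
  also have "\<dots> = mul 1 (dop fds ?W) ?\<Lambda> + mul 1 ?W (dop fds ?\<Lambda>)"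
    unfolding B_W by (rule dop_mul[OF fd]) (auto intro!: mulok_bd[of b] fdiff_W fdiff_lamb)
  finally have dB: "mul 1 (dop fds (B b l)) ?W = mul 1 (dop fds ?W) ?\<Lambda> - mul 1 (B b l) (dop fds ?W)"
    by (simp add: eq_diff_eq)
  have "mul 1 (mul 1 (Pd b) (B b l)) ?W = mul 1 (mul 1 (Pd b) ?W) ?\<Lambda>"
    by (subst assoc_W, simp, simp, unfold B_W, rule mul_assoc_bd[of b, symmetric]) auto
  also have "\<dots> = - mul 1 (dop fds ?W) ?\<Lambda>" by (simp only: Pd_W mul_minus_left)
  finally have l: "mul 1 (mul 1 (Pd b) (B b l)) ?W = - mul 1 (dop fds ?W) ?\<Lambda>" .
  have "mul 1 (mul 1 (B b l) (Pd b) - dop fds (B b l)) ?W =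
      mul 1 (B b l) (mul 1 (Pd b) ?W) - mul 1 (dop fds (B b l)) ?W"
    by (subst mul_diff_left) (use bds in \<open>auto intro!: mulok_bd[of b] bd_mul simp: assoc_W\<close>)
  also have "\<dots> = - mul 1 (dop fds ?W) ?\<Lambda>"
    unfolding dB Pd_W mul_minus_right by simp
  finally show "mul 1 (mul 1 (Pd b) (B b l)) ?W = mul 1 (mul 1 (B b l) (Pd b) - dop fds (B b l)) ?W"
    unfolding l by simp
qed

text \<open>One summand is bounded above and the other below, which is why products with this
  operator are formed with finite operators only.\<close>

definition logLop :: fop where "logLop = sm (fcst (1/2)) (Pd True) + sm (fcst (- 1/2)) (Pd False)"

end

section \<open>The truncated identity\<close>

lemma mul_sum_right:
  assumes "finop L"
  shows "mul h L (sum F S) = (\<Sum>x\<in>S. mul h L (F x))"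
proof (induction S rule: infinite_finite_induct)
  case (insert x S)
  have "mul h L (F x + sum F S) = mul h L (F x) + mul h L (sum F S)"
    using assms by (intro mul_add_right mulok_fin_left)
  thus ?case using insert by (simp only: sum.insert not_False_eq_True insert_iff simp_thms)
qed (simp_all only: sum.infinite sum.empty mul_zero_right not_False_eq_True)

lemma regroup: "a + r + (b - r + (x + (y + z))) = (a + y) + (b + z) + (x :: 'a :: ab_group_add)"
  by (simp add: algebra_simps)

lemma add_exchange: "a + b = a' + b' \<Longrightarrow> (a + x) + (b + y) = (a' + x) + (b' + (y :: 'a :: ab_group_add))"
  by (metis add.assoc add.left_commute)

lemma fsh_cst_var: "fsh i (fcst a * fvar v) = fcst a * fvar v"
  by (simp add: fsh_mult)

locale bigraded = flow +
  fixes k m :: nat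
  assumes k: "1 \<le> k" and m: "1 \<le> m"
    and BB: "B True (int k) = B False (int m)"
    and flowX: "dop (fdX n) (Wv c) = sm (- of_int (sg c))
      (mul 1 (proj c (sm (fcst 2) (mul 1 (B True (int (k * n))) logLop))) (Wv c))"
begin

definition Lp :: "nat \<Rightarrow> fop" where "Lp n = B True (int (k * n))"

lemma Lp_mul: "mul 1 (Lp a) (Lp b) = Lp (a + b)"
  by (simp add: Lp_def B_mul distrib_left)

lemma Lp_0 [simp]: "Lp 0 = lamb 0" by (simp add: Lp_def)

lemma Lp_eq: "Lp n = B False (int (m * n))"
proof (induction n)
  case (Suc n)
  have "Lp (Suc n) = mul 1 (B True (int k)) (Lp n)"
    by (simp add: Lp_def B_mul distrib_left)
  also have "\<dots> = B False (int (m * Suc n))"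
    unfolding Suc BB by (simp add: B_mul distrib_left)
  finally show ?case .
qed (simp add: Lp_def)

text \<open>A power of L is bounded above when dressed by W and bounded below when dressed by
  Wbar.\<close>

lemma finop_Lp [simp]: "finop (Lp n)"
  using finop_iff[of "Lp n" True] bd_B[of True "int (k * n)"] bd_B[of False "int (m * n)"]
  by (metis Lp_def Lp_eq)

text \<open>The commutators of \<open>W (\<partial>\<^sub>s W\<^sup>-\<^sup>1)\<close> and of its barred counterpart with a power of \<open>L\<close> are both minus
  its \<open>s\<close>-derivative.\<close>

lemma logL_comm: "mul 1 logLop (Lp n) = mul 1 (Lp n) logLop"
proof -
  have T: "mul 1 (Pd True) (Lp n) = mul 1 (Lp n) (Pd True) - dop fds (Lp n)"
    unfolding Lp_def by (rule Pd_B)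
  have F: "mul 1 (Pd False) (Lp n) = mul 1 (Lp n) (Pd False) - dop fds (Lp n)"
    unfolding Lp_eq by (rule Pd_B)
  have "mul 1 logLop (Lp n) = sm (fcst (1/2)) (mul 1 (Pd True) (Lp n)) + sm (fcst (-1/2)) (mul 1 (Pd False) (Lp n))"
    unfolding logLop_def by (subst mul_add_left) (auto simp: mul_sm_left mulok_fin_right)
  also have "\<dots> = sm (fcst (1/2)) (mul 1 (Lp n) (Pd True)) + sm (fcst (-1/2)) (mul 1 (Lp n) (Pd False))"
    unfolding T F by (auto simp: sm_def fun_eq_iff right_diff_distrib fcst_minus)
  also have "\<dots> = mul 1 (Lp n) logLop"
    unfolding logLop_def by (subst mul_add_right) (auto simp: mul_sm_right mulok_fin_left)
  finally show ?thesis .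
qed

definition cK :: fser where "cK = fcst (1 / of_nat k)"
definition cM :: fser where "cM = fcst (1 / of_nat m)"

definition M_X :: "nat \<Rightarrow> fop" where
  "M_X n = mul 1 (sm (fcst (1 / of_nat k + 1 / of_nat m)) (sm (fvar (X n)) (lamb 0))
      + sm (fcst (2 * of_nat n)) (sm (fvar (X n)) logLop)) (Lp (n - 1))"

definition M_T :: "nat \<Rightarrow> fop" where
  "M_T n = sm (fcst (of_nat n / of_nat k)) (sm (fvar (T n)) (B True (int n - int k)))
    + sm (fcst (of_nat n / of_nat m)) (sm (fvar (TB n)) (B False (int n - int m)))"

definition M_trunc :: "nat \<Rightarrow> fop" where
  "M_trunc N = sm cK (A True (- int k)) + (sm cM (A False (- int m)) +
     ((\<Sum>n=1..N. M_X n) + (\<Sum>n=1..N. M_T n)))"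

lemma Lp_M_X:
  assumes "1 \<le> n"
  shows "mul 1 (Lp p) (M_X n) = sm (fvar (X n)) (sm (fcst (1 / of_nat k + 1 / of_nat m)) (Lp (p + n - 1))
     + sm (fcst (of_nat n)) (sm (fcst 2) (mul 1 (Lp (p + n - 1)) logLop)))"
proof -
  let ?c = "fcst (1 / of_nat k + 1 / of_nat m) * fvar (X n)" and ?d = "fcst (2 * of_nat n) * fvar (X n)"
  have pn: "p + (n - 1) = p + n - 1" using assms by simp
  have "mul 1 (Lp p) (M_X n) = mul 1 (Lp p) (sm ?c (Lp (n - 1)) + sm ?d (mul 1 (Lp (n - 1)) logLop))"
    unfolding M_X_def sm_sm
    by (subst mul_add_left) (auto simp: mul_sm_left mulok_fin_right logL_comm)
  also have "\<dots> = sm ?c (mul 1 (Lp p) (Lp (n - 1))) + sm ?d (mul 1 (Lp p) (mul 1 (Lp (n - 1)) logLop))"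
    by (subst mul_add_right) (auto simp: mul_sm_right mulok_fin_left fsh_cst_var)
  also have "mul 1 (Lp p) (mul 1 (Lp (n - 1)) logLop) = mul 1 (mul 1 (Lp p) (Lp (n - 1))) logLop"
    by (rule mul_assoc_fin[symmetric]) simp
  finally show ?thesis
    unfolding Lp_mul pn sm_add sm_sm fcst_mult by (simp only: mult_ac)
qed

text \<open>\<open>JK l\<close> and \<open>JM l\<close> correspond to \<open>L\<^sup>l\<close>, seen as a power of \<open>L\<^bsup>1/k\<^esup>\<close> and of \<open>L\<^bsup>1/m\<^esup>\<close>.\<close>

definition JK :: "nat \<Rightarrow> fser" where "JK l = (if l = 0 then fS * t else dd True (k * l) t)"
definition JM :: "nat \<Rightarrow> fser" where "JM l = (if l = 0 then fS * t else dd False (m * l) t)"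

text \<open>L^l is a power of both fractional roots, so two functions that need not be equal have
  the same image under \<open>del\<close>.\<close>

lemma Del_Lp: "Del c (Lp l) = del c (JK l)" "Del c (Lp l) = del c (JM l)"
proof -
  show "Del c (Lp l) = del c (JK l)"
  proof (cases "l = 0")
    case False
    hence "1 \<le> k * l" using k by simp
    with False show ?thesis unfolding JK_def Lp_def by (simp only: if_False Del_B_pos)
  qed (simp add: JK_def Del_lamb0)
  show "Del c (Lp l) = del c (JM l)"
  proof (cases "l = 0")
    case False
    hence "1 \<le> m * l" using m by simp
    with False show ?thesis unfolding JM_def Lp_eq by (simp only: if_False Del_B_pos)
  qed (simp add: JM_def Del_lamb0)
qed

text \<open>2 L^n log L generates the x_n flow. For n = 0 this is d_s, so differentiability of tau
  and of its inverse enters here.\<close>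

lemma Del_X: "Del c (sm (fcst 2) (mul 1 (Lp n) logLop)) = del c (fdX n t)"
proof -
  have "Del c (sm (fcst 2) (mul 1 (Lp n) logLop)) = sm t (dop (fdX n) (Wv c))"
    unfolding flowX Del_def Lp_def by (simp add: sm_sm mult.commute)
  also have "\<dots> = del c (fdX n t)"
  proof (cases "n = 0")
    case True
    hence "fdX n = fds" by (simp add: fdX_eq fun_eq_iff)
    thus ?thesis using del_D[OF fds.fderiv_axioms fdiff_t fdiff_u] by simp
  next
    case False
    hence "fdX n = fdv (X n)" by (simp add: fdX_eq fun_eq_iff)
    thus ?thesis using del_fdv by simp
  qed
  finally show ?thesis .
qed

text \<open>The share 1/k of L^(p+n-1) is translated through t and the share 1/m through tbar, as in
  the definition of the operators D_p.\<close>

definition X_part :: "nat \<Rightarrow> nat \<Rightarrow> fser" where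
  "X_part p n = fvar (X n) * (cK * JK (p + n - 1) + cM * JM (p + n - 1) + fcst (of_nat n) * fdX (p + n - 1) t)"

lemma Del_M_X:
  assumes "1 \<le> n"
  shows "Del c (mul 1 (Lp p) (M_X n)) = del c (X_part p n)"
proof -
  have v: "del c (fvar (X n) * f) = sm (fvar (X n)) (del c f)" for f
    by (rule del_other) simp
  have "Del c (mul 1 (Lp p) (M_X n)) = sm (fvar (X n)) (sm (cK + cM) (Del c (Lp (p + n - 1)))
     + sm (fcst (of_nat n)) (del c (fdX (p + n - 1) t)))"
    unfolding Lp_M_X[OF assms] Del_sm[of _ "fvar _"] Del_add Del_sm[of _ "fcst (of_nat n)"] Del_X
    by (simp add: Del_sm cK_def cM_def fcst_add)
  also have "sm (cK + cM) (Del c (Lp (p + n - 1))) = sm cK (del c (JK (p + n - 1))) + sm cM (del c (JM (p + n - 1)))"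
    unfolding sm_add' by (simp only: Del_Lp(1)[symmetric] Del_Lp(2)[symmetric])
  also have "sm (fvar (X n)) (\<dots> + sm (fcst (of_nat n)) (del c (fdX (p + n - 1) t))) = del c (X_part p n)"
    unfolding X_part_def v del_add cK_def cM_def del_cst ..
  finally show ?thesis .
qed

lemma Lp_M_T: "mul 1 (Lp p) (M_T n) = sm cK (sm (tm True n) (B True (int n - int k + int (k * p))))
   + sm cM (sm (tm False n) (B False (int n - int m + int (m * p))))"
proof -
  let ?c = "fcst (of_nat n / of_nat k) * fvar (T n)" and ?d = "fcst (of_nat n / of_nat m) * fvar (TB n)"
  have c: "?c = cK * tm True n" "?d = cM * tm False n"
    by (simp_all add: cK_def cM_def tm_def bv_def of_nat_fser mult.assoc[symmetric] flip: fcst_mult)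
  have "mul 1 (Lp p) (M_T n) = sm ?c (mul 1 (Lp p) (B True (int n - int k))) + sm ?d (mul 1 (Lp p) (B False (int n - int m)))"
    unfolding M_T_def sm_sm by (subst mul_add_right) (auto simp: mul_sm_right mulok_fin_left fsh_cst_var)
  also have "mul 1 (Lp p) (B True (int n - int k)) = B True (int n - int k + int (k * p))"
    by (simp add: Lp_def B_mul add.commute)
  also have "mul 1 (Lp p) (B False (int n - int m)) = B False (int n - int m + int (m * p))"
    by (simp add: Lp_eq B_mul add.commute)
  finally show ?thesis unfolding c sm_sm .
qed

definition LM_trunc :: "nat \<Rightarrow> nat \<Rightarrow> fop" where "LM_trunc p N = mul 1 (Lp p) (M_trunc N)"

text \<open>Moving L^p into the dressed s terms adds (1/k)(kp) L^(p-1) in one and (1/m)(-mp) L^(p-1)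
  in the other. The weights 1/k and 1/m are exactly those that make these cancel.\<close>

lemma LM_trunc_eq:
  "LM_trunc p N =
     sm cK (A True (int (k * p) - int k) + (\<Sum>n=1..N. sm (tm True n) (B True (int n - int k + int (k * p)))))
   + sm cM (A False (int (m * p) - int m) + (\<Sum>n=1..N. sm (tm False n) (B False (int n - int m + int (m * p)))))
   + (\<Sum>n=1..N. mul 1 (Lp p) (M_X n))"
proof -
  have K: "mul 1 (Lp p) (sm cK (A True (- int k))) =
      sm cK (A True (int (k * p) - int k)) + sm (of_nat p) (B True (int (k * p) - int k))"
  proof -
    have "cK * of_int (sg True * int (k * p)) = of_nat p"
      using k by (simp add: cK_def sg_def of_nat_fser flip: fcst_mult)
    moreover have "mul 1 (Lp p) (A True (- int k)) = A True (int (k * p) - int k)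
        + sm (of_int (sg True * int (k * p))) (B True (int (k * p) - int k))"
      using B_A[of True "int (k * p)" "- int k"] by (simp only: Lp_def diff_conv_add_uminus)
    moreover have "mul 1 (Lp p) (sm cK (A True (- int k))) = sm cK (mul 1 (Lp p) (A True (- int k)))"
      by (rule mul_sm_right) (simp_all add: mulok_fin_left cK_def)
    ultimately show ?thesis by (simp only: sm_add sm_sm)
  qed
  have M: "mul 1 (Lp p) (sm cM (A False (- int m))) =
      sm cM (A False (int (m * p) - int m)) - sm (of_nat p) (B False (int (m * p) - int m))"
  proof -
    have "cM * of_int (sg False * int (m * p)) = - of_nat p"
      using m by (simp add: cM_def sg_def of_nat_fser flip: fcst_mult fcst_minus)
    moreover have "mul 1 (Lp p) (A False (- int m)) = A False (int (m * p) - int m)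
        + sm (of_int (sg False * int (m * p))) (B False (int (m * p) - int m))"
      using B_A[of False "int (m * p)" "- int m"] by (simp only: Lp_eq diff_conv_add_uminus)
    moreover have "mul 1 (Lp p) (sm cM (A False (- int m))) = sm cM (mul 1 (Lp p) (A False (- int m)))"
      by (rule mul_sm_right) (simp_all add: mulok_fin_left cM_def)
    ultimately show ?thesis by (simp only: sm_add sm_sm sm_minus diff_conv_add_uminus)
  qed
  \<comment> \<open>For p = 0 the factor p vanishes; otherwise both operators are L^(p-1).\<close>
  have pc: "sm (of_nat p) (B True (int (k * p) - int k)) = sm (of_nat p) (B False (int (m * p) - int m))"
  proof (cases p)
    case (Suc q)
    have "B True (int (k * p) - int k) = Lp q" "B False (int (m * p) - int m) = Lp q"
      unfolding Suc by (simp add: Lp_def, simp add: Lp_eq)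
    thus ?thesis by simp
  qed simp
  have "LM_trunc p N = mul 1 (Lp p) (sm cK (A True (- int k))) + (mul 1 (Lp p) (sm cM (A False (- int m)))
     + ((\<Sum>n=1..N. mul 1 (Lp p) (M_X n)) + (\<Sum>n=1..N. mul 1 (Lp p) (M_T n))))"
    unfolding LM_trunc_def M_trunc_def
    by (simp only: mul_add_right[OF mulok_fin_left[OF finop_Lp] mulok_fin_left[OF finop_Lp]] mul_sum_right[OF finop_Lp])
  thus ?thesis
    unfolding K M pc Lp_M_T sm_add sm_sum sum.distrib by (simp only: regroup)
qed

definition quad' :: "bool \<Rightarrow> nat \<Rightarrow> fser" where
  "quad' b j = fS * dd b j t + fcst (1/2) * (\<Sum>n=1..j-1. dd b n (dd b (j - n) t)) - fcst (1/2) * dd b j t"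

text \<open>For \<open>p \<ge> 2\<close> the operator \<open>quad'\<close> differs from \<open>quad\<close> by multiples of \<open>\<partial>\<^bsub>t (p-1)k\<^esub>\<close> and of its barred counterpart,
  which cancel because both correspond to \<open>L\<^bsup>p-1\<^esup>\<close>.\<close>

definition Vir_trunc :: "nat \<Rightarrow> nat \<Rightarrow> fser" where
  "Vir_trunc p N = (\<Sum>n=1..N. X_part p n) + (
    if p = 0 then cK * (quadneg True k + (\<Sum>n=k+1..N. tm True n * dd True (n - k) t))
       + cM * (quadneg False m + (\<Sum>n=m+1..N. tm False n * dd False (n - m) t))
    else if p = 1 then cK * (quad0 + (\<Sum>n=1..N. tm True n * dd True n t))
       + cM * (quad0 + (\<Sum>n=1..N. tm False n * dd False n t))
    else cK * (quad' True (k * (p - 1)) + (\<Sum>n=1..N. tm True n * dd True (n + k * (p - 1)) t))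
       + cM * (quad' False (m * (p - 1)) + (\<Sum>n=1..N. tm False n * dd False (n + m * (p - 1)) t)))"

text \<open>The part \<open>sg b * j / 2\<close> of the first-order coefficient, at j = kq with
  weight 1/k and at j = mq with weight 1/m, becomes q/2 and -q/2.\<close>

lemma quad_quad':
  "cK * (quad True (k * q)) + cM * (quad False (m * q)) =
     cK * (quad' True (k * q)) + cM * (quad' False (m * q))
     - fcst (of_nat q / 2) * (dd True (k * q) t - dd False (m * q) t)"
proof -
  have qe: "quad b j = quad' b j - fcst (of_int (sg b) * of_nat j / 2) * dd b j t" for b j
    by (simp add: quad_def quad'_def add_divide_distrib fcst_add algebra_simps)
  have ce: "cK * (fcst (of_int (sg True) * of_nat (k * q) / 2) * f) = fcst (of_nat q / 2) * f"
    "cM * (fcst (of_int (sg False) * of_nat (m * q) / 2) * f) = - (fcst (of_nat q / 2) * f)" for f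
    using k m by (simp_all add: cK_def cM_def sg_def mult.assoc[symmetric] flip: fcst_mult) (simp add: fcst_minus)
  show ?thesis unfolding qe right_diff_distrib ce by simp
qed

lemma truncated_identity:
  assumes N: "k \<le> N" "m \<le> N" "- (sg c * i) \<le> int N"
  shows "Del c (LM_trunc p N) i = del c (Vir_trunc p N) i"
proof -
  have x: "(\<Sum>n=1..N. Del c (mul 1 (Lp p) (M_X n)) i) = (\<Sum>n=1..N. del c (X_part p n) i)"
    by (rule sum.cong[OF refl]) (simp add: Del_M_X)
  have L: "Del c (LM_trunc p N) i = cK * Del c (A True (int (k * p) - int k) + (\<Sum>n=1..N. sm (tm True n) (B True (int n - int k + int (k * p))))) i
    + cM * Del c (A False (int (m * p) - int m) + (\<Sum>n=1..N. sm (tm False n) (B False (int n - int m + int (m * p))))) i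
    + (\<Sum>n=1..N. del c (X_part p n) i)"
    unfolding LM_trunc_eq Del_add[of c "_ + _"] Del_add[of c "sm cK _"] Del_sm[of c cK] Del_sm[of c cM] Del_sum[of c "\<lambda>n. mul 1 (Lp p) (M_X n)"]
      plus_fun_apply sm_apply sum_op_apply x ..
  have cst: "del c (cK * f) i = cK * del c f i" "del c (cM * f) i = cM * del c f i" for f
    by (simp_all add: cK_def cM_def del_cst sm_apply)
  consider "p = 0" | "p = 1" | q where "p = Suc q" "1 \<le> q"
    by (cases p; fastforce)
  thus ?thesis
  proof cases
    case 1
    show ?thesis
      unfolding L Vir_trunc_def unfolding 1 using current_sum_neg[OF k N(1,3), of True] current_sum_neg[OF m N(2,3), of False]
      by (simp add: del_add del_sum cst sum_op_apply)
  next
    case 2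
    show ?thesis
      unfolding L Vir_trunc_def unfolding 2 using current_sum_0[OF N(3), of True] current_sum_0[OF N(3), of False]
      by (simp add: del_add del_sum cst sum_op_apply)
  next
    case 3
    have q: "1 \<le> k * q" "1 \<le> m * q" using 3 k m by (simp_all add: Suc_le_eq)
    have r: "int (k * Suc q) - int k = int (k * q)" "int (m * Suc q) - int m = int (m * q)"
      "int n - int k + int (k * Suc q) = int (n + k * q)" "int n - int m + int (m * Suc q) = int (n + m * q)" for n
      by simp_all
    let ?T = "\<Sum>n=1..N. tm True n * dd True (n + k * q) t" and ?TB = "\<Sum>n=1..N. tm False n * dd False (n + m * q) t"
    \<comment> \<open>Both derivatives correspond to L^q, so the discrepancy between
      \<open>quad\<close> and \<open>quad'\<close> lies in the kernel of \<open>del\<close>.\<close>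
    have "del c (dd True (k * q) t) = del c (dd False (m * q) t)"
      using Del_B_pos[OF q(1), of c True] Del_B_pos[OF q(2), of c False] Lp_def[of q] Lp_eq[of q] by simp
    hence "del c (fcst (of_nat q / 2) * (dd True (k * q) t - dd False (m * q) t)) i = 0"
      by (simp add: del_cst del_diff sm_apply)
    hence Q: "del c (cK * quad True (k * q) + cM * quad False (m * q)) i =
        del c (cK * quad' True (k * q) + cM * quad' False (m * q)) i"
      unfolding quad_quad' del_diff[of c "_ + _"] by simp
    have "Del c (LM_trunc p N) i = del c (cK * (quad True (k * q) + ?T) + cM * (quad False (m * q) + ?TB)) i
        + (\<Sum>n=1..N. del c (X_part p n) i)"
      unfolding L unfolding 3 r current_sum_pos[OF q(1) N(3)] current_sum_pos[OF q(2) N(3)] del_add[of c "cK * _"] plus_fun_apply cst ..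
    also have "del c (cK * (quad True (k * q) + ?T) + cM * (quad False (m * q) + ?TB)) i =
       del c (cK * (quad' True (k * q) + ?T) + cM * (quad' False (m * q) + ?TB)) i"
      using Q unfolding del_add plus_fun_apply distrib_left by (rule add_exchange)
    finally show ?thesis
      using 3 by (simp add: Vir_trunc_def del_add del_sum sum_op_apply)
  qed
qed

end

section \<open>Transfer to the raw representation\<close>

definition rp :: "fop \<Rightarrow> op" where "rp Q = (\<lambda>i. coeff (Q i))"
definition fsum :: "(nat \<Rightarrow> fser) \<Rightarrow> fser" where "fsum F = of_coeff (rsum (\<lambda>n. coeff (F n)))"
definition null_seq :: "(nat \<Rightarrow> fser) \<Rightarrow> bool" where
  "null_seq F \<longleftrightarrow> (\<forall>\<alpha>. \<forall>\<^sub>F n in sequentially. coeff (F n) \<alpha> = (\<lambda>s. 0))"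

lemma rp_inject: "rp Q = rp Z \<longleftrightarrow> Q = Z"
  unfolding rp_def fun_eq_iff[where f = "\<lambda>i. coeff (Q i)"] coeff_inject by (auto simp: fun_eq_iff)

lemma rp_surj: obtains Q where "V = rp Q"
proof
  show "V = rp (\<lambda>i. of_coeff (V i))" by (simp add: rp_def of_coeff_inverse)
qed

lemma rzero_Rep: "rzero = coeff 0" and rone_Rep: "rone = coeff 1"
  and radd_Rep: "radd (coeff f) (coeff g) = coeff (f + g)"
  and rmul_Rep: "rmul (coeff f) (coeff g) = coeff (f * g)"
  and rdvar_Rep: "rdvar v (coeff f) = coeff (fdv v f)"
  and rds_Rep: "rds (coeff f) = coeff (fds f)"
  and dX_Rep: "dX n (coeff f) = coeff (fdX n f)"
  and rshift_Rep: "rshift i (coeff f) = coeff (fsh i f)"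
  and rsum_Rep: "rsum (\<lambda>n. coeff (F n)) = coeff (fsum F)"
  and if_Rep: "(if c then coeff f else coeff g) = coeff (if c then f else g)"
  by (simp_all add: zero_fser.rep_eq one_fser.rep_eq plus_fser.rep_eq times_fser.rep_eq fdv.rep_eq
      fds.rep_eq fdX.rep_eq fsh.rep_eq fsum_def of_coeff_inverse)

lemmas Rep_rules = rzero_Rep rone_Rep radd_Rep rmul_Rep rscale_eq rS_eq rvar_eq rdvar_Rep rds_Rep dX_Rep
  rshift_Rep if_Rep

lemma Rep_add: "coeff (f + g) \<alpha> s = coeff f \<alpha> s + coeff g \<alpha> s"
  and Rep_diff: "coeff (f - g) \<alpha> s = coeff f \<alpha> s - coeff g \<alpha> s"
  and Rep_cst: "coeff (fcst c * f) \<alpha> s = c * coeff f \<alpha> s"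
  by (simp_all add: plus_fser.rep_eq radd_def minus_fser.rep_eq rscale_def flip: rscale_eq)

lemma rinv_Rep:
  assumes "u * t = 1"
  shows "rinv (coeff t) = coeff u"
  unfolding rinv_def
proof (rule the_equality)
  show "rmul (coeff t) (coeff u) = rone"
    unfolding rmul_Rep rone_Rep using assms by (simp add: mult.commute)
  fix v assume v: "rmul (coeff t) v = rone"
  define w where "w = of_coeff v"
  have vw: "v = coeff w" by (simp add: w_def of_coeff_inverse)
  have "t * w = 1" using v unfolding vw rmul_Rep rone_Rep coeff_inject .
  hence "u = u * (t * w)" by simp
  hence "u = w" using assms by (simp add: mult.assoc[symmetric])
  thus "v = coeff u" by (simp add: vw)
qed

lemma rdiv_Rep: "u * t = 1 \<Longrightarrow> rdiv (coeff f) (coeff t) = coeff (f * u)"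
  unfolding rdiv_def by (subst rinv_Rep, assumption, rule rmul_Rep)

lemma opadd_rp: "opadd (rp Q) (rp Z) = rp (Q + Z)"
  and opscale_rp: "opscale c (rp Q) = rp (sm (fcst c) Q)"
  and opmap_rvar_rp: "opmap (rvar v) (rp Q) = rp (sm (fvar v) Q)"
  and opmap_rdvar_rp: "opmap (rdvar v) (rp Q) = rp (dop (fdv v) Q)"
  and opmap_rds_rp: "opmap rds (rp Q) = rp (dop fds Q)"
  and opmap_dX_rp: "opmap (dX n) (rp Q) = rp (dop (fdX n) Q)"
  and lam_rp: "lam i = rp (lamb i)"
  and sLam_rp: "sLam i = rp (sm fS (lamb i))"
  and opminus_rp: "opminus (rp Q) = rp (proj True Q)"
  and opplus_rp: "opplus (rp Q) = rp (proj False Q)"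
  and zero_rp: "(\<lambda>_. rzero) = rp 0"
  and if_rp: "(if b then rp Q else rp Z) = rp (if b then Q else Z)"
  by (auto simp: opadd_def opscale_def opmap_def lam_def sLam_def opminus_def opplus_def rp_def
      sm_def dop_def lamb_def proj_def Rep_rules fun_eq_iff not_less
      simp del: if_Rep)

lemma opmul_rp: "opmul (rp Q) (rp Z) = rp (mul 1 Q Z)"
  by (intro ext) (simp add: opmul_def rp_def mul_def Rep_rules coeff_inject coeff_sum)

lemma smul_rp: "smul (rp Q) (rp Z) = rp (mul 0 Q Z)"
  by (intro ext) (simp add: smul_def rp_def mul_def Rep_rules coeff_inject coeff_sum)

lemma opsum_rp: "opsum (\<lambda>n. rp (F n)) = rp (\<lambda>i. fsum (\<lambda>n. F n i))"
  by (simp add: opsum_def rp_def rsum_Rep)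

lemmas rp_rules = opadd_rp opscale_rp opmap_rvar_rp opmap_rdvar_rp opmap_rds_rp opmap_dX_rp lam_rp sLam_rp
  opminus_rp opplus_rp opmul_rp

lemma bd_True_rp: "(\<exists>N. \<forall>i>N. rp Q i = rzero) \<longleftrightarrow> bd True Q"
  by (simp add: rp_def rzero_Rep coeff_inject bd_def sg_def)

lemma bd_False_rp: "(\<exists>N. \<forall>i<N. rp Q i = rzero) \<longleftrightarrow> bd False Q"
proof -
  have "(\<exists>N. \<forall>i<N. Q i = 0) \<longleftrightarrow> (\<exists>N. \<forall>i. - i > N \<longrightarrow> Q i = 0)"
  proof
    assume "\<exists>N. \<forall>i<N. Q i = 0"
    then obtain N where "\<forall>i<N. Q i = 0" by blast
    thus "\<exists>N. \<forall>i. - i > N \<longrightarrow> Q i = 0" by (intro exI[of _ "- N"]) auto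
  next
    assume "\<exists>N. \<forall>i. - i > N \<longrightarrow> Q i = 0"
    then obtain N where "\<forall>i. - i > N \<longrightarrow> Q i = 0" by blast
    thus "\<exists>N. \<forall>i<N. Q i = 0" by (intro exI[of _ "- N"]) auto
  qed
  thus ?thesis by (simp add: rp_def rzero_Rep coeff_inject bd_def sg_def)
qed

text \<open>The Boolean form of the support condition lets one argument evaluate both inverses and
  both quotients.\<close>

lemma the_rp:
  assumes "bd b V" "E (rp V)" "\<And>Z. bd b Z \<Longrightarrow> E (rp Z) \<Longrightarrow> Z = V"
  shows "(THE V. (if b then \<exists>N. \<forall>i>N. V i = rzero else \<exists>N. \<forall>i<N. V i = rzero) \<and> E V) = rp V"
proof (rule the_equality)
  show "(if b then \<exists>N. \<forall>i>N. rp V i = rzero else \<exists>N. \<forall>i<N. rp V i = rzero) \<and> E (rp V)"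
    unfolding bd_True_rp bd_False_rp using assms(1,2) by (cases b) auto
  fix Z assume Z: "(if b then \<exists>N. \<forall>i>N. Z i = rzero else \<exists>N. \<forall>i<N. Z i = rzero) \<and> E Z"
  obtain Z' where Z': "Z = rp Z'" by (rule rp_surj)
  have "bd b Z'" "E (rp Z')"
    using Z unfolding Z' bd_True_rp bd_False_rp by (cases b; simp)+
  thus "Z = rp V" unfolding Z' using assms(3) by blast
qed

lemma inv_rp:
  assumes "neg_supp b Q" "w * Q 0 = 1" "neg_supp b V" "mul 1 Q V = lamb 0"
  shows "(if b then inv_mm (rp Q) else inv_pp (rp Q)) = rp V"
proof -
  have "(THE V. (if b then \<exists>N. \<forall>i>N. V i = rzero else \<exists>N. \<forall>i<N. V i = rzero) \<and> opmul (rp Q) V = lam 0) = rp V"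
  proof (rule the_rp[OF neg_supp_bd[OF assms(3)]])
    show "opmul (rp Q) (rp V) = lam 0" by (simp add: opmul_rp lam_rp assms(4))
    fix Z assume Z: "bd b Z" "opmul (rp Q) (rp Z) = lam 0"
    have "mul 1 Q Z = mul 1 Q V" using Z(2) assms(4) unfolding opmul_rp lam_rp rp_inject by simp
    thus "Z = V" by (rule left_cancel[OF assms(1,2) Z(1) neg_supp_bd[OF assms(3)]])
  qed
  thus ?thesis by (cases b) (simp_all add: inv_mm_def inv_pp_def)
qed

lemma sdiv_rp:
  assumes "neg_supp b Q" "w * Q 0 = 1" "bd b V" "mul 0 V Q = Z"
  shows "(if b then sdiv_minus (rp Z) (rp Q) else sdiv_plus (rp Z) (rp Q)) = rp V"
proof -
  have "(THE V. (if b then \<exists>N. \<forall>i>N. V i = rzero else \<exists>N. \<forall>i<N. V i = rzero) \<and> smul V (rp Q) = rp Z) = rp V"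
  proof (rule the_rp[OF assms(3)])
    show "smul (rp V) (rp Q) = rp Z" by (simp add: smul_rp assms(4))
    fix Y assume Y: "bd b Y" "smul (rp Y) (rp Q) = rp Z"
    have "mul 0 Y Q = mul 0 V Q" using Y(2) assms(4) unfolding smul_rp rp_inject by simp
    thus "Y = V" by (rule right_cancel[OF assms(1,2) Y(1) assms(3)])
  qed
  thus ?thesis by (cases b) (simp_all add: sdiv_minus_def sdiv_plus_def)
qed

text \<open>For symbols no shift intervenes, so this is multiplicativity of the vertex operator; it
  turns G(h/tau) G(tau) into G(h).\<close>

lemma Gs_mult: "mul 0 (Gs b f) (Gs b g) = Gs b (f * g)"
proof
  fix i
  have neg: "neg_supp b (Gs b h)" for h by (simp add: neg_supp_def)
  show "mul 0 (Gs b f) (Gs b g) i = Gs b (f * g) i"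
  proof (cases "sg b * i > 0")
    case True
    thus ?thesis using neg_suppD[OF neg_supp_mul(2)[OF neg neg]] by simp
  next
    case False
    define n where "n = nat (- (sg b * i))"
    have i: "i = - sg b * int n" using False by (simp add: n_def)
    have G: "Gs b h (- sg b * int l) = gco b (fsh (kap b) h) l" for h l
      by (simp add: Gs_def mult.assoc[symmetric])
    show ?thesis unfolding i neg_supp_mul(1)[OF neg neg] G by (simp add: fsh_mult gco_mult)
  qed
qed

lemma mul0_sm_right: "mulok Q Z \<Longrightarrow> mul 0 Q (sm f Z) = sm f (mul 0 Q Z)"
  unfolding sm_def
  by (intro ext, subst mul_superset[where S = "{i. Q i \<noteq> 0 \<and> Z (n - i) \<noteq> 0}" for n])
     (auto simp: mulok_def mul_def sum_distrib_left mult.left_commute)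

lemma null_seq_add: "null_seq F \<Longrightarrow> null_seq G \<Longrightarrow> null_seq (\<lambda>n. F n + G n)"
  unfolding null_seq_def
proof
  fix \<alpha>
  assume "\<forall>\<alpha>. \<forall>\<^sub>F n in sequentially. coeff (F n) \<alpha> = (\<lambda>s. 0)"
    and "\<forall>\<alpha>. \<forall>\<^sub>F n in sequentially. coeff (G n) \<alpha> = (\<lambda>s. 0)"
  hence "\<forall>\<^sub>F n in sequentially. coeff (F n) \<alpha> = (\<lambda>s. 0)"
    "\<forall>\<^sub>F n in sequentially. coeff (G n) \<alpha> = (\<lambda>s. 0)" by blast+
  thus "\<forall>\<^sub>F n in sequentially. coeff (F n + G n) \<alpha> = (\<lambda>s. 0)"
    by eventually_elim (simp add: plus_fser.rep_eq radd_def)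
qed

text \<open>A monomial contains finitely many variables, and by injectivity each of them occurs as a
  factor for at most one n.\<close>

lemma null_seq_var:
  assumes "inj V"
  shows "null_seq (\<lambda>n. fvar (V n) * g n)"
  unfolding null_seq_def
proof
  fix \<alpha> :: mono
  have "finite (V -` Poly_Mapping.keys \<alpha>)" using assms by (intro finite_vimageI) auto
  then obtain K where K: "\<And>n. n \<in> V -` Poly_Mapping.keys \<alpha> \<Longrightarrow> n < K"
    by (metis finite_nat_set_iff_bounded)
  show "\<forall>\<^sub>F n in sequentially. coeff (fvar (V n) * g n) \<alpha> = (\<lambda>s. 0)"
    unfolding eventually_sequentially
  proof (intro exI[of _ K] allI impI)
    fix n assume "K \<le> n"
    hence "V n \<notin> Poly_Mapping.keys \<alpha>" using K[of n] by force
    thus "coeff (fvar (V n) * g n) \<alpha> = (\<lambda>s. 0)"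
      unfolding rvar_eq[symmetric] by (simp add: rvar_def in_keys_iff)
  qed
qed

lemma null_seq_eventually: "null_seq F \<Longrightarrow> (\<And>n. 1 \<le> n \<Longrightarrow> G n = F n) \<Longrightarrow> null_seq G"
  unfolding null_seq_def
proof
  fix \<alpha>
  assume F: "\<forall>\<alpha>. \<forall>\<^sub>F n in sequentially. coeff (F n) \<alpha> = (\<lambda>s. 0)" and G: "\<And>n. 1 \<le> n \<Longrightarrow> G n = F n"
  have "\<forall>\<^sub>F n in sequentially. coeff (F n) \<alpha> = (\<lambda>s. 0)" using F by blast
  moreover have "\<forall>\<^sub>F n in sequentially. 1 \<le> n" by (rule eventually_ge_at_top)
  ultimately show "\<forall>\<^sub>F n in sequentially. coeff (G n) \<alpha> = (\<lambda>s. 0)"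
    by eventually_elim (simp add: G)
qed

lemma fconv_fsum: "null_seq F \<Longrightarrow> fconv (\<lambda>N. \<Sum>n\<le>N. F n) (fsum F)"
  unfolding fsum_def null_seq_def by (rule fconv_rsum) blast

lemma fconv_fsum':
  assumes "null_seq F" "F 0 = 0"
  shows "fconv (\<lambda>N. \<Sum>n=1..N. F n) (fsum F)"
proof -
  have "(\<Sum>n\<le>N. F n) = (\<Sum>n=1..N. F n)" for N
    using assms(2) by (simp add: atMost_atLeast0 sum.atLeast_Suc_atMost)
  thus ?thesis using fconv_fsum[OF assms(1)] by simp
qed

lemma fconv_offset: "fconv F f \<Longrightarrow> fconv (\<lambda>N. F (N - c)) f"
  unfolding fconv_def
proof
  fix \<alpha>
  assume "\<forall>\<alpha>. \<forall>\<^sub>F n in sequentially. coeff (F n) \<alpha> = coeff f \<alpha>"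
  thus "\<forall>\<^sub>F n in sequentially. coeff (F (n - c)) \<alpha> = coeff f \<alpha>"
    using filterlim_minus_const_nat_at_top[of c] unfolding filterlim_iff by blast
qed

lemma fconv_mul_left:
  assumes "finop L" "\<And>i. fconv (\<lambda>N. F N i) (G i)"
  shows "fconv (\<lambda>N. mul 1 L (F N) i) (mul 1 L G i)"
proof -
  have "mul 1 L Z i = (\<Sum>l\<in>{l. L l \<noteq> 0}. L l * fsh (1 * l) (Z (i - l)))" for Z
    using assms(1) by (intro mul_superset) (auto simp: finop_def)
  thus ?thesis by (simp only:) (intro fconv_sum fconv_mult fconv_const fconv_sh assms(2))
qed

context flow
begin

lemma fconv_Del:
  assumes "\<And>i. fconv (\<lambda>N. F N i) (G i)"
  shows "fconv (\<lambda>N. Del c (F N) i) (Del c G i)"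
proof -
  \<comment> \<open>The projection bounds l on one side and the support of the wave operator bounds
    it on the other. The range of summation is thus finite and the same for all members of the
    sequence.\<close>
  have "mul 1 (proj c Z) (Wv c) i = (\<Sum>l=-\<bar>i\<bar>..\<bar>i\<bar>. proj c Z l * fsh (1 * l) (Wv c (i - l)))" for Z
  proof (rule mul_superset)
    show "{l. proj c Z l \<noteq> 0 \<and> Wv c (i - l) \<noteq> 0} \<subseteq> {-\<bar>i\<bar>..\<bar>i\<bar>}"
    proof clarify
      fix l assume l: "proj c Z l \<noteq> 0" "Wv c (i - l) \<noteq> 0"
      have "sg c * (i - l) \<le> 0" using l(2) neg_suppD[OF neg_W, of c "i - l"] by fastforce
      moreover have "c = (l < 0)" using l(1) by (auto simp: proj_def split: if_splits)
      ultimately show "l \<in> {-\<bar>i\<bar>..\<bar>i\<bar>}" by (cases c) (auto simp: sg_def)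
    qed
  qed simp
  moreover have "fconv (\<lambda>N. proj c (F N) l) (proj c G l)" for l
    using assms by (simp add: proj_def)
  ultimately show ?thesis
    unfolding Del_def sm_apply by (simp only:) (intro fconv_mult fconv_const fconv_sum)
qed

lemma fconv_del: "fconv h v \<Longrightarrow> fconv (\<lambda>N. del c (h N) i) (del c v i)"
  unfolding del_def by (intro fconv_diff fconv_mult fconv_const fconv_Gs)

text \<open>The link between the quotients of the theorem and \<open>del\<close>: multiplying
  G(h/tau) - h/tau by the symbol G(tau)/tau gives (G(h) - (h/tau) G(tau)) / tau.\<close>

lemma quotient_symbol:
  "mul 0 (\<lambda>j. Gs c (v * u) j - (if j = 0 then v * u else 0)) (Wv c) = sm u (del c v)"
proof -
  let ?Z = "\<lambda>j. if j = 0 then v * u else 0 :: fser"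
  have W: "Wv c = sm u (Gs c t)" by (auto simp: Wv_def sm_def mult.commute)
  have bdG: "bd c (Gs c f)" for f by (rule neg_supp_bd) (simp add: neg_supp_def)
  have Z: "?Z = sm (v * u) (lamb 0)" by (auto simp: sm_def lamb_def)
  have "mul 0 (Gs c (v * u) - ?Z) (Wv c) = mul 0 (Gs c (v * u)) (Wv c) - mul 0 ?Z (Wv c)"
    unfolding Z by (rule mul_diff_left) (auto intro!: mulok_bd[of c] bdG bd_sm)
  also have "mul 0 (Gs c (v * u)) (Wv c) = sm u (Gs c v)"
    unfolding W by (subst mul0_sm_right) (auto intro!: mulok_bd[of c] bdG simp: Gs_mult mult.assoc ut)
  also have "mul 0 ?Z (Wv c) = sm (v * u) (Wv c)"
    unfolding Z by (subst mul_sm_left) (auto intro!: mulok_bd[of c])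
  also have "sm u (Gs c v) - sm (v * u) (Wv c) = sm u (del c v)"
    by (auto simp: fun_eq_iff sm_def del_W right_diff_distrib mult_ac)
  finally show ?thesis by (simp add: fun_diff_def)
qed

end

section \<open>Passage to the limit\<close>

lemma null_seq_cvar: "inj V \<Longrightarrow> null_seq (\<lambda>n. c n * (fvar (V n) * g n))"
  using null_seq_var[of V "\<lambda>n. c n * g n"] by (simp add: mult.left_commute)

lemma inj_vars [simp]: "inj X" "inj (\<lambda>n. X (n + 1))" "inj (\<lambda>n. X (Suc n))" "inj (bv b)" "inj (\<lambda>n. bv b (n + j))"
  by (auto simp: inj_def)

lemma fsum_add:
  assumes "null_seq F" "null_seq G"
  shows "fsum (\<lambda>n. F n + G n) = fsum F + fsum G"
  using fconv_fsum[OF null_seq_add[OF assms]] fconv_add[OF fconv_fsum[OF assms(1)] fconv_fsum[OF assms(2)]]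
  unfolding sum.distrib by (rule fconv_unique)

lemma sum_atMost_0: "F 0 = 0 \<Longrightarrow> (\<Sum>n\<le>N. F n) = (\<Sum>n=1..N. F n)"
  for F :: "nat \<Rightarrow> fser"
  by (simp add: atMost_atLeast0 sum.atLeast_Suc_atMost)

lemma sum_offset: "(\<Sum>n=j+1..N. F n) = (\<Sum>n=1..N-j. F (n + j))"
  for F :: "nat \<Rightarrow> fser"
  by (rule sum.reindex_bij_witness[of _ "\<lambda>n. n + j" "\<lambda>n. n - j"]) auto

context bigraded
begin

definition M_X' :: "nat \<Rightarrow> fop" where "M_X' n = (if n = 0 then 0 else M_X n)"
definition M_T' :: "nat \<Rightarrow> fop" where "M_T' n = (if n = 0 then 0 else M_T n)"
definition M_op :: fop where
  "M_op = sm cK (A True (- int k)) + (sm cM (A False (- int m)) +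
     ((\<lambda>i. fsum (\<lambda>n. M_X' n i)) + (\<lambda>i. fsum (\<lambda>n. M_T' n i))))"

lemma fconv_M_trunc: "fconv (\<lambda>N. M_trunc N i) (M_op i)"
proof -
  define Y where "Y = (\<lambda>n. sm (fcst (1 / of_nat k + 1 / of_nat m)) (Lp (n - 1))
     + sm (fcst (of_nat n)) (sm (fcst 2) (mul 1 (Lp (n - 1)) logLop)))"
  \<comment> \<open>The case p = 0 of \<open>Lp_M_X\<close> brings x_n to the front, so the sequence
    vanishes eventually at each monomial.\<close>
  have "M_X n = sm (fvar (X n)) (Y n)" if "1 \<le> n" for n
    using Lp_M_X[OF that, of 0] by (simp add: Y_def)
  hence X: "null_seq (\<lambda>n. M_X' n i)"
    by (intro null_seq_eventually[OF null_seq_var[of X "\<lambda>n. Y n i"]]) (auto simp: M_X'_def sm_apply)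
  have T: "null_seq (\<lambda>n. M_T' n i)"
    by (rule null_seq_eventually[OF null_seq_add[OF
          null_seq_cvar[of "bv True" "\<lambda>n. fcst (of_nat n / of_nat k)" "\<lambda>n. B True (int n - int k) i"]
          null_seq_cvar[of "bv False" "\<lambda>n. fcst (of_nat n / of_nat m)" "\<lambda>n. B False (int n - int m) i"]]])
       (auto simp: M_T'_def M_T_def sm_apply bv_def)
  have "(\<Sum>n=1..N. M_X n) i = (\<Sum>n=1..N. M_X' n i)" "(\<Sum>n=1..N. M_T n) i = (\<Sum>n=1..N. M_T' n i)" for N
    by (auto simp: sum_op_apply M_X'_def M_T'_def)
  thus ?thesis
    unfolding M_trunc_def M_op_def plus_fun_apply
    by (simp only:) (intro fconv_add fconv_const fconv_fsum' X T; simp add: M_X'_def M_T'_def)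
qed

lemma Del_limit:
  assumes "fconv (Vir_trunc p) v"
  shows "Del c (mul 1 (Lp p) M_op) = del c v"
proof
  fix i
  have 1: "fconv (\<lambda>N. Del c (LM_trunc p N) i) (Del c (mul 1 (Lp p) M_op) i)"
    unfolding LM_trunc_def by (intro fconv_Del fconv_mul_left finop_Lp fconv_M_trunc)
  have 2: "fconv (\<lambda>N. del c (Vir_trunc p N) i) (del c v i)"
    by (rule fconv_del[OF assms])
  have "\<forall>\<^sub>F N in sequentially. k \<le> N \<and> m \<le> N \<and> nat (- (sg c * i)) \<le> N"
    by (intro eventually_conj eventually_ge_at_top)
  hence "\<forall>\<^sub>F N in sequentially. del c (Vir_trunc p N) i = Del c (LM_trunc p N) i"
    by (rule eventually_mono) (subst truncated_identity, auto)
  from fconv_unique[OF 1 fconv_eventually[OF this 2]]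
  show "Del c (mul 1 (Lp p) M_op) i = del c v i" .
qed

section \<open>The operators L_(p-1) on tau as limits of the truncations\<close>

definition quadV :: "bool \<Rightarrow> nat \<Rightarrow> fser" where
  "quadV b j = fcst (1 / (2 * of_nat j)) *
     (\<Sum>n=1..j-1. fcst (of_nat (n * (j - n))) * (fvar (bv b n) * (fvar (bv b (j - n)) * t)))"

definition D0_summand :: "bool \<Rightarrow> nat \<Rightarrow> nat \<Rightarrow> fser" where
  "D0_summand b j n = (if n = 0 then 0 else fvar (X (n + 1)) * dd b (n * j) t
     + fcst (of_nat (n + j)) * (fvar (bv b (n + j)) * dd b n t))"

definition D0_X_summand :: "nat \<Rightarrow> fser" where
  "D0_X_summand n = (if n = 0 then 0 else fcst (of_nat n) * (fvar (X n) * fdX (n - 1) t))"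

definition Vir_zero :: fser where
  "Vir_zero = cK * fsum (D0_summand True k) + quadV True k + cM * fsum (D0_summand False m) + quadV False m + fsum D0_X_summand
    + fcst (1 / of_nat k + 1 / of_nat m) * (fS * (fvar (X 1) * t))
    + fS * (fvar (bv True k) * t + fvar (bv False m) * t)
    + fcst ((of_nat k - 1) / 2) * (fvar (bv True k) * t) - fcst ((of_nat m + 1) / 2) * (fvar (bv False m) * t)"

lemma Vir_0: "Vir k m 0 (coeff t) = coeff Vir_zero"
proof (intro ext)
  fix \<alpha> s
  show "Vir k m 0 (coeff t) \<alpha> s = coeff Vir_zero \<alpha> s"
    unfolding Vir_zero_def quadV_def D0_summand_def D0_X_summand_def cK_def cM_def Rep_add Rep_diff Rep_cst coeff_sum
    by (simp only: Vir_def if_True refl D0_def Rep_rules rsum_Rep bv_def if_False)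
qed

definition D1_summand :: "bool \<Rightarrow> nat \<Rightarrow> nat \<Rightarrow> fser" where
  "D1_summand b j n = (if n = 0 then 0 else fvar (X n) * dd b (n * j) t
     + fcst (of_nat n) * (fvar (bv b n) * dd b n t))"

definition D1_X_summand :: "nat \<Rightarrow> fser" where
  "D1_X_summand n = (if n = 0 then 0 else fcst (of_nat n) * (fvar (X n) * fdv (X n) t))"

definition Vir_one :: fser where
  "Vir_one = cK * fsum (D1_summand True k) + cM * fsum (D1_summand False m) + fsum D1_X_summand
    + fcst ((1 / of_nat k + 1 / of_nat m) / 2) * (fS * (fS * t))
    - fcst (1 / (2 * of_nat k) + 1 / (2 * of_nat m)) * (fS * t)"

lemma Vir_1: "Vir k m 1 (coeff t) =
  coeff (Vir_one + fcst (of_nat (k + m) * (of_nat (k * m) + 2) / (24 * of_nat k * of_nat m)) * t)"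
proof (intro ext)
  fix \<alpha> s
  show "Vir k m 1 (coeff t) \<alpha> s =
    coeff (Vir_one + fcst (of_nat (k + m) * (of_nat (k * m) + 2) / (24 * of_nat k * of_nat m)) * t) \<alpha> s"
    unfolding Vir_one_def D1_summand_def D1_X_summand_def cK_def cM_def Rep_add Rep_diff Rep_cst coeff_sum
    by (simp only: Vir_def if_True if_False refl one_neq_zero D1_def Rep_rules rsum_Rep bv_def)
qed

definition Dsucc_summand :: "nat \<Rightarrow> bool \<Rightarrow> nat \<Rightarrow> nat \<Rightarrow> fser" where
  "Dsucc_summand q b j n = (if n = 0 then fS * dd b ((q + n) * j) t else fvar (X n) * dd b ((q + n) * j) t)
     + (if n = 0 then 0 else fcst (of_nat n) * (fvar (bv b n) * dd b (q * j + n) t))"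

definition Dsucc_X_summand :: "nat \<Rightarrow> nat \<Rightarrow> fser" where
  "Dsucc_X_summand q n = (if n = 0 then 0 else fcst (of_nat n) * (fvar (X n) * fdv (X (q + n)) t))"

definition Vir_ge_two :: "nat \<Rightarrow> fser" where
  "Vir_ge_two q = fsum (Dsucc_X_summand q) + cK * fsum (Dsucc_summand q True k)
    + fcst (1 / (2 * of_nat k)) * (\<Sum>n=1..q*k-1. dd True n (dd True (q * k - n) t))
    + cM * fsum (Dsucc_summand q False m)
    + fcst (1 / (2 * of_nat m)) * (\<Sum>n=1..q*m-1. dd False n (dd False (q * m - n) t))
    - fcst (1 / (2 * of_nat k)) * dd True (q * k) t - fcst (1 / (2 * of_nat m)) * dd False (q * m) t"

lemma Vir_2:
  assumes "1 \<le> q"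
  shows "Vir k m (Suc q) (coeff t) = coeff (Vir_ge_two q)"
proof (intro ext)
  fix \<alpha> s
  have x: "xmul n (coeff f) = coeff (if n = 0 then fS * f else fvar (X n) * f)" for n f
    by (simp add: xmul_def Rep_rules)
  have p: "Suc q \<noteq> 0" "Suc q \<noteq> 1" "Suc q - 1 = q" using assms by auto
  show "Vir k m (Suc q) (coeff t) \<alpha> s = coeff (Vir_ge_two q) \<alpha> s"
    unfolding Vir_ge_two_def Dsucc_summand_def Dsucc_X_summand_def cK_def cM_def Rep_add Rep_diff Rep_cst coeff_sum
    by (simp only: Vir_def p if_True if_False refl Dsucc_def x Rep_rules rsum_Rep bv_def)
qed

lemma quadneg_quadV:
  assumes "1 \<le> j"
  shows "fcst (1 / of_nat j) * quadneg b j = quadV b j + fS * (fvar (bv b j) * t)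
     + fcst ((of_int (sg b * int j) - 1) / 2) * (fvar (bv b j) * t)"
proof -
  have j: "fcst (1 / of_nat j) * (tm b j * f) = fvar (bv b j) * f" for f
    using assms by (simp add: tm_def of_nat_fser mult.assoc[symmetric] flip: fcst_mult)
  have "fcst (1 / of_nat j) * (fcst (1 / 2) * (\<Sum>n=1..j-1. tm b n * (tm b (j - n) * t))) = quadV b j"
  proof -
    have "tm b n * (tm b (j - n) * t) = fcst (of_nat (n * (j - n))) * (fvar (bv b n) * (fvar (bv b (j - n)) * t))" for n
      unfolding tm_def of_nat_fser of_nat_mult fcst_mult by (simp only: mult_ac)
    thus ?thesis unfolding quadV_def
      by (simp add: mult.assoc[symmetric] mult.commute[of "of_nat j" "2 :: complex"] flip: fcst_mult)
  qed
  thus ?thesis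
    unfolding quadneg_def distrib_left mult.left_commute[of _ "fcst ((of_int (sg b * int j) - 1) / 2)"] j
    by (simp add: mult.left_commute)
qed

text \<open>D_0 is indexed by x_(n+1) and t_(n+k), the truncation by x_n and t_n, so the sums
  \<open>a\<close> and \<open>e\<close> are cut at N - 1 and N - j. The summand n = 1 of the x part
  is s x_1 tau with both weights, the source of (1/k + 1/m) x_0 x_1.\<close>

lemma fconv_Vir_trunc_0: "fconv (Vir_trunc 0) Vir_zero"
proof -
  define a where "a = (\<lambda>b j n. if n = 0 then 0 else fvar (X (n + 1)) * dd b (n * j) t)"
  define e where "e = (\<lambda>b j n. if n = 0 then 0 else fcst (of_nat (n + j)) * (fvar (bv b (n + j)) * dd b n t))"
  have na: "null_seq (a b j)" for b j
    by (rule null_seq_eventually[OF null_seq_var[of "\<lambda>n. X (n + 1)" "\<lambda>n. dd b (n * j) t"]]) (auto simp: a_def)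
  have ne: "null_seq (e b j)" for b j
    by (rule null_seq_eventually[OF null_seq_cvar[of "\<lambda>n. bv b (n + j)" "\<lambda>n. fcst (of_nat (n + j))" "\<lambda>n. dd b n t"]])
       (auto simp: e_def)
  have n3: "null_seq D0_X_summand"
    by (rule null_seq_eventually[OF null_seq_cvar[of X "\<lambda>n. fcst (of_nat n)" "\<lambda>n. fdX (n - 1) t"]])
       (auto simp: D0_X_summand_def)
  have D0_summand: "fsum (D0_summand b j) = fsum (a b j) + fsum (e b j)" for b j
    unfolding fsum_add[OF na ne, symmetric] by (rule arg_cong[where f = fsum]) (auto simp: D0_summand_def a_def e_def)
  let ?x = "fvar (X 1) * (fS * t)"
  let ?g = "\<lambda>N. cK * (?x + (\<Sum>n\<le>N-1. a True k n)) + cM * (?x + (\<Sum>n\<le>N-1. a False m n)) + (\<Sum>n\<le>N. D0_X_summand n)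
    + (cK * quadneg True k + cK * (\<Sum>n\<le>N-k. e True k n) + (cM * quadneg False m + cM * (\<Sum>n\<le>N-m. e False m n)))"
  have lim: "fconv ?g (cK * (?x + fsum (a True k)) + cM * (?x + fsum (a False m)) + fsum D0_X_summand
    + (cK * quadneg True k + cK * fsum (e True k) + (cM * quadneg False m + cM * fsum (e False m))))"
    by (intro fconv_add fconv_mult fconv_const fconv_fsum n3 fconv_offset[OF fconv_fsum[OF na]] fconv_offset[OF fconv_fsum[OF ne]])
  have "cK * (?x + fsum (a True k)) + cM * (?x + fsum (a False m)) + fsum D0_X_summand
    + (cK * quadneg True k + cK * fsum (e True k) + (cM * quadneg False m + cM * fsum (e False m))) = Vir_zero"
  proof -
    have mm: "fcst ((of_int (sg False * int m) - 1) / 2) = - fcst ((of_nat m + 1) / 2)"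
      unfolding fcst_minus[symmetric] by (rule arg_cong[where f = fcst]) (simp add: sg_def field_simps)
    have kk: "fcst ((of_int (sg True * int k) - 1) / 2) = fcst ((of_nat k - 1) / 2)"
      by (simp add: sg_def)
    have c: "fcst (1 / of_nat k + 1 / of_nat m) = cK + cM" by (simp add: cK_def cM_def fcst_add)
    show ?thesis
      unfolding Vir_zero_def D0_summand quadneg_quadV[OF k, of True, folded cK_def] quadneg_quadV[OF m, of False, folded cM_def] mm kk c
      by (simp add: algebra_simps)
  qed
  moreover have "\<forall>\<^sub>F N in sequentially. ?g N = Vir_trunc 0 N"
  proof (rule eventually_mono[OF eventually_ge_at_top[of 1]])
    fix N :: nat assume N: "1 \<le> N"
    have X: "(\<Sum>n=1..N. fvar (X n) * J (n - 1)) = ?x + (\<Sum>n\<le>N-1. a b j n)"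
      if "J 0 = fS * t" "\<And>n. 1 \<le> n \<Longrightarrow> J n = dd b (n * j) t" for J b j
    proof -
      have "(\<Sum>n=1..N. fvar (X n) * J (n - 1)) = fvar (X 1) * J 0 + (\<Sum>n=2..N. fvar (X n) * J (n - 1))"
        using N by (simp add: sum.atLeast_Suc_atMost numeral_2_eq_2)
      also have "(\<Sum>n=2..N. fvar (X n) * J (n - 1)) = (\<Sum>n=1..N-1. fvar (X (n + 1)) * J n)"
        using sum_offset[of "\<lambda>n. fvar (X n) * J (n - 1)" 1 N] by (simp add: numeral_2_eq_2)
      also have "\<dots> = (\<Sum>n\<le>N-1. a b j n)"
        by (subst sum_atMost_0) (auto simp: a_def that intro!: sum.cong)
      finally show ?thesis using that(1) by simp
    qed
    have E: "(\<Sum>n=j+1..N. tm b n * dd b (n - j) t) = (\<Sum>n\<le>N-j. e b j n)" for b j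
      unfolding sum_offset by (subst sum_atMost_0) (auto simp: e_def tm_def of_nat_fser mult.assoc fcst_add intro!: sum.cong)
    have "(\<Sum>n=1..N. X_part 0 n) = cK * (\<Sum>n=1..N. fvar (X n) * JK (n - 1)) + cM * (\<Sum>n=1..N. fvar (X n) * JM (n - 1)) + (\<Sum>n\<le>N. D0_X_summand n)"
      by (subst sum_atMost_0)
         (auto simp: D0_X_summand_def X_part_def sum.distrib[symmetric] sum_distrib_left algebra_simps intro!: sum.cong)
    also have "(\<Sum>n=1..N. fvar (X n) * JK (n - 1)) = ?x + (\<Sum>n\<le>N-1. a True k n)"
      by (rule X) (auto simp: JK_def mult.commute)
    also have "(\<Sum>n=1..N. fvar (X n) * JM (n - 1)) = ?x + (\<Sum>n\<le>N-1. a False m n)"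
      by (rule X) (auto simp: JM_def mult.commute)
    finally show "?g N = Vir_trunc 0 N"
      unfolding Vir_trunc_def E by (simp add: distrib_left)
  qed
  ultimately show ?thesis using lim by (auto intro: fconv_eventually)
qed

text \<open>The two copies of \<open>quad0\<close>, weighted by 1/k and 1/m, give both the s^2/2
  term of D_1 and the linear term in s of L_0.\<close>

lemma fconv_Vir_trunc_1: "fconv (Vir_trunc 1) Vir_one"
proof -
  have n1: "null_seq (D1_summand b j)" for b j
    by (rule null_seq_eventually[OF null_seq_add[OF null_seq_var[of X "\<lambda>n. dd b (n * j) t"]
          null_seq_cvar[of "bv b" "\<lambda>n. fcst (of_nat n)" "\<lambda>n. dd b n t"]]]) (auto simp: D1_summand_def)
  have n3: "null_seq D1_X_summand"
    by (rule null_seq_eventually[OF null_seq_cvar[of X "\<lambda>n. fcst (of_nat n)" "\<lambda>n. fdv (X n) t"]])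
       (auto simp: D1_X_summand_def)
  let ?g = "\<lambda>N. cK * (\<Sum>n=1..N. D1_summand True k n) + cM * (\<Sum>n=1..N. D1_summand False m n) + (\<Sum>n=1..N. D1_X_summand n)
    + (cK * quad0 + cM * quad0)"
  have "Vir_trunc 1 = ?g"
  proof
    fix N
    have "(\<Sum>n=1..N. X_part 1 n) = cK * (\<Sum>n=1..N. fvar (X n) * dd True (n * k) t)
       + cM * (\<Sum>n=1..N. fvar (X n) * dd False (n * m) t) + (\<Sum>n=1..N. D1_X_summand n)"
      unfolding sum_distrib_left sum.distrib[symmetric]
      by (intro sum.cong refl) (auto simp: X_part_def JK_def JM_def D1_X_summand_def fdX_eq algebra_simps)
    moreover have "(\<Sum>n=1..N. D1_summand b j n) = (\<Sum>n=1..N. fvar (X n) * dd b (n * j) t) + (\<Sum>n=1..N. tm b n * dd b n t)" for b j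
      unfolding sum.distrib[symmetric] by (intro sum.cong refl) (auto simp: D1_summand_def tm_def of_nat_fser mult.assoc)
    ultimately show "Vir_trunc 1 N = ?g N" by (simp add: Vir_trunc_def algebra_simps)
  qed
  moreover have "fconv ?g (cK * fsum (D1_summand True k) + cM * fsum (D1_summand False m) + fsum D1_X_summand + (cK * quad0 + cM * quad0))"
    by (intro fconv_add fconv_mult fconv_const fconv_fsum' n1 n3) (auto simp: D1_summand_def D1_X_summand_def)
  moreover have "cK * fsum (D1_summand True k) + cM * fsum (D1_summand False m) + fsum D1_X_summand + (cK * quad0 + cM * quad0) = Vir_one"
    unfolding Vir_one_def quad0_def cK_def cM_def
    by (simp add: add_divide_distrib fcst_add right_diff_distrib mult.assoc[symmetric] flip: fcst_mult) (simp add: algebra_simps)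
  ultimately show ?thesis by (simp only:)
qed

text \<open>The summand n = 0 of each sum in D_(q+1), where x_0 = s and n t_n vanishes, sits inside
  \<open>quad'\<close> in the truncation.\<close>

lemma fconv_Vir_trunc_ge_2:
  assumes q: "1 \<le> q"
  shows "fconv (Vir_trunc (Suc q)) (Vir_ge_two q)"
proof -
  have n1: "null_seq (Dsucc_summand q b j)" for b j
    by (rule null_seq_eventually[OF null_seq_add[OF null_seq_var[of X "\<lambda>n. dd b ((q + n) * j) t"]
          null_seq_cvar[of "bv b" "\<lambda>n. fcst (of_nat n)" "\<lambda>n. dd b (q * j + n) t"]]]) (auto simp: Dsucc_summand_def)
  have n3: "null_seq (Dsucc_X_summand q)"
    by (rule null_seq_eventually[OF null_seq_cvar[of X "\<lambda>n. fcst (of_nat n)" "\<lambda>n. fdv (X (q + n)) t"]])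
       (auto simp: Dsucc_X_summand_def)
  let ?Q = "\<lambda>b j. fcst (1/2) * (\<Sum>n=1..q*j-1. dd b n (dd b (q * j - n) t)) - fcst (1/2) * dd b (q * j) t"
  let ?g = "\<lambda>N. cK * (\<Sum>n\<le>N. Dsucc_summand q True k n) + cM * (\<Sum>n\<le>N. Dsucc_summand q False m n) + (\<Sum>n\<le>N. Dsucc_X_summand q n)
    + (cK * ?Q True k + cM * ?Q False m)"
  have "Vir_trunc (Suc q) = ?g"
  proof
    fix N
    have x: "(\<Sum>n=1..N. X_part (Suc q) n) = cK * (\<Sum>n=1..N. fvar (X n) * dd True ((q + n) * k) t)
       + cM * (\<Sum>n=1..N. fvar (X n) * dd False ((q + n) * m) t) + (\<Sum>n=1..N. Dsucc_X_summand q n)"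
      unfolding sum_distrib_left sum.distrib[symmetric]
      by (intro sum.cong refl) (auto simp: X_part_def JK_def JM_def Dsucc_X_summand_def fdX_eq algebra_simps)
    have h: "(\<Sum>n\<le>N. Dsucc_summand q b j n) = fS * dd b (q * j) t +
       ((\<Sum>n=1..N. fvar (X n) * dd b ((q + n) * j) t) + (\<Sum>n=1..N. tm b n * dd b (n + q * j) t))" for b j
    proof -
      have "(\<Sum>n\<le>N. Dsucc_summand q b j n) = Dsucc_summand q b j 0 + (\<Sum>n=1..N. Dsucc_summand q b j n)"
        by (simp add: atMost_atLeast0 sum.atLeast_Suc_atMost)
      also have "(\<Sum>n=1..N. Dsucc_summand q b j n) =
          (\<Sum>n=1..N. fvar (X n) * dd b ((q + n) * j) t) + (\<Sum>n=1..N. tm b n * dd b (n + q * j) t)"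
        unfolding sum.distrib[symmetric]
        by (intro sum.cong refl) (auto simp: Dsucc_summand_def tm_def of_nat_fser mult.assoc add.commute)
      finally show ?thesis by (simp add: Dsucc_summand_def)
    qed
    have h3: "(\<Sum>n\<le>N. Dsucc_X_summand q n) = (\<Sum>n=1..N. Dsucc_X_summand q n)" by (rule sum_atMost_0) (simp add: Dsucc_X_summand_def)
    have p: "Suc q \<noteq> 0" "Suc q \<noteq> 1" "Suc q - 1 = q" using q by auto
    show "Vir_trunc (Suc q) N = ?g N"
      unfolding Vir_trunc_def p if_False x h h3 quad'_def mult.commute[of k q] mult.commute[of m q] simp_thms
      using q by (simp add: algebra_simps)
  qed
  moreover have "fconv ?g (cK * fsum (Dsucc_summand q True k) + cM * fsum (Dsucc_summand q False m) + fsum (Dsucc_X_summand q) + (cK * ?Q True k + cM * ?Q False m))"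
    by (intro fconv_add fconv_mult fconv_const fconv_fsum n1 n3)
  moreover have "cK * fsum (Dsucc_summand q True k) + cM * fsum (Dsucc_summand q False m) + fsum (Dsucc_X_summand q) + (cK * ?Q True k + cM * ?Q False m) = Vir_ge_two q"
  proof -
    have c: "cK * (fcst (1/2) * f) = fcst (1 / (2 * of_nat k)) * f" "cM * (fcst (1/2) * f) = fcst (1 / (2 * of_nat m)) * f" for f
      unfolding cK_def cM_def mult.assoc[symmetric] fcst_mult[symmetric]
      by (simp_all add: mult.commute[of "of_nat k" "2 :: complex"] mult.commute[of "of_nat m" "2 :: complex"])
    show ?thesis unfolding Vir_ge_two_def right_diff_distrib c by (simp add: algebra_simps)
  qed
  ultimately show ?thesis by (simp only:)
qed

lemma Virasoro_del:
  obtains v where "Vir k m p (coeff t) = coeff v" "\<And>c. Del c (mul 1 (Lp p) M_op) = del c v"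
proof -
  consider "p = 0" | "p = 1" | q where "p = Suc q" "1 \<le> q"
    by (cases p; fastforce)
  thus ?thesis
  proof cases
    case 1
    show ?thesis using that[of Vir_zero] Vir_0 Del_limit[OF fconv_Vir_trunc_0] unfolding 1 by blast
  next
    case 2
    \<comment> \<open>Constant multiples of tau lie in the kernel of \<open>del\<close>; this takes
      care of the additive constant in L_0.\<close>
    have "del c (Vir_one + fcst x * t) = del c Vir_one" for c x
      by (simp only: del_add del_cst del_t sm_zero add_0_right)
    thus ?thesis using that[OF Vir_1[folded 2]] Del_limit[OF fconv_Vir_trunc_1] unfolding 2 by simp
  next
    case 3
    show ?thesis using that[of "Vir_ge_two q"] Vir_2[OF 3(2)] Del_limit[OF fconv_Vir_trunc_ge_2[OF 3(2)]] unfolding 3(1) by blast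
  qed
qed

end

section \<open>Identification with the given operators and conclusion\<close>

lemma (in unit_series) W_inverse:
  "\<exists>V. neg_supp b V \<and> mul 1 (Wv b) V = lamb 0 \<and> mul 1 V (Wv b) = lamb 0 \<and> (\<forall>i. fdiff (V i))"
proof (rule inverse_exists[OF neg_W W_unit, where h = 1 and b = b])
  fix V
  assume V: "neg_supp b V" "mul 1 (Wv b) V = lamb 0" "mul 1 V (Wv b) = lamb 0"
    and P: "\<And>D P i. fderiv D P \<Longrightarrow> P (fsh (kap b) u * t) \<Longrightarrow> (\<And>i. P (Wv b i)) \<Longrightarrow> P (V i)"
  have "fdiff (V i)" for i
    by (rule P[OF fds.fderiv_axioms]) (intro fdiff_mult fdiff_sh fdiff_u fdiff_t fdiff_W)+
  with V show ?thesis by blast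
qed

context wave
begin

lemma Wop_rp: "Wop (coeff t) = rp (Wv True)"
  by (rule ext)
     (auto simp: Wop_def rp_def Gser_eq rdiv_Rep[OF ut] Wv_def rzero_Rep coeff_inject sg_def)

lemma Wbop_rp: "Wbop (coeff t) = rp (Wv False)"
  by (rule ext)
     (auto simp: Wbop_def rp_def Gbser_eq rdiv_Rep[OF ut] Wv_def rzero_Rep coeff_inject sg_def)

lemma inv_W_rp: "inv_mm (Wop (coeff t)) = rp (Wi True)" "inv_pp (Wbop (coeff t)) = rp (Wi False)"
  using inv_rp[OF neg_W W_unit Wi_neg W_Wi, of True] inv_rp[OF neg_W W_unit Wi_neg W_Wi, of False]
  by (simp_all add: Wop_rp Wbop_rp)

lemma Lk_rp: "Lk (coeff t) n = rp (B True n)" and Lm_rp: "Lm (coeff t) n = rp (B False n)"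
  by (simp_all add: Lk_def Lm_def inv_W_rp B_def sg_def) (simp_all add: Wop_rp Wbop_rp lam_rp opmul_rp)

lemma logL_rp: "logL (coeff t) = rp (sm (fcst (1/2)) (mul 1 (Wv True) (dop fds (Wi True)))
    + sm (fcst (-1/2)) (mul 1 (Wv False) (dop fds (Wi False))))"
  unfolding logL_def inv_W_rp by (simp only: Wop_rp Wbop_rp rp_rules)

lemma oppow_rp: "oppow (Lax k (coeff t)) n = rp (B True (int (k * n)))"
proof (induction n)
  case 0
  show ?case by (simp add: oppow_def lam_rp)
next
  case (Suc n)
  have "oppow (Lax k (coeff t)) (Suc n) = opmul (rp (B True (int k))) (oppow (Lax k (coeff t)) n)"
    by (simp add: oppow_def Lax_def Lk_rp)
  thus ?case unfolding Suc opmul_rp B_mul by simp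
qed

lemma A_rp: "opmul (opmul (Wop (coeff t)) (sLam (- n))) (inv_mm (Wop (coeff t))) = rp (A True (- n))"
  "opmul (opmul (Wbop (coeff t)) (sLam n)) (inv_pp (Wbop (coeff t))) = rp (A False (- n))"
  unfolding inv_W_rp by (simp_all add: Wop_rp Wbop_rp sLam_rp opmul_rp A_def sg_def)

end

context bigraded
begin

lemma logL_rp': "logL (coeff t) = rp logLop"
  by (simp add: logL_rp logLop_def Pd_def)

lemma MMb_rp: "MMb k m (coeff t) = rp M_op"
proof -
  have X: "(\<lambda>n. if n = 0 then (\<lambda>_. rzero) else
      opmul (opadd (opscale (1 / of_nat k + 1 / of_nat m) (opmap (rvar (X n)) (lam 0)))
                   (opscale (2 * of_nat n) (opmap (rvar (X n)) (logL (coeff t)))))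
            (oppow (Lax k (coeff t)) (n - 1))) = (\<lambda>n. rp (M_X' n))"
    by (rule ext) (simp only: M_X'_def M_X_def zero_rp oppow_rp logL_rp' rp_rules Lp_def if_rp)
  have T: "(\<lambda>n. if n = 0 then (\<lambda>_. rzero) else
      opadd (opscale (of_nat n / of_nat k) (opmap (rvar (T n)) (Lk (coeff t) (int n - int k))))
            (opscale (of_nat n / of_nat m) (opmap (rvar (TB n)) (Lm (coeff t) (int n - int m))))) = (\<lambda>n. rp (M_T' n))"
    by (rule ext) (simp only: M_T'_def M_T_def zero_rp Lk_rp Lm_rp rp_rules if_rp)
  show ?thesis
    unfolding MMb_def X T A_rp opsum_rp by (simp only: rp_rules M_op_def cK_def cM_def)
qed

end

theorem theorem4p8:
  fixes k m p :: nat and \<tau> :: R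
  assumes "1 \<le> k" and "1 \<le> m" and "is_tau k m \<tau>"
  shows "let a = opmul (oppow (Lax k \<tau>) p) (MMb k m \<tau>);
             q = rdiv (Vir k m p \<tau>) \<tau>
         in sdiv_minus (opscale (-1) (opmul (opminus a) (Wop \<tau>))) (Wop \<tau>)
              = (\<lambda>j. radd (Gser q j) (if j = 0 then rscale (-1) q else rzero))
          \<and> sdiv_plus (opmul (opplus a) (Wbop \<tau>)) (Wbop \<tau>)
              = (\<lambda>j. radd (Gbser q j) (if j = 0 then rscale (-1) q else rzero))"
proof -
  define t where "t = of_coeff \<tau>"
  have \<tau>: "\<tau> = coeff t" by (simp add: t_def of_coeff_inverse)
  note tau = assms(3)[unfolded is_tau_def \<tau>]
  obtain v where v: "rmul (coeff t) v = rone" using tau by blast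
  define u where "u = of_coeff v"
  have ut: "u * t = 1"
  proof -
    have "coeff (t * u) = coeff 1"
      using v by (simp add: u_def times_fser.rep_eq one_fser.rep_eq of_coeff_inverse)
    thus ?thesis by (simp add: coeff_inject mult.commute)
  qed
  have "smooth_s (coeff t \<alpha>)" for \<alpha> using tau by blast
  hence "coeff t \<alpha> differentiable (at s)" for \<alpha> s
    unfolding smooth_s_def by (metis funpow_0)
  hence "fdiff t" by (simp add: fdiff.rep_eq)
  then interpret unit_series t u using ut by unfold_locales
  have "\<exists>V. neg_supp b V \<and> mul 1 (Wv b) V = lamb 0 \<and> mul 1 V (Wv b) = lamb 0 \<and> (\<forall>i. fdiff (V i))" for b
    by (rule W_inverse)
  then obtain Wi where "\<And>b. neg_supp b (Wi b)" "\<And>b. mul 1 (Wv b) (Wi b) = lamb 0"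
    "\<And>b. mul 1 (Wi b) (Wv b) = lamb 0" "\<And>b i. fdiff (Wi b i)"
    by metis
  then interpret wave t u Wi by unfold_locales
  interpret flow t u Wi
  proof
    fix n :: nat and b c
    assume "1 \<le> n"
    hence "opmap (rdvar (T n)) (Wop (coeff t)) = opscale (-1) (opmul (opminus (Lk (coeff t) (int n))) (Wop (coeff t)))"
      "opmap (rdvar (T n)) (Wbop (coeff t)) = opmul (opplus (Lk (coeff t) (int n))) (Wbop (coeff t))"
      "opmap (rdvar (TB n)) (Wop (coeff t)) = opscale (-1) (opmul (opminus (Lm (coeff t) (int n))) (Wop (coeff t)))"
      "opmap (rdvar (TB n)) (Wbop (coeff t)) = opmul (opplus (Lm (coeff t) (int n))) (Wbop (coeff t))"
      using tau by blast+
    thus "dop (fdv (bv b n)) (Wv c) = sm (- of_int (sg c)) (mul 1 (proj c (B b (int n))) (Wv c))"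
      unfolding Lk_rp Lm_rp Wop_rp Wbop_rp rp_rules rp_inject
      by (cases b; cases c; simp add: sg_def bv_def fcst_minus)
  qed
  interpret bigraded t u Wi k m
  proof
    show "1 \<le> k" "1 \<le> m" by fact+
    show "B True (int k) = B False (int m)"
      using tau unfolding Lax_def Lk_rp Lm_rp rp_inject by blast
    fix n :: nat and c
    have l: "logL (coeff t) = rp logLop" by (simp add: logL_rp logLop_def Pd_def)
    have "opmap (dX n) (Wop (coeff t)) =
        opscale (-1) (opmul (opminus (opscale 2 (opmul (oppow (Lax k (coeff t)) n) (logL (coeff t))))) (Wop (coeff t)))"
      "opmap (dX n) (Wbop (coeff t)) =
        opmul (opplus (opscale 2 (opmul (oppow (Lax k (coeff t)) n) (logL (coeff t))))) (Wbop (coeff t))"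
      using tau by blast+
    thus "dop (fdX n) (Wv c) = sm (- of_int (sg c))
        (mul 1 (proj c (sm (fcst 2) (mul 1 (B True (int (k * n))) logLop))) (Wv c))"
      unfolding l oppow_rp Wop_rp Wbop_rp rp_rules rp_inject
      by (cases c; simp add: sg_def fcst_minus)
  qed
  let ?a = "mul 1 (Lp p) M_op"
  obtain w where w: "Vir k m p (coeff t) = coeff w" "\<And>c. Del c ?a = del c w"
    using Virasoro_del[of p] by blast
  let ?Q = "\<lambda>c j. Gs c (w * u) j - (if j = 0 then w * u else 0)"
  \<comment> \<open>\<open>?Q c\<close> is the claimed quotient. Its product with the symbol of the
    wave operator is \<open>u\<close> times \<open>Del\<close>, where \<open>u\<close> cancels the
    factor tau built into \<open>Del\<close>; boundedness then identifies it as the unique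
    quotient.\<close>
  have "mul 0 (?Q c) (Wv c) = sm (- of_int (sg c)) (mul 1 (proj c ?a) (Wv c))" for c
    unfolding quotient_symbol w(2)[symmetric] Del_def by (simp add: sm_sm mult.left_commute[of u] ut)
  moreover have "bd c (?Q c)" for c
    unfolding bd_def by (intro exI[of _ 0]) auto
  ultimately have S: "(if c then sdiv_minus (rp (sm (- of_int (sg c)) (mul 1 (proj c ?a) (Wv c)))) (rp (Wv c))
      else sdiv_plus (rp (sm (- of_int (sg c)) (mul 1 (proj c ?a) (Wv c)))) (rp (Wv c))) = rp (?Q c)" for c
    by (intro sdiv_rp[OF neg_W W_unit])
  have a: "opmul (oppow (Lax k (coeff t)) p) (MMb k m (coeff t)) = rp ?a"
    unfolding oppow_rp MMb_rp opmul_rp Lp_def ..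
  have Q: "(\<lambda>j. radd (Gser (coeff (w * u)) j) (if j = 0 then rscale (-1) (coeff (w * u)) else rzero)) = rp (?Q True)"
    "(\<lambda>j. radd (Gbser (coeff (w * u)) j) (if j = 0 then rscale (-1) (coeff (w * u)) else rzero)) = rp (?Q False)"
    by (auto simp: rp_def Gser_eq Gbser_eq Rep_rules fcst_minus fun_eq_iff)
  show ?thesis
    unfolding \<tau> Let_def a w(1) rdiv_Rep[OF ut] Q Wop_rp Wbop_rp rp_rules
    using S[of True] S[of False] by (simp add: sg_def fcst_minus)
qed

end
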